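(* Let $H$ be a limit sparse semigroup of genus $g$. If the Frobenius number $\ell_g$ of $H$ is even, then $H$ is a Weierstrass semigroup.
   Context: $\mathbb{N}$ is the set of natural numbers including $0$. A numerical semigroup $H\subseteq\mathbb{N}$ of genus $g\ge 1$ is a subset containing $0$, closed under addition, whose complement $\mathbb{N}\setminus H=\{1=\ell_1<\ell_2<\dots<\ell_g\}$ has exactly $g$ elements, called gaps; $\ell_g$ is the Frobenius number. $H$ is sparse if $\ell_i-\ell_{i-1}\le 2$ for all $i=2,\dots,g$. A sparse semigroup is a limit sparse semigroup if the number of indices $i\in\{1,\dots,g-1\}$ with $\ell_{i+1}-\ell_i=1$ equals the number of indices $i\in\{1,\dots,g-1\}$ with $\ell_{i+1}-\ell_i=2$; equivalently, $g=2\kappa-1$ where $\kappa:=2g-\ell_g$. A curve is a smooth projective curve over an algebraically closed field of characteristic zero. For a point $P$ of a curve $X$, the Weierstrass semigroup of $(X,P)$ is $H(P):=\{n\in\mathbb{N}: \dim H^0(X,\mathcal{O}_X((n-1)P))<\dim H^0(X,\mathcal{O}_X(nP))\}$, i.e. the set of $n$ for which there is a rational function on $X$ with pole divisor $nP$. A numerical semigroup is a Weierstrass semigroup if it equals $H(P)$ for some pair $(X,P)$. *)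

theory Defs
  imports
    "HOL-Computational_Algebra.Polynomial"
    "HOL-Library.Poly_Mapping"
    "HOL-Library.Function_Algebras"
    "HOL-Library.Extended_Nat"
begin

section \<open>Sparse and limit sparse numerical semigroups\<close>

definition numerical_semigroup :: "nat \<Rightarrow> nat set \<Rightarrow> bool" where
  "numerical_semigroup g H \<longleftrightarrow>
     g \<ge> 1 \<and> 0 \<in> H \<and> (\<forall>a\<in>H. \<forall>b\<in>H. a + b \<in> H) \<and> finite (- H) \<and> card (- H) = g"

text \<open>The gaps are numbered from 1: for \<open>1 \<le> i \<le> g\<close>, \<open>gap H i\<close> is the \<open>i\<close>-th smallest gap.\<close>

definition gap :: "nat set \<Rightarrow> nat \<Rightarrow> nat" where
  "gap H i = sorted_list_of_set (- H) ! (i - 1)"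

definition sparse_semigroup :: "nat \<Rightarrow> nat set \<Rightarrow> bool" where
  "sparse_semigroup g H \<longleftrightarrow>
     numerical_semigroup g H \<and> (\<forall>i\<in>{2..g}. gap H i - gap H (i - 1) \<le> 2)"

definition limit_sparse_semigroup :: "nat \<Rightarrow> nat set \<Rightarrow> bool" where
  "limit_sparse_semigroup g H \<longleftrightarrow>
     sparse_semigroup g H \<and>
     card {i \<in> {1..g - 1}. gap H (i + 1) - gap H i = 1} =
     card {i \<in> {1..g - 1}. gap H (i + 1) - gap H i = 2}"


section \<open>Homogeneous polynomials and projective space\<close>

text \<open>A monomial is its finitely supported exponent vector; a polynomial is a finitely
  supported family of coefficients indexed by monomials.\<close>

type_synonym 'k mpoly = "(nat \<Rightarrow>\<^sub>0 nat) \<Rightarrow>\<^sub>0 'k"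

definition mpoly_eval :: "(nat \<Rightarrow> 'k::field) \<Rightarrow> 'k mpoly \<Rightarrow> 'k" where
  "mpoly_eval v p =
     (\<Sum>m\<in>Poly_Mapping.keys p. Poly_Mapping.lookup p m *
        (\<Prod>i\<in>Poly_Mapping.keys m. v i ^ Poly_Mapping.lookup m i))"

text \<open>Forms of degree \<open>d\<close> in the variables \<open>x\<^sub>0, \<dots>, x\<^sub>n\<close> (including the zero polynomial).\<close>

definition forms :: "nat \<Rightarrow> nat \<Rightarrow> 'k::field mpoly set" where
  "forms n d =
     {p. \<forall>m\<in>Poly_Mapping.keys p.
           Poly_Mapping.keys m \<subseteq> {..n} \<and> (\<Sum>i\<in>Poly_Mapping.keys m. Poly_Mapping.lookup m i) = d}"

text \<open>A point of projective \<open>n\<close>-space is the set of all its vectors of homogeneous coordinates.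
  Coordinates are indexed by all of \<open>nat\<close> and vanish beyond index \<open>n\<close>.\<close>

type_synonym 'k ppoint = "(nat \<Rightarrow> 'k) set"

definition proj_space :: "nat \<Rightarrow> 'k::field ppoint set" where
  "proj_space n =
     {{(\<lambda>i. c * v i) |c. c \<noteq> 0} |v. (\<forall>i>n. v i = 0) \<and> (\<exists>i\<le>n. v i \<noteq> 0)}"

definition zariski_closed :: "nat \<Rightarrow> 'k::field ppoint set \<Rightarrow> bool" where
  "zariski_closed n Z \<longleftrightarrow>
     (\<exists>S. (\<forall>p\<in>S. \<exists>d. p \<in> forms n d) \<and>
          Z = {Q \<in> proj_space n. \<forall>p\<in>S. \<forall>v\<in>Q. mpoly_eval v p = 0})"

definition irreducible_closed :: "nat \<Rightarrow> 'k::field ppoint set \<Rightarrow> bool" where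
  "irreducible_closed n Z \<longleftrightarrow>
     zariski_closed n Z \<and> Z \<noteq> {} \<and>
     (\<forall>A B. zariski_closed n A \<and> zariski_closed n B \<and> Z \<subseteq> A \<union> B \<longrightarrow> Z \<subseteq> A \<or> Z \<subseteq> B)"

text \<open>Krull dimension of the topological space \<open>X\<close>: the supremum of the lengths of strictly
  increasing chains of irreducible closed subsets.\<close>

definition zariski_dim :: "nat \<Rightarrow> 'k::field ppoint set \<Rightarrow> enat" where
  "zariski_dim n X =
     Sup {enat d |d. \<exists>C. (\<forall>i\<le>d. irreducible_closed n (C i) \<and> C i \<subseteq> X) \<and>
                         (\<forall>i<d. C i \<subset> C (Suc i))}"


section \<open>Local rings, smooth projective curves\<close>

text \<open>\<open>near n X Q \<phi>\<close>: \<open>\<phi>\<close> holds on some Zariski open neighbourhood of \<open>Q\<close> in the closed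
  set \<open>X\<close>.\<close>

definition near :: "nat \<Rightarrow> 'k::field ppoint set \<Rightarrow> 'k ppoint \<Rightarrow> ('k ppoint \<Rightarrow> bool) \<Rightarrow> bool" where
  "near n X Q \<phi> \<longleftrightarrow> (\<exists>U\<subseteq>X. zariski_closed n (X - U) \<and> Q \<in> U \<and> (\<forall>R\<in>U. \<phi> R))"

text \<open>A function is regular at \<open>Q\<close> if near \<open>Q\<close> it is a quotient of two forms of the same degree,
  the denominator having no zero there. The elements of the local ring at \<open>Q\<close> are the functions
  regular at \<open>Q\<close>, taken modulo equality near \<open>Q\<close>.\<close>

definition regular_at :: "nat \<Rightarrow> 'k::field ppoint set \<Rightarrow> ('k ppoint \<Rightarrow> 'k) \<Rightarrow> 'k ppoint \<Rightarrow> bool" where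
  "regular_at n X f Q \<longleftrightarrow>
     (\<exists>d. \<exists>a\<in>forms n d. \<exists>b\<in>forms n d.
        near n X Q (\<lambda>R. \<forall>v\<in>R. mpoly_eval v b \<noteq> 0 \<and> f R = mpoly_eval v a / mpoly_eval v b))"

text \<open>The functions \<open>t\<^sub>0, \<dots>, t\<^bsub>d-1\<^esub>\<close> generate the maximal ideal of the local ring at \<open>Q\<close>.\<close>

definition generate_maximal_ideal ::
  "nat \<Rightarrow> 'k::field ppoint set \<Rightarrow> 'k ppoint \<Rightarrow> nat \<Rightarrow> (nat \<Rightarrow> 'k ppoint \<Rightarrow> 'k) \<Rightarrow> bool" where
  "generate_maximal_ideal n X Q d t \<longleftrightarrow>
     (\<forall>i<d. regular_at n X (t i) Q \<and> t i Q = 0) \<and>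
     (\<forall>s. regular_at n X s Q \<and> s Q = 0 \<longrightarrow>
        (\<exists>u. (\<forall>i<d. regular_at n X (u i) Q) \<and>
             near n X Q (\<lambda>R. s R = (\<Sum>i<d. u i R * t i R))))"

text \<open>Smoothness over an algebraically closed field is regularity of the local rings at the
  (closed) points. Each of these has Krull dimension \<open>d = dim X\<close>, so it is regular iff its
  maximal ideal is generated by \<open>d\<close> elements.\<close>

definition smooth_projective_variety :: "nat \<Rightarrow> nat \<Rightarrow> 'k::field ppoint set \<Rightarrow> bool" where
  "smooth_projective_variety n d X \<longleftrightarrow>
     irreducible_closed n X \<and> zariski_dim n X = enat d \<and>
     (\<forall>Q\<in>X. \<exists>t. generate_maximal_ideal n X Q d t)"

abbreviation smooth_projective_curve :: "nat \<Rightarrow> 'k::field ppoint set \<Rightarrow> bool" where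
  "smooth_projective_curve n X \<equiv> smooth_projective_variety n 1 X"


section \<open>Weierstrass semigroups\<close>

text \<open>On a smooth curve: \<open>ord\<^sub>P f \<ge> m\<close>, for a function \<open>f\<close> regular on a punctured neighbourhood
  of \<open>P\<close>; that is, \<open>f = u t\<^sup>m\<close> with \<open>t\<close> a uniformizer and \<open>u\<close> regular at \<open>P\<close>. The value of
  \<open>f\<close> at \<open>P\<close> itself is irrelevant.\<close>

definition ord_ge :: "nat \<Rightarrow> 'k::field ppoint set \<Rightarrow> 'k ppoint \<Rightarrow> ('k ppoint \<Rightarrow> 'k) \<Rightarrow> int \<Rightarrow> bool" where
  "ord_ge n X P f m \<longleftrightarrow>
     (\<exists>t u. generate_maximal_ideal n X P 1 (\<lambda>_. t) \<and> regular_at n X u P \<and>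
            near n X P (\<lambda>R. R \<noteq> P \<longrightarrow> f R = u R * t R powi m))"

text \<open>The space of global sections of \<open>O\<^sub>X(mP)\<close>: rational functions on \<open>X\<close> that are regular away
  from \<open>P\<close> and satisfy \<open>ord\<^sub>P f \<ge> -m\<close>. Such a rational function is determined by its values on
  the dense open subset \<open>X - {P}\<close>, so it is represented by the function with these values,
  extended by 0 (at \<open>P\<close> as well as outside \<open>X\<close>).\<close>

definition H0 :: "nat \<Rightarrow> 'k::field ppoint set \<Rightarrow> 'k ppoint \<Rightarrow> int \<Rightarrow> ('k ppoint \<Rightarrow> 'k) set" where
  "H0 n X P m =
     {f. (\<forall>R. R \<notin> X - {P} \<longrightarrow> f R = 0) \<and> (\<forall>Q\<in>X - {P}. regular_at n X f Q) \<and> ord_ge n X P f (- m)}"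

interpretation fun_space: vector_space "\<lambda>(c::'k::field) (f :: 'b \<Rightarrow> 'k) x. c * f x"
  by unfold_locales (auto simp: fun_eq_iff algebra_simps)

definition weierstrass_semigroup_at :: "nat \<Rightarrow> 'k::field ppoint set \<Rightarrow> 'k ppoint \<Rightarrow> nat set" where
  "weierstrass_semigroup_at n X P =
     {k. fun_space.dim (H0 n X P (int k - 1)) < fun_space.dim (H0 n X P (int k))}"

text \<open>The base field is the type argument.\<close>

definition weierstrass_semigroup :: "'k::{alg_closed_field, field_char_0} itself \<Rightarrow> nat set \<Rightarrow> bool" where
  "weierstrass_semigroup K H \<longleftrightarrow>
     (\<exists>n (X :: 'k ppoint set). \<exists>P\<in>X.
        smooth_projective_curve n X \<and> H = weierstrass_semigroup_at n X P)"

end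

theory Submission
  imports Defs
begin

text \<open>
  Let \<open>F\<close> be the even Frobenius number of the limit sparse semigroup \<open>H\<close>. Nongaps below \<open>F\<close> are
  isolated, and there are as many pairs of consecutive gaps as positive nongaps below \<open>F\<close>. Let
  \<open>F - 1, F - 3, \<dots>\<close> be the last run of \<open>\<lambda>\<close> nongaps. As \<open>F - 2 \<lambda>\<close> and its predecessor are gaps,
  subtracting the nongaps below them yields all but \<open>\<lambda> - 1\<close> of these pairs. The gaps below the
  multiplicity \<open>m\<close> then force \<open>m \<le> 2 \<lambda> + 1\<close>; since \<open>F\<close> is even this leaves \<open>m = 2 \<lambda> + 1\<close>, and a
  closer look at the pairs leaves \<open>m = 3\<close>. So \<open>H\<close> is generated by \<open>3\<close>, \<open>3 k + 2\<close> and \<open>3 k + 4\<close>.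

  This \<open>H\<close> is the semigroup of the totally ramified point at infinity of the cyclic trigonal curve
  \<open>y\<^sup>2 = b z\<close>, \<open>y z = a b\<close>, \<open>z\<^sup>2 = a y\<close>, where \<open>a\<close> and \<open>b\<close> are coprime squarefree polynomials in \<open>x\<close>
  of degrees \<open>k + 2\<close> and \<open>k\<close>: there \<open>x, y, z\<close> have poles of orders \<open>3\<close>, \<open>3 k + 2\<close>, \<open>3 k + 4\<close>. The
  coordinate ring is free over the polynomials in \<open>x\<close> with basis \<open>1, y, z\<close>, and the degree of the
  norm of \<open>p + q y + r z\<close> is its pole order, because the three terms contribute degrees that are
  distinct modulo 3. The curve is embedded by \<open>1, x, \<dots>, x\<^bsup>k+2\<^esup>, y, x y, z\<close>. Its proper closed subsets
  are finite, which gives irreducibility, dimension 1, and a simple description of local rings.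
\<close>

section \<open>Limit sparse semigroups with even Frobenius number\<close>

text \<open>The curve is the normalization of the plane curve \<open>y^3 = a * b^2\<close>, obtained
  by adjoining \<open>z = a * b / y\<close>. For \<open>k \<ge> 1\<close> the plane curve would not
  do, since 3 and 3 k + 2 do not generate 3 k + 4. As \<open>z^3 = a^2 * b\<close>, the degrees of
  \<open>a * b^2\<close> and \<open>a^2 * b\<close> must be 3 k + 2 and 3 k + 4, and this forces the
  degrees of \<open>a\<close> and \<open>b\<close>. That the required pole orders occur is the easy
  half. For the converse, every function regular away from infinity must be recovered as a triple,
  although regularity only gives fractions of forms that vary from point to point. Conjugates
  provide one denominator in \<open>x\<close>, whose linear factors cancel one at a time. Pole
  orders are handled without valuations: the norm makes \<open>wt\<close> additive, so the order of
  a fraction is read off from the weights in a polynomial identity. In the combinatorial part,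
  \<open>m = 2 \<lambda> + 1\<close> with \<open>\<lambda> \<ge> 2\<close> makes the count of pairs
  tight: every pair from \<open>m\<close> on then comes from a nongap. This rigidity produces two
  nongaps whose sum is one of the gaps \<open>F - 2 i\<close> of the last run.\<close>

lemma card_nonadjacent_le:
  fixes W :: "nat set"
  assumes "W \<subseteq> {1..N}" and "\<And>p. p \<in> W \<Longrightarrow> Suc p \<notin> W"
  shows "card W \<le> (N + 1) div 2"
proof -
  \<comment> \<open>The numbers \<open>2 * j - 1\<close> and \<open>2 * j\<close> share the value
    \<open>j\<close>, and a set without neighbours contains at most one of them.\<close>
  let ?f = "\<lambda>p::nat. (p + 1) div 2"
  have "inj_on ?f W"
  proof (rule inj_onI)
    fix p q assume pq: "p \<in> W" "q \<in> W" "?f p = ?f q"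
    then have "p = q \<or> p = Suc q \<or> q = Suc p" by presburger
    with pq assms(2) show "p = q" by blast
  qed
  moreover have "?f ` W \<subseteq> {1..(N + 1) div 2}"
    using assms(1) by (auto simp: div_le_mono Suc_le_eq div_greater_zero_iff)
  ultimately have "card W \<le> card {1..(N + 1) div 2}"
    by (metis card_image card_mono finite_atLeastAtMost)
  then show ?thesis by simp
qed

lemma even_limit_sparse_structure:
  fixes H :: "nat set" and F :: nat
  assumes zero: "0 \<in> H" and add: "\<And>a b. a \<in> H \<Longrightarrow> b \<in> H \<Longrightarrow> a + b \<in> H"
    and F: "F \<notin> H" and big: "\<And>n. F < n \<Longrightarrow> n \<in> H" and ev: "even F"
    and nonadj: "\<And>n. n \<in> H \<Longrightarrow> n < F \<Longrightarrow> Suc n \<notin> H"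
    and leaps: "card {p. p \<notin> H \<and> Suc p \<notin> H} = card {n \<in> H. 0 < n \<and> n < F}"
  shows "\<exists>k\<ge>1. H = {n. 3 dvd n \<or> 3 * k + 2 \<le> n}"
proof -
  have sub: "n - s \<notin> H" if "s \<in> H" "n \<notin> H" "s \<le> n" for n s
    using add[of "n - s" s] that by auto
  have mult: "j * s \<in> H" if "s \<in> H" for j s
    using that by (induction j) (auto intro: add zero)
  have one: "1 \<notin> H" using mult[of 1 F] F by auto
  have F2: "2 \<le> F" using F zero ev by (cases F) (auto simp: Suc_le_eq elim!: oddE intro!: Nat.gr0I)
  \<comment> \<open>The guard \<open>2 * j + 1 \<le> F\<close> matters: truncated subtraction would
    otherwise end in 0, which lies in \<open>H\<close>, and the run would never stop. It fails for
    \<open>j = F\<close>, so the minimum exists.\<close>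
  define lam where "lam = (LEAST j. \<not> (2 * j + 1 \<le> F \<and> F - 1 - 2 * j \<in> H))"
  have run: "2 * i + 1 \<le> F" "F - 1 - 2 * i \<in> H" if "i < lam" for i
    using not_less_Least[OF that[unfolded lam_def]] by auto
  have lam_end: "\<not> (2 * lam + 1 \<le> F \<and> F - 1 - 2 * lam \<in> H)"
    unfolding lam_def by (rule LeastI[of _ F]) auto
  have lamF: "2 * lam + 2 \<le> F"
  proof (cases lam)
    case 0 then show ?thesis using F2 by simp
  next
    case (Suc l)
    have "2 * l + 1 \<le> F" "F - 1 - 2 * l \<in> H" using run[of l] Suc by auto
    moreover have "F - 1 - 2 * l \<noteq> 1" using calculation(2) one by metis
    ultimately have "2 * l + 1 \<le> F" "F - 1 - 2 * l \<noteq> 1" by auto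
    then have "2 * l + 4 \<le> F" using ev by presburger
    then show ?thesis using Suc by simp
  qed
  define Fh where "Fh = F - 2 * lam"
  have Fh2: "2 \<le> Fh" "Fh \<le> F" using lamF by (auto simp: Fh_def)
  have Fh1: "Fh - 1 \<notin> H"
  proof -
    have "F - 1 - 2 * lam = Fh - 1" by (simp add: Fh_def)
    then show ?thesis using lam_end lamF by simp
  qed
  have evgap: "F - 2 * i \<notin> H" if "i \<le> lam" for i
  proof (cases i)
    case 0 then show ?thesis using F by simp
  next
    case (Suc l)
    have "F - 1 - 2 * l = Suc (F - 2 * i)" using Suc lamF that by simp
    then have "Suc (F - 2 * i) \<in> H" using run(2)[of l] Suc that by auto
    then show ?thesis using nonadj[of "F - 2 * i"] Suc F2 by auto
  qed
  have Fh0: "Fh \<notin> H" using evgap[of lam] by (simp add: Fh_def)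
  define L where "L = {p. p \<notin> H \<and> Suc p \<notin> H}"
  have finL: "finite L"
    by (rule finite_subset[of _ "{..F}"]) (auto simp: L_def intro: ccontr big)
  define Sh where "Sh = {n \<in> H. n < Fh}"
  \<comment> \<open>Adding a nongap \<open>s\<close> to \<open>Fh - 1 - s\<close> or to
    \<open>Fh - s\<close> gives one of the gaps \<open>Fh - 1\<close> and \<open>Fh\<close>, so both
    are gaps and form a pair.\<close>
  define A where "A = (\<lambda>s. Fh - 1 - s) ` Sh"
  have finSh: "finite Sh" by (simp add: Sh_def)
  have Shle: "s \<le> Fh - 2" if "s \<in> Sh" for s
    using that Fh1 by (cases "s = Fh - 1") (auto simp: Sh_def)
  have AD: "Fh - 1 - p \<in> H" "p \<le> Fh - 1" if "p \<in> A" for p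
    using that Shle Fh2 by (auto simp: A_def Sh_def)
  have AL: "A \<subseteq> L"
  proof
    fix p assume "p \<in> A"
    then obtain s where s: "s \<in> Sh" "p = Fh - 1 - s" by (auto simp: A_def)
    have "s \<le> Fh - 2" by (rule Shle[OF s(1)])
    then have "Suc p = Fh - s" using s Fh2 by simp
    then show "p \<in> L"
      using s sub[of s "Fh - 1"] sub[of s Fh] Fh1 Fh0 Shle[OF s(1)] by (auto simp: L_def Sh_def)
  qed
  have cardA: "card A = card Sh" unfolding A_def
    by (rule card_image) (auto intro!: inj_onI dest!: Shle)
  have cardS: "card {n \<in> H. n < F} = card Sh + lam"
  proof -
    have "{n \<in> H. n < F} = Sh \<union> (\<lambda>i. F - 1 - 2 * i) ` {..<lam}"
    proof (intro set_eqI iffI)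
      fix n assume n: "n \<in> {n \<in> H. n < F}"
      show "n \<in> Sh \<union> (\<lambda>i. F - 1 - 2 * i) ` {..<lam}"
      proof (cases "n < Fh")
        case False
        have "odd n"
        proof
          assume "even n"
          then have "n = F - 2 * ((F - n) div 2)" using n ev by auto
          moreover have "(F - n) div 2 \<le> lam" using False by (auto simp: Fh_def)
          ultimately show False using evgap n by (metis (no_types, lifting) mem_Collect_eq)
        qed
        define i where "i = (F - 1 - n) div 2"
        have "n = F - 1 - 2 * i" using n ev \<open>odd n\<close> by (auto simp: i_def elim!: oddE evenE)
        moreover have "i < lam" using False \<open>odd n\<close> n ev lamF
          by (auto simp: i_def Fh_def elim!: oddE evenE)
        ultimately show ?thesis by blast
      qed (use n in \<open>auto simp: Sh_def\<close>)
    next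
      fix n assume "n \<in> Sh \<union> (\<lambda>i. F - 1 - 2 * i) ` {..<lam}"
      then show "n \<in> {n \<in> H. n < F}" using Fh2 F2 run by (auto simp: Sh_def)
    qed
    moreover have "Sh \<inter> (\<lambda>i. F - 1 - 2 * i) ` {..<lam} = {}"
      using lamF by (auto simp: Sh_def Fh_def)
    moreover have "inj_on (\<lambda>i. F - 1 - 2 * i) {..<lam}"
      using lamF by (auto intro!: inj_onI)
    ultimately show ?thesis using finSh by (simp add: card_Un_disjoint card_image)
  qed
  have "{n \<in> H. n < F} = insert 0 {n \<in> H. 0 < n \<and> n < F}" using zero F2 by auto
  then have "card {n \<in> H. n < F} = Suc (card {n \<in> H. 0 < n \<and> n < F})" by simp
  \<comment> \<open>The hypothesis counts positive nongaps, whereas \<open>cardS\<close> includes 0;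
    this accounts for the 1 on the left.\<close>
  then have cardL: "card L + 1 = card Sh + lam" using leaps cardS by (simp add: L_def)
  have "card A \<le> card L" using AL finL card_mono by blast
  then have lam1: "1 \<le> lam" using cardA cardL by simp
  have cardLA: "card (L - A) = lam - 1"
    using card_Diff_subset[OF finite_subset[OF AL finL] AL] cardL cardA by simp
  define m where "m = (LEAST n. n \<in> H \<and> 0 < n)"
  have "m \<in> H \<and> 0 < m" unfolding m_def by (rule LeastI[of _ "F + 1"]) (simp add: big)
  then have m: "m \<in> H" "0 < m" by auto
  have mmin: "n \<notin> H" if "0 < n" "n < m" for n
    using that not_less_Least[of n "\<lambda>n. n \<in> H \<and> 0 < n"] by (auto simp: m_def)
  have multm: "j * m \<in> H" for j using mult m by blast
  have "m \<noteq> 1" using one m by metis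
  moreover have "m \<noteq> 2" using multm[of "F div 2"] ev F by auto
  ultimately have m3: "3 \<le> m" using m by simp
  have bottom: "{1..m - 2} \<subseteq> L" using mmin m3 by (auto simp: L_def)
  define W where "W = {1..m - 2} \<inter> A"
  \<comment> \<open>Neighbours in \<open>A\<close> are reflections of neighbouring nongaps below
    \<open>F\<close>.\<close>
  have Wna: "Suc p \<notin> W" if "p \<in> W" for p
  proof
    assume q: "Suc p \<in> W"
    have "Fh - 1 - Suc p \<in> H" "Suc p \<le> Fh - 1" "Fh - 1 - p \<in> H"
      using AD q that by (auto simp: W_def)
    moreover have "Fh - 1 - p = Suc (Fh - 1 - Suc p)" using calculation(2) by simp
    ultimately show False using nonadj[of "Fh - 1 - Suc p"] Fh2 by auto
  qed
  have cardW: "card W \<le> (m - 1) div 2"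
    using card_nonadjacent_le[of W "m - 2"] Wna m3 by (auto simp: W_def)
  have "{1..m - 2} - A \<subseteq> L - A" using bottom by blast
  then have "card ({1..m - 2} - A) \<le> lam - 1" using cardLA finL by (metis card_mono finite_Diff)
  moreover have cbot: "card ({1..m - 2} - A) = m - 2 - card W"
    by (simp add: W_def card_Diff_subset_Int)
  ultimately have mlam': "m - 2 - card W \<le> lam - 1" by simp
  then have mlam: "m \<le> 2 * lam + 1" using cardW lam1 m3 by linarith
  \<comment> \<open>For even \<open>m\<close> the largest multiple of \<open>m\<close> up to
    \<open>F\<close> lies at the even distance \<open>F mod m \<le> 2 * lam\<close> below
    \<open>F\<close>, where there are only gaps.\<close>
  have oddm: "odd m"
  proof
    assume "even m"
    then have "even (F mod m)" using ev by (simp add: dvd_mod)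
    moreover have "F mod m < m" using m by simp
    ultimately have "(F mod m) div 2 \<le> lam" using mlam by (auto elim!: evenE)
    then have "F - 2 * ((F mod m) div 2) \<notin> H" by (rule evgap)
    then have "F - F mod m \<notin> H" using \<open>even (F mod m)\<close> by simp
    then show False using multm[of "F div m"] by (simp add: minus_mod_eq_div_mult)
  qed
  \<comment> \<open>A smaller odd \<open>m\<close> would put \<open>F - m\<close> into the last run,
    and then \<open>F = (F - m) + m\<close> would be a nongap.\<close>
  have m_eq: "m = 2 * lam + 1"
  proof (rule ccontr)
    assume "m \<noteq> 2 * lam + 1"
    then have i: "(m - 1) div 2 < lam" "2 * ((m - 1) div 2) = m - 1"
      using mlam oddm lam1 by (auto elim!: oddE)
    have "m \<le> F" "F - m \<in> H" using run[OF i(1)] i(2) m by auto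
    then show False using add[of "F - m" m] m F by simp
  qed
  have "lam = 1"
  proof (rule ccontr)
    assume "lam \<noteq> 1"
    then have lam2: "2 \<le> lam" using lam1 by simp
    \<comment> \<open>Both estimates are now equalities: \<open>W\<close> is as large as a set
      without neighbours can be, and the \<open>lam - 1\<close> pairs outside \<open>A\<close> all
      lie in \<open>{1..m - 2}\<close>. Hence every pair from \<open>m\<close> on belongs to
      \<open>A\<close>.\<close>
    have cW: "card W = lam" using mlam' cardW m_eq lam2 by auto
    have "L - A = {1..m - 2} - A"
    proof (rule sym, rule card_subset_eq)
      show "card ({1..m - 2} - A) = card (L - A)" using cbot cW m_eq cardLA by simp
    qed (use finL bottom in auto)
    have LA: "p \<in> A" if "p \<in> L" "m \<le> p" for p
    proof (rule ccontr)
      assume "p \<notin> A"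
      then have "p \<in> {1..m - 2} - A" using that \<open>L - A = {1..m - 2} - A\<close> by blast
      then show False using that m by auto
    qed
    \<comment> \<open>The only subset of \<open>{1..2 * lam - 1}\<close> with \<open>lam\<close>
      elements and no neighbours is the set of odd numbers; its largest element is
      \<open>m - 2\<close>.\<close>
    have "m - 2 \<in> W"
    proof (rule ccontr)
      assume n: "m - 2 \<notin> W"
      have "p \<in> {1..2 * lam - 2}" if "p \<in> W" for p
      proof -
        have "p \<noteq> m - 2" using n that by blast
        then show ?thesis using that m_eq by (auto simp: W_def)
      qed
      then have "card W \<le> (2 * lam - 2 + 1) div 2" by (intro card_nonadjacent_le Wna) auto
      then show False using cW lam2 by linarith
    qed
    then have "m - 2 \<le> Fh - 1" "Fh - 1 - (m - 2) \<in> H" using AD by (auto simp: W_def)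
    then have lam4: "4 * lam \<le> F" and "F - 4 * lam \<in> H" using m_eq Fh2 lam2 by (auto simp: Fh_def)
    \<comment> \<open>\<open>T\<close> is the nongap that reflects to \<open>m - 2\<close>. Below
      it, \<open>T - 3\<close> turns out to be the next nongap; this makes \<open>m + 2\<close> a
      gap and \<open>m + 3\<close> a nongap. Then \<open>T + (m + 3)\<close> hits the gap
      \<open>F - 2 * (lam - 2)\<close>.\<close>
    define T where "T = F - 4 * lam"
    have T: "T \<in> H" using \<open>F - 4 * lam \<in> H\<close> by (simp add: T_def)
    have "T \<noteq> 0"
    proof
      assume "T = 0"
      then have "Fh < m" using lam4 m_eq by (simp add: T_def Fh_def)
      then have "Sh \<subseteq> {0}" using mmin by (auto simp: Sh_def intro: ccontr)
      then have "card Sh \<le> 1" by (metis card_mono finite.emptyI finite.insertI card_insert_if card.empty One_nat_def equals0D)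
      moreover have "card W \<le> card A" unfolding W_def by (rule card_mono) (use finSh in \<open>auto simp: A_def\<close>)
      ultimately show False using cardA cW lam2 by simp
    qed
    have "even T" using ev by (simp add: T_def)
    have "m \<le> T" using mmin[of T] T \<open>T \<noteq> 0\<close> by force
    moreover have "T \<noteq> m" using \<open>even T\<close> oddm by auto
    moreover have "T \<noteq> m + 1"
      using nonadj[of m] m T \<open>m \<le> T\<close> lam2 by (auto simp: T_def)
    moreover have "T \<noteq> m + 2" using \<open>even T\<close> oddm by auto
    ultimately have Tm: "m + 3 \<le> T" by simp
    have TF: "T + 8 \<le> F" using lam4 lam2 by (simp add: T_def)
    have "T - 1 < F" "Suc (T - 1) = T" using Tm TF by auto
    then have T1: "T - 1 \<notin> H" using nonadj[of "T - 1"] T by auto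
    have T2: "T - 2 \<notin> H"
    proof
      assume "T - 2 \<in> H"
      then have "T - 2 + m \<in> H" using add m by blast
      moreover have "T - 2 + m = Fh - 1" using Tm m_eq by (simp add: T_def Fh_def)
      ultimately show False using Fh1 by simp
    qed
    \<comment> \<open>Otherwise \<open>T - 3\<close> and \<open>T - 2\<close> would be neighbouring
      elements of \<open>L\<close> above \<open>m\<close>, hence of \<open>A\<close>, which has no
      neighbours.\<close>
    have T3: "T - 3 \<in> H"
    proof (rule ccontr)
      assume "T - 3 \<notin> H"
      moreover have "Suc (T - 3) = T - 2" "Suc (T - 2) = T - 1" using Tm by auto
      ultimately have "T - 3 \<in> L" "T - 2 \<in> L" using T1 T2 by (auto simp: L_def)
      then have "T - 3 \<in> A" "T - 2 \<in> A" using LA Tm by auto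
      then have "Fh - 1 - (T - 3) \<in> H" "Fh - 1 - (T - 2) \<in> H" "T - 2 \<le> Fh - 1" using AD by auto
      moreover have "Fh - 1 - (T - 3) = Suc (Fh - 1 - (T - 2))" using calculation(3) Tm by simp
      moreover have "Fh - 1 - (T - 2) < F" using Fh2 by linarith
      ultimately show False using nonadj by metis
    qed
    have m2: "m + 2 \<notin> H"
    proof
      assume "m + 2 \<in> H"
      then have "T - 3 + (m + 2) \<in> H" using add T3 by blast
      moreover have "T - 3 + (m + 2) = Fh" using Tm m_eq by (simp add: T_def Fh_def)
      ultimately show False using Fh0 by simp
    qed
    have "m + 3 \<in> H"
    proof (rule ccontr)
      assume "m + 3 \<notin> H"
      then have "m + 2 \<in> L" using m2 by (simp add: L_def numeral_3_eq_3)
      then have "Fh - 1 - (m + 2) \<in> H" using LA AD by auto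
      moreover have "Fh - 1 - (m + 2) = T - 4" using m_eq by (simp add: T_def Fh_def)
      ultimately have "T - 4 \<in> H" by simp
      moreover have "Suc (T - 4) = T - 3" "T - 4 < F" using Tm m3 TF by linarith+
      ultimately show False using nonadj T3 by metis
    qed
    then have "T + (m + 3) \<in> H" using add T by blast
    moreover have "T + (m + 3) = F - 2 * (lam - 2)" using m_eq lam2 lam4 by (simp add: T_def)
    ultimately show False using evgap[of "lam - 2"] by simp
  qed
  then have "m = 3" using m_eq by simp
  then have three: "n \<in> H" if "3 dvd n" for n
    using multm[of "n div 3"] that by simp
  have "F - 1 \<in> H" using run(2)[of 0] \<open>lam = 1\<close> by simp
  have "F mod 3 \<noteq> 0" using three F by (auto simp: mod_eq_0_iff_dvd)
  moreover have "F mod 3 \<noteq> 2"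
  proof
    assume a: "F mod 3 = 2"
    then have "3 dvd F - 2" by presburger
    then have "F - 2 \<in> H" by (rule three)
    moreover have "Suc (F - 2) = F - 1" using F2 by simp
    ultimately show False using nonadj[of "F - 2"] \<open>F - 1 \<in> H\<close> F2 by simp
  qed
  ultimately have F1: "F mod 3 = 1" by presburger
  \<comment> \<open>With \<open>F = 3 * k + 1\<close>, a nongap below \<open>F\<close> that is not a
    multiple of 3 would be a neighbour of such a multiple, hence of a nongap.\<close>
  have "H = {n. 3 dvd n \<or> 3 * (F div 3) + 2 \<le> n}"
  proof (intro set_eqI iffI)
    fix n assume n: "n \<in> H"
    show "n \<in> {n. 3 dvd n \<or> 3 * (F div 3) + 2 \<le> n}"
    proof (rule ccontr)
      assume c: "n \<notin> {n. 3 dvd n \<or> 3 * (F div 3) + 2 \<le> n}"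
      then have "n \<le> F" "\<not> 3 dvd n" using F1 by (auto, presburger)
      then have nF: "n < F" using n F by (cases "n = F") auto
      have "3 dvd n - 1 \<and> n \<noteq> 0 \<or> 3 dvd Suc n" using \<open>\<not> 3 dvd n\<close> by presburger
      then show False
      proof
        assume a: "3 dvd n - 1 \<and> n \<noteq> 0"
        then have "n - 1 \<in> H" "Suc (n - 1) = n" using three by auto
        then show False using nonadj[of "n - 1"] n nF by auto
      next
        assume "3 dvd Suc n"
        then show False using three nonadj n nF by blast
      qed
    qed
  next
    fix n assume "n \<in> {n. 3 dvd n \<or> 3 * (F div 3) + 2 \<le> n}"
    moreover have "F < n" if "3 * (F div 3) + 2 \<le> n" using that F1 by presburger
    ultimately show "n \<in> H" using three big by auto
  qed
  moreover have "1 \<le> F div 3" using F1 F2 by presburger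
  ultimately show ?thesis by blast
qed

section \<open>From numbered gaps to sets of gaps and nongaps\<close>

lemma sorted_list_of_set_consecutive:
  fixes G :: "nat set"
  assumes "finite G" "p \<in> G" "q \<in> G" "p < q" and "\<And>x. p < x \<Longrightarrow> x < q \<Longrightarrow> x \<notin> G"
  obtains i where "Suc i < card G" "sorted_list_of_set G ! i = p" "sorted_list_of_set G ! Suc i = q"
proof -
  let ?xs = "sorted_list_of_set G"
  have len: "length ?xs = card G" and set: "set ?xs = G"
    using assms(1) by simp_all
  have less: "?xs ! i < ?xs ! j" if "i < j" "j < card G" for i j
    using that sorted_wrt_nth_less[OF strict_sorted_list_of_set] len by metis
  obtain i j where ij: "i < card G" "?xs ! i = p" "j < card G" "?xs ! j = q"
    using assms(2,3) len set by (metis in_set_conv_nth)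
  have "i < j" using ij assms(4) less by (metis linorder_neqE_nat order_less_asym)
  moreover have "\<not> Suc i < j"
  proof
    assume "Suc i < j"
    then have "p < ?xs ! Suc i" "?xs ! Suc i < q" using less ij by auto
    moreover have "?xs ! Suc i \<in> G" using \<open>Suc i < j\<close> ij len set by (metis nth_mem order_less_trans)
    ultimately show False using assms(5) by blast
  qed
  ultimately have "j = Suc i" by simp
  then show thesis using that ij by blast
qed

lemma limit_sparse_even_structure:
  assumes "limit_sparse_semigroup g H" and "even (gap H g)"
  shows "\<exists>k\<ge>1. H = {n. 3 dvd n \<or> 3 * k + 2 \<le> n}"
proof -
  define xs where "xs = sorted_list_of_set (- H)"
  define F where "F = gap H g"
  have g: "1 \<le> g" and zero: "0 \<in> H" and add: "\<And>a b. a \<in> H \<Longrightarrow> b \<in> H \<Longrightarrow> a + b \<in> H"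
    and fin: "finite (- H)" and card: "card (- H) = g"
    and diff: "\<And>i. i \<in> {2..g} \<Longrightarrow> gap H i - gap H (i - 1) \<le> 2"
    and leaps: "card {i \<in> {1..g - 1}. gap H (i + 1) - gap H i = 1} =
     card {i \<in> {1..g - 1}. gap H (i + 1) - gap H i = 2}"
    using assms(1) unfolding limit_sparse_semigroup_def sparse_semigroup_def numerical_semigroup_def
    by auto
  have gap: "gap H i = xs ! (i - 1)" for i by (simp add: gap_def xs_def)
  have len: "length xs = g" and set: "set xs = - H" using fin card by (simp_all add: xs_def)
  have less: "xs ! i < xs ! j" if "i < j" "j < g" for i j
    using that sorted_wrt_nth_less[OF strict_sorted_list_of_set, of i j "- H"] len
    by (simp add: xs_def)
  have dist: "xs ! i = xs ! j \<longleftrightarrow> i = j" if "i < g" "j < g" for i j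
    using that len by (simp add: xs_def nth_eq_iff_index_eq)
  have in_gap: "xs ! i \<notin> H" if "i < g" for i using that set len nth_mem by blast
  have consec: "\<exists>i. Suc i < g \<and> xs ! i = p \<and> xs ! Suc i = q"
    if "p \<notin> H" "q \<notin> H" "p < q" "\<And>x. p < x \<Longrightarrow> x < q \<Longrightarrow> x \<in> H" for p q
    using sorted_list_of_set_consecutive[OF fin, of p q] that card unfolding xs_def
    by (metis ComplD ComplI)
  have between: "x \<in> H" if "xs ! i < x" "x < xs ! Suc i" "Suc i < g" for x i
  proof (rule ccontr)
    assume "x \<notin> H"
    then obtain j where j: "j < g" "xs ! j = x" using set len by (metis ComplI in_set_conv_nth)
    have "i < j" using j that less by (metis linorder_neqE_nat order_less_asym Suc_lessD)
    moreover have "j < Suc i" using j that less by (metis linorder_neqE_nat order_less_asym)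
    ultimately show False by simp
  qed
  have F: "F \<notin> H" using in_gap[of "g - 1"] g by (simp add: F_def gap)
  have leF: "n \<le> F" if "n \<notin> H" for n
  proof -
    have "n \<in> set xs" using that set by simp
    then obtain j where j: "j < g" "xs ! j = n" using len by (auto simp: in_set_conv_nth)
    then have "j = g - 1 \<or> xs ! j < xs ! (g - 1)" using less[of j "g - 1"] g by linarith
    then show ?thesis using j by (auto simp: F_def gap)
  qed
  have one: "1 \<notin> H"
  proof
    assume "1 \<in> H"
    then have "n \<in> H" for n
    proof (induction n)
      case (Suc n) then show ?case using add[of n 1] by simp
    qed (simp add: zero)
    then show False using F by blast
  qed
  \<comment> \<open>Two neighbouring nongaps \<open>n\<close> and \<open>n + 1\<close> would be
    enclosed by consecutive gaps \<open>p < n\<close> and \<open>q > n + 1\<close>, at distance at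
    least 3.\<close>
  have nonadj: "Suc n \<notin> H" if n: "n \<in> H" "n < F" for n
  proof
    assume sn: "Suc n \<in> H"
    then have "n \<noteq> 0" using one by (cases n) auto
    then have n1: "1 < n" using n one by (cases "n = 1") auto
    define p where "p = Max {x. x \<notin> H \<and> x < n}"
    define q where "q = (LEAST x. x \<notin> H \<and> Suc n < x)"
    have "p \<in> {x. x \<notin> H \<and> x < n}" unfolding p_def
      by (rule Max_in) (use one n1 in auto)
    then have p: "p \<notin> H" "p < n" by auto
    have pmax: "x \<le> p" if "x \<notin> H" "x < n" for x unfolding p_def by (rule Max_ge) (use that in auto)
    have "Suc n < F" using n sn F by (metis Suc_lessI)
    then have q: "q \<notin> H" "Suc n < q" using LeastI[of "\<lambda>x. x \<notin> H \<and> Suc n < x" F] F by (auto simp: q_def)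
    have qmin: "q \<le> x" if "x \<notin> H" "Suc n < x" for x unfolding q_def by (rule Least_le) (use that in auto)
    have inner: "x \<in> H" if "p < x" "x < q" for x
    proof (rule ccontr)
      assume x: "x \<notin> H"
      then have "x \<noteq> n" "x \<noteq> Suc n" using n sn by auto
      then show False using pmax[OF x] qmin[OF x] that by linarith
    qed
    have "p < q" using p q by simp
    then obtain i where i: "Suc i < g" "xs ! i = p" "xs ! Suc i = q"
      using consec[OF p(1) q(1) _ inner] by blast
    have "gap H (i + 2) - gap H (i + 2 - 1) \<le> 2" by (rule diff) (use i in auto)
    then show False using i p q by (simp add: gap)
  qed
  have "bij_betw (\<lambda>i. gap H i) {i \<in> {1..g - 1}. gap H (i + 1) - gap H i = 1}
     {p. p \<notin> H \<and> Suc p \<notin> H}"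
  proof (rule bij_betwI')
    fix i j assume "i \<in> {i \<in> {1..g - 1}. gap H (i + 1) - gap H i = 1}"
      "j \<in> {i \<in> {1..g - 1}. gap H (i + 1) - gap H i = 1}"
    then have "i - 1 < g" "j - 1 < g" "0 < i" "0 < j" by auto
    then show "(gap H i = gap H j) = (i = j)"
      unfolding gap using dist[of "i - 1" "j - 1"] by auto
  next
    fix i assume i: "i \<in> {i \<in> {1..g - 1}. gap H (i + 1) - gap H i = 1}"
    then have "i < g" "i - 1 < g" "i - 1 < i" by auto
    then have "xs ! (i - 1) \<notin> H" "xs ! i \<notin> H" "xs ! i = Suc (xs ! (i - 1))"
      using i in_gap[of i] in_gap[of "i - 1"] less[of "i - 1" i] by (auto simp: gap)
    then show "gap H i \<in> {p. p \<notin> H \<and> Suc p \<notin> H}" by (simp add: gap)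
  next
    fix p assume p: "p \<in> {p. p \<notin> H \<and> Suc p \<notin> H}"
    then obtain i where i: "Suc i < g" "xs ! i = p" "xs ! Suc i = Suc p"
      using consec[of p "Suc p"] by fastforce
    then show "\<exists>i\<in>{i \<in> {1..g - 1}. gap H (i + 1) - gap H i = 1}. p = gap H i"
      by (intro bexI[of _ "Suc i"]) (auto simp: gap)
  qed
  then have c1: "card {i \<in> {1..g - 1}. gap H (i + 1) - gap H i = 1} = card {p. p \<notin> H \<and> Suc p \<notin> H}"
    by (rule bij_betw_same_card)
  \<comment> \<open>A difference 2 encloses exactly one nongap. By \<open>nonadj\<close> each
    positive nongap below \<open>F\<close> has gaps on both sides and so arises in this way.\<close>
  have "bij_betw (\<lambda>i. Suc (gap H i)) {i \<in> {1..g - 1}. gap H (i + 1) - gap H i = 2}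
     {n \<in> H. 0 < n \<and> n < F}"
  proof (rule bij_betwI')
    fix i j assume "i \<in> {i \<in> {1..g - 1}. gap H (i + 1) - gap H i = 2}"
      "j \<in> {i \<in> {1..g - 1}. gap H (i + 1) - gap H i = 2}"
    then have "i - 1 < g" "j - 1 < g" "0 < i" "0 < j" by auto
    then show "(Suc (gap H i) = Suc (gap H j)) = (i = j)"
      unfolding gap using dist[of "i - 1" "j - 1"] by auto
  next
    fix i assume i: "i \<in> {i \<in> {1..g - 1}. gap H (i + 1) - gap H i = 2}"
    then have "i < g" "Suc (i - 1) = i" by auto
    moreover have "xs ! i = Suc (Suc (xs ! (i - 1)))" using i by (auto simp: gap)
    ultimately
    show "Suc (gap H i) \<in> {n \<in> H. 0 < n \<and> n < F}"
      using between[of "i - 1" "Suc (xs ! (i - 1))"] leF[OF in_gap[of i]] by (simp add: gap)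
  next
    fix n assume n: "n \<in> {n \<in> H. 0 < n \<and> n < F}"
    then have "n - 1 < F" "Suc (n - 1) = n" by auto
    then have a: "Suc n \<notin> H" "n - 1 \<notin> H" using n nonadj[of n] nonadj[of "n - 1"] by auto
    have inner: "x \<in> H" if "n - 1 < x" "x < Suc n" for x
    proof -
      have "x = n" using that by simp
      then show ?thesis using n by simp
    qed
    have "n - 1 < Suc n" by simp
    then obtain i where i: "Suc i < g" "xs ! i = n - 1" "xs ! Suc i = Suc n"
      using consec[OF a(2,1) _ inner] by blast
    then show "\<exists>i\<in>{i \<in> {1..g - 1}. gap H (i + 1) - gap H i = 2}. n = Suc (gap H i)"
      using n by (intro bexI[of _ "Suc i"]) (auto simp: gap)
  qed
  then have c2: "card {i \<in> {1..g - 1}. gap H (i + 1) - gap H i = 2} = card {n \<in> H. 0 < n \<and> n < F}"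
    by (rule bij_betw_same_card)
  show ?thesis
  proof (rule even_limit_sparse_structure[of H F])
    show "n \<in> H" if "F < n" for n using leF[of n] that by fastforce
    show "even F" using assms(2) by (simp add: F_def)
    show "card {p. p \<notin> H \<and> Suc p \<notin> H} = card {n \<in> H. 0 < n \<and> n < F}" using leaps c1 c2 by simp
  qed (use zero add F nonadj in auto)
qed

section \<open>Forms as functions\<close>

text \<open>Points, closed sets and regular functions see only the values of forms. Generating these
  functions by rules gives inductions and closure properties without exponent vectors. The rule
  \<open>zero\<close> puts 0 into every degree.\<close>

inductive form_fun :: "nat \<Rightarrow> nat \<Rightarrow> ((nat \<Rightarrow> 'k::field) \<Rightarrow> 'k) \<Rightarrow> bool" for n where
  const: "form_fun n 0 (\<lambda>_. c)"
| zero: "form_fun n d (\<lambda>_. 0)"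
| add: "form_fun n d F \<Longrightarrow> form_fun n d G \<Longrightarrow> form_fun n d (\<lambda>v. F v + G v)"
| coord: "i \<le> n \<Longrightarrow> form_fun n d F \<Longrightarrow> form_fun n (Suc d) (\<lambda>v. v i * F v)"

lemma form_fun_scale: "form_fun n d F \<Longrightarrow> form_fun n d (\<lambda>v. c * F v)"
proof (induction rule: form_fun.induct)
  case (coord i d F)
  have "(\<lambda>v. c * (v i * F v)) = (\<lambda>v. v i * (c * F v))" by (simp add: fun_eq_iff mult.left_commute)
  with coord show ?case by (metis form_fun.coord)
qed (auto simp: distrib_left intro: form_fun.intros)

lemma form_fun_mult:
  "form_fun n d F \<Longrightarrow> form_fun n e G \<Longrightarrow> form_fun n (d + e) (\<lambda>v. F v * G v)"
proof (induction rule: form_fun.induct)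
  case (coord i d F)
  then show ?case using form_fun.coord[of i n "d + e" "\<lambda>v. F v * G v"] by (simp add: mult.assoc)
qed (auto simp: distrib_right intro: form_fun.intros form_fun_scale)

lemma form_fun_diff: "form_fun n d F \<Longrightarrow> form_fun n d G \<Longrightarrow> form_fun n d (\<lambda>v. F v - G v)"
  using form_fun.add[of n d F "\<lambda>v. -1 * G v"] form_fun_scale[of n d G "-1"] by simp

lemma form_fun_coordinate: "i \<le> n \<Longrightarrow> form_fun n 1 (\<lambda>v. v i)"
  using form_fun.coord[OF _ form_fun.const[of n 1], of i] by simp

lemma form_fun_power: "form_fun n d F \<Longrightarrow> form_fun n (e * d) (\<lambda>v. F v ^ e)"
  by (induction e) (auto intro: form_fun.const[of n 1] form_fun_mult)

lemma form_fun_sum: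
  "finite I \<Longrightarrow> (\<And>i. i \<in> I \<Longrightarrow> form_fun n d (F i)) \<Longrightarrow> form_fun n d (\<lambda>v. \<Sum>i\<in>I. F i v)"
  by (induction rule: finite_induct) (auto intro: form_fun.intros)

lemma form_fun_homogeneous: "form_fun n d F \<Longrightarrow> F (\<lambda>i. c * v i) = c ^ d * F v"
  by (induction rule: form_fun.induct) (auto simp: algebra_simps)

lemma form_fun_monomial:
  assumes "finite I" "I \<subseteq> {..n}"
  shows "form_fun n (\<Sum>i\<in>I. e i) (\<lambda>v. \<Prod>i\<in>I. v i ^ e i)"
  using assms
proof (induction rule: finite_induct)
  case empty
  then show ?case using form_fun.const[of n 1] by simp
next
  case (insert i I)
  have "form_fun n (e i * 1) (\<lambda>v. v i ^ e i)"
    by (rule form_fun_power[OF form_fun_coordinate]) (use insert in auto)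
  with insert show ?case using form_fun_mult by fastforce
qed

lemma mpoly_eval_superset:
  assumes "finite A" "Poly_Mapping.keys p \<subseteq> A"
  shows "mpoly_eval v p =
     (\<Sum>m\<in>A. Poly_Mapping.lookup p m * (\<Prod>i\<in>Poly_Mapping.keys m. v i ^ Poly_Mapping.lookup m i))"
  unfolding mpoly_eval_def
  by (rule sum.mono_neutral_left[OF assms]) (auto simp: in_keys_iff)

lemma mpoly_eval_add: "mpoly_eval v (p + q) = mpoly_eval v p + mpoly_eval v q"
proof -
  let ?A = "Poly_Mapping.keys p \<union> Poly_Mapping.keys q"
  have "mpoly_eval v r = (\<Sum>m\<in>?A. Poly_Mapping.lookup r m *
      (\<Prod>i\<in>Poly_Mapping.keys m. v i ^ Poly_Mapping.lookup m i))" if "Poly_Mapping.keys r \<subseteq> ?A" for r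
    by (rule mpoly_eval_superset) (use that in auto)
  then show ?thesis
    using Poly_Mapping.keys_add[of p q]
    by (simp add: lookup_add distrib_right sum.distrib)
qed

lemma mpoly_eval_zero [simp]: "mpoly_eval v 0 = 0"
  by (simp add: mpoly_eval_def)

lemma mpoly_eval_sum: "mpoly_eval v (\<Sum>i\<in>I. p i) = (\<Sum>i\<in>I. mpoly_eval v (p i))"
  by (induction I rule: infinite_finite_induct) (auto simp: mpoly_eval_add)

lemma mpoly_eval_single:
  "mpoly_eval v (Poly_Mapping.single m c) =
     c * (\<Prod>i\<in>Poly_Mapping.keys m. v i ^ Poly_Mapping.lookup m i)"
  by (simp add: mpoly_eval_def)

lemma monomial_add_single:
  fixes v :: "nat \<Rightarrow> 'k::field"
  shows "(\<Prod>j\<in>Poly_Mapping.keys (m + Poly_Mapping.single i 1).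
       v j ^ Poly_Mapping.lookup (m + Poly_Mapping.single i (1::nat)) j) =
     v i * (\<Prod>j\<in>Poly_Mapping.keys m. v j ^ Poly_Mapping.lookup m j)"
proof -
  let ?A = "insert i (Poly_Mapping.keys m)"
  have a: "(\<Prod>j\<in>Poly_Mapping.keys r. v j ^ Poly_Mapping.lookup r j) = (\<Prod>j\<in>?A. v j ^ Poly_Mapping.lookup r j)"
    if "Poly_Mapping.keys r \<subseteq> ?A" for r :: "nat \<Rightarrow>\<^sub>0 nat"
    by (rule prod.mono_neutral_left) (use that in \<open>auto simp: in_keys_iff\<close>)
  have b: "Poly_Mapping.keys (m + Poly_Mapping.single i 1) \<subseteq> ?A"
    using Poly_Mapping.keys_add[of m "Poly_Mapping.single i 1"] by auto
  have c: "(\<Prod>j\<in>?A. v j ^ Poly_Mapping.lookup (Poly_Mapping.single i 1) j) = v i"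
    by (subst prod.remove[of _ i]) (auto simp: lookup_single when_def intro!: prod.neutral)
  show ?thesis
    by (subst a[OF b], subst a[OF subset_insertI])
      (simp only: lookup_add power_add prod.distrib c mult.commute)
qed

lemma forms_zero: "0 \<in> forms n d"
  by (simp add: forms_def)

lemma forms_add: "p \<in> forms n d \<Longrightarrow> q \<in> forms n d \<Longrightarrow> p + q \<in> forms n d"
  using Poly_Mapping.keys_add[of p q] unfolding forms_def by blast

lemma forms_sum: "(\<And>i. i \<in> I \<Longrightarrow> p i \<in> forms n d) \<Longrightarrow> (\<Sum>i\<in>I. p i) \<in> forms n d"
  by (induction I rule: infinite_finite_induct) (auto intro: forms_add forms_zero)

lemma degree_add_single:
  fixes m :: "nat \<Rightarrow>\<^sub>0 nat"
  shows "(\<Sum>j\<in>Poly_Mapping.keys (m + Poly_Mapping.single i 1).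
       Poly_Mapping.lookup (m + Poly_Mapping.single i 1) j) =
     Suc (\<Sum>j\<in>Poly_Mapping.keys m. Poly_Mapping.lookup m j)"
proof -
  let ?A = "insert i (Poly_Mapping.keys m)"
  have a: "(\<Sum>j\<in>Poly_Mapping.keys r. Poly_Mapping.lookup r j) = (\<Sum>j\<in>?A. Poly_Mapping.lookup r j)"
    if "Poly_Mapping.keys r \<subseteq> ?A" for r :: "nat \<Rightarrow>\<^sub>0 nat"
    by (rule sum.mono_neutral_left) (use that in \<open>auto simp: in_keys_iff\<close>)
  have b: "Poly_Mapping.keys (m + Poly_Mapping.single i 1) \<subseteq> ?A"
    using Poly_Mapping.keys_add[of m "Poly_Mapping.single i 1"] by auto
  have c: "(\<Sum>j\<in>?A. Poly_Mapping.lookup (Poly_Mapping.single i (1::nat)) j) = 1"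
    by (subst sum.remove[of _ i]) (auto simp: lookup_single when_def intro!: sum.neutral)
  have "(\<Sum>j\<in>?A. Poly_Mapping.lookup (m + Poly_Mapping.single i 1) j) =
      (\<Sum>j\<in>?A. Poly_Mapping.lookup m j) + 1"
    by (subst c[symmetric], subst sum.distrib[symmetric]) (simp add: lookup_add)
  then show ?thesis unfolding a[OF b] a[OF subset_insertI] by simp
qed

lemma form_fun_imp_mpoly: "form_fun n d F \<Longrightarrow> \<exists>p\<in>forms n d. \<forall>v. mpoly_eval v p = F v"
proof (induction rule: form_fun.induct)
  case (const c)
  show ?case
    by (rule bexI[of _ "Poly_Mapping.single 0 c"])
      (auto simp: mpoly_eval_single forms_def split: if_splits)
next
  case (zero d)
  show ?case by (rule bexI[of _ 0]) (auto simp: forms_zero)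
next
  case (add d F G)
  then show ?case using forms_add by (metis mpoly_eval_add)
next
  case (coord i d F)
  then obtain p where p: "p \<in> forms n d" "\<And>v. mpoly_eval v p = F v" by blast
  \<comment> \<open>Multiplication by the coordinate \<open>i\<close> adds a unit vector to each
    exponent vector, one monomial at a time.\<close>
  let ?s = "\<lambda>m. Poly_Mapping.single (m + Poly_Mapping.single i 1) (Poly_Mapping.lookup p m)"
  let ?q = "\<Sum>m\<in>Poly_Mapping.keys p. ?s m"
  have "?q \<in> forms n (Suc d)"
  proof (rule forms_sum)
    fix m assume m: "m \<in> Poly_Mapping.keys p"
    have "Poly_Mapping.keys (m + Poly_Mapping.single i 1) \<subseteq> {..n}"
      using Poly_Mapping.keys_add[of m "Poly_Mapping.single i 1"] m p(1) coord(1)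
      by (auto simp: forms_def)
    then show "?s m \<in> forms n (Suc d)"
      using m p(1) degree_add_single[of m i] by (auto simp: forms_def)
  qed
  moreover have "mpoly_eval v ?q = v i * F v" for v
    unfolding p(2)[symmetric] mpoly_eval_sum mpoly_eval_single monomial_add_single
    by (simp add: mpoly_eval_def sum_distrib_left mult.left_commute)
  ultimately show ?case by blast
qed

lemma mpoly_imp_form_fun:
  assumes "p \<in> forms n d"
  shows "form_fun n d (\<lambda>v. mpoly_eval v p)"
  unfolding mpoly_eval_def
proof (rule form_fun_sum[OF finite_keys form_fun_scale])
  fix m assume "m \<in> Poly_Mapping.keys p"
  then have "Poly_Mapping.keys m \<subseteq> {..n}" "(\<Sum>i\<in>Poly_Mapping.keys m. Poly_Mapping.lookup m i) = d"
    using assms by (auto simp: forms_def)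
  then show "form_fun n d (\<lambda>v. \<Prod>i\<in>Poly_Mapping.keys m. v i ^ Poly_Mapping.lookup m i)"
    using form_fun_monomial[of "Poly_Mapping.keys m" n "Poly_Mapping.lookup m"] by simp
qed


section \<open>Points and closed sets\<close>

definition point :: "(nat \<Rightarrow> 'k::field) \<Rightarrow> 'k ppoint" where
  "point v = {(\<lambda>i. c * v i) |c. c \<noteq> 0}"

text \<open>A form vanishes at all coordinate vectors of a point or at none, and a quotient of two
  forms of equal degree has the same value at all of them. Hence conditions on every vector of
  \<open>Q\<close> can be tested at this one.\<close>

definition rep :: "'k::field ppoint \<Rightarrow> nat \<Rightarrow> 'k" where
  "rep Q = (SOME v. v \<in> Q)"

lemma in_point_self: "v \<in> point v"
  unfolding point_def by (rule CollectI, rule exI[of _ 1]) simp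

lemma point_eq: "w \<in> point v \<Longrightarrow> point w = point v"
proof -
  assume "w \<in> point v"
  then obtain c where c: "c \<noteq> 0" "w = (\<lambda>i. c * v i)" by (auto simp: point_def)
  have "\<exists>e. e \<noteq> 0 \<and> (\<forall>i. d * v i = e * (c * v i))" if "d \<noteq> 0" for d
    using that c(1) by (intro exI[of _ "d / c"]) auto
  moreover have "\<exists>e. e \<noteq> 0 \<and> (\<forall>i. d * (c * v i) = e * v i)" if "d \<noteq> 0" for d
    using that c(1) by (intro exI[of _ "d * c"]) auto
  ultimately show ?thesis unfolding point_def c(2) fun_eq_iff set_eq_iff by fastforce
qed

lemma in_proj_space_iff:
  "Q \<in> proj_space n \<longleftrightarrow> (\<exists>v. Q = point v \<and> (\<forall>i>n. v i = 0) \<and> (\<exists>i\<le>n. v i \<noteq> 0))"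
  by (auto simp: proj_space_def point_def)

lemma in_proj_spaceD:
  assumes "Q \<in> proj_space n" "v \<in> Q"
  shows "Q = point v" "i > n \<Longrightarrow> v i = 0" "\<exists>i\<le>n. v i \<noteq> 0"
proof -
  obtain w where w: "Q = point w" "\<forall>i>n. w i = 0" "\<exists>i\<le>n. w i \<noteq> 0"
    using assms(1) by (auto simp: in_proj_space_iff)
  then show "Q = point v" using assms(2) point_eq by metis
  obtain c where "c \<noteq> 0" "v = (\<lambda>i. c * w i)" using assms(2) w by (auto simp: point_def)
  then show "i > n \<Longrightarrow> v i = 0" "\<exists>i\<le>n. v i \<noteq> 0" using w by auto
qed

lemma rep_in: "Q \<in> proj_space n \<Longrightarrow> rep Q \<in> Q"
  unfolding rep_def in_proj_space_iff by (metis in_point_self someI_ex)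

lemma form_fun_zero_iff:
  assumes "form_fun n d F" "w \<in> point v"
  shows "F w = 0 \<longleftrightarrow> F v = 0"
  using assms form_fun_homogeneous[OF assms(1)] by (auto simp: point_def)

lemma form_fun_quotient_eq:
  assumes "form_fun n d F" "form_fun n d G" "w \<in> point v"
  shows "F w / G w = F v / G v"
  using assms form_fun_homogeneous[OF assms(1)] form_fun_homogeneous[OF assms(2)]
  by (auto simp: point_def)

lemma zariski_closed_iff:
  "zariski_closed n Z \<longleftrightarrow>
     (\<exists>S. (\<forall>F\<in>S. \<exists>d. form_fun n d F) \<and> Z = {Q \<in> proj_space n. \<forall>F\<in>S. F (rep Q) = 0})"
  (is "_ \<longleftrightarrow> ?R")
proof
  assume "zariski_closed n Z"
  then obtain S where S: "\<forall>p\<in>S. \<exists>d. p \<in> forms n d"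
    "Z = {Q \<in> proj_space n. \<forall>p\<in>S. \<forall>v\<in>Q. mpoly_eval v p = 0}"
    unfolding zariski_closed_def by blast
  have ff: "\<exists>d. form_fun n d (\<lambda>v. mpoly_eval v p)" if "p \<in> S" for p
    using S(1) that mpoly_imp_form_fun by blast
  have "(\<forall>v\<in>Q. mpoly_eval v p = 0) \<longleftrightarrow> mpoly_eval (rep Q) p = 0" if "Q \<in> proj_space n" "p \<in> S" for Q p
    using ff[OF that(2)] rep_in[OF that(1)] in_proj_spaceD(1)[OF that(1)] form_fun_zero_iff by metis
  then have "Z = {Q \<in> proj_space n. \<forall>F\<in>(\<lambda>p v. mpoly_eval v p) ` S. F (rep Q) = 0}"
    using S(2) by auto
  then show ?R using ff by (intro exI[of _ "(\<lambda>p v. mpoly_eval v p) ` S"]) auto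
next
  assume ?R
  then obtain S where S: "\<forall>F\<in>S. \<exists>d. form_fun n d F"
    "Z = {Q \<in> proj_space n. \<forall>F\<in>S. F (rep Q) = 0}" by blast
  define T where "T = {p. (\<exists>d. p \<in> forms n d) \<and> (\<exists>F\<in>S. \<forall>v. mpoly_eval v p = F v)}"
  have T: "\<exists>p\<in>T. \<forall>v. mpoly_eval v p = F v" if "F \<in> S" for F
    using S(1) that form_fun_imp_mpoly unfolding T_def by blast
  have "(\<forall>F\<in>S. F (rep Q) = 0) \<longleftrightarrow> (\<forall>p\<in>T. \<forall>v\<in>Q. mpoly_eval v p = 0)" if Q: "Q \<in> proj_space n" for Q
  proof -
    have "(\<forall>v\<in>Q. F v = 0) \<longleftrightarrow> F (rep Q) = 0" if "F \<in> S" for F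
      using S(1) that rep_in[OF Q] in_proj_spaceD(1)[OF Q] form_fun_zero_iff by metis
    moreover have "(\<forall>F\<in>S. \<forall>v\<in>Q. F v = 0) \<longleftrightarrow> (\<forall>p\<in>T. \<forall>v\<in>Q. mpoly_eval v p = 0)"
    proof (intro iffI ballI)
      fix p v assume "\<forall>F\<in>S. \<forall>v\<in>Q. F v = 0" "p \<in> T" "v \<in> Q"
      then show "mpoly_eval v p = 0" unfolding T_def by auto
    next
      fix F v assume a: "\<forall>p\<in>T. \<forall>v\<in>Q. mpoly_eval v p = 0" "F \<in> S" "v \<in> Q"
      obtain p where "p \<in> T" "mpoly_eval v p = F v" using T[OF a(2)] by blast
      then show "F v = 0" using a(1,3) by simp
    qed
    ultimately show ?thesis by simp
  qed
  then have "Z = {Q \<in> proj_space n. \<forall>p\<in>T. \<forall>v\<in>Q. mpoly_eval v p = 0}" using S(2) by auto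
  moreover have "\<forall>p\<in>T. \<exists>d. p \<in> forms n d" by (auto simp: T_def)
  ultimately show "zariski_closed n Z" unfolding zariski_closed_def by blast
qed

lemma zariski_closed_subset: "zariski_closed n Z \<Longrightarrow> Z \<subseteq> proj_space n"
  by (auto simp: zariski_closed_def)

lemma zariski_closed_empty: "zariski_closed n {}"
  unfolding zariski_closed_iff
  by (rule exI[of _ "{\<lambda>_. 1}"]) (auto intro: form_fun.const)

lemma zariski_closed_Un:
  assumes "zariski_closed n A" "zariski_closed n B"
  shows "zariski_closed n (A \<union> B)"
proof -
  obtain S where S: "\<forall>F\<in>S. \<exists>d. form_fun n d F" "A = {Q \<in> proj_space n. \<forall>F\<in>S. F (rep Q) = 0}"
    using assms(1) unfolding zariski_closed_iff by blast
  obtain T where T: "\<forall>F\<in>T. \<exists>d. form_fun n d F" "B = {Q \<in> proj_space n. \<forall>F\<in>T. F (rep Q) = 0}"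
    using assms(2) unfolding zariski_closed_iff by blast
  have "A \<union> B = {Q \<in> proj_space n. \<forall>F\<in>{\<lambda>v. F v * G v |F G. F \<in> S \<and> G \<in> T}. F (rep Q) = 0}"
    unfolding S(2) T(2) by fastforce
  moreover have "\<forall>F\<in>{\<lambda>v. F v * G v |F G. F \<in> S \<and> G \<in> T}. \<exists>d. form_fun n d F"
    using S(1) T(1) form_fun_mult by fastforce
  ultimately show ?thesis unfolding zariski_closed_iff by blast
qed

lemma zariski_closed_point:
  assumes Q: "Q \<in> proj_space n"
  shows "zariski_closed n {Q}"
proof -
  define v where "v = rep Q"
  have v: "v \<in> Q" "Q = point v" unfolding v_def using rep_in[OF Q] in_proj_spaceD(1)[OF Q] by auto
  obtain j where j: "j \<le> n" "v j \<noteq> 0" using in_proj_spaceD(3)[OF Q v(1)] by blast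
  \<comment> \<open>These are the 2 by 2 minors, involving column \<open>j\<close>, of the matrix
    with rows \<open>v\<close> and \<open>w\<close>. Since \<open>v j \<noteq> 0\<close>, their
    vanishing makes \<open>w\<close> a multiple of \<open>v\<close>.\<close>
  define S where "S = {\<lambda>w. v j * w i - v i * w j |i. i \<le> n}"
  have uniq: "R = Q" if R: "R \<in> proj_space n" and z: "\<forall>F\<in>S. F (rep R) = 0" for R
  proof -
    define w where "w = rep R"
    have w: "w \<in> R" "R = point w" unfolding w_def using rep_in[OF R] in_proj_spaceD(1)[OF R] by auto
    have eq: "v j * w i = v i * w j" if "i \<le> n" for i
      using z that unfolding w_def S_def by fastforce
    have wi: "w i = w j / v j * v i" for i
      using eq[of i] in_proj_spaceD(2)[OF Q v(1), of i] in_proj_spaceD(2)[OF R w(1), of i] j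
      by (cases "i \<le> n") (auto simp: field_simps)
    have "w j \<noteq> 0" using wi in_proj_spaceD(3)[OF R w(1)] by fastforce
    then have "w j / v j \<noteq> 0" using j(2) by simp
    moreover have "w = (\<lambda>i. w j / v j * v i)" by (rule ext) (rule wi)
    ultimately have "w \<in> point v" unfolding point_def by blast
    then show "R = Q" using point_eq v w by metis
  qed
  have zer: "\<forall>F\<in>S. F (rep Q) = 0" by (auto simp: v_def S_def)
  have "{Q} = {R \<in> proj_space n. \<forall>F\<in>S. F (rep R) = 0}"
  proof (intro equalityI subsetI)
    fix R assume "R \<in> {Q}"
    then show "R \<in> {R \<in> proj_space n. \<forall>F\<in>S. F (rep R) = 0}" using Q zer by simp
  next
    fix R assume "R \<in> {R \<in> proj_space n. \<forall>F\<in>S. F (rep R) = 0}"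
    then have "R = Q" by (intro uniq) simp_all
    then show "R \<in> {Q}" by simp
  qed
  moreover have "\<forall>F\<in>S. \<exists>d. form_fun n d F"
  proof
    fix F assume "F \<in> S"
    then obtain i where "i \<le> n" "F = (\<lambda>w. v j * w i - v i * w j)" unfolding S_def by blast
    then show "\<exists>d. form_fun n d F"
      using j(1) form_fun_diff form_fun_scale form_fun_coordinate by metis
  qed
  ultimately show ?thesis unfolding zariski_closed_iff by blast
qed

lemma zariski_closed_finite:
  "finite A \<Longrightarrow> A \<subseteq> proj_space n \<Longrightarrow> zariski_closed n A"
proof (induction rule: finite_induct)
  case (insert Q A)
  then show ?case using zariski_closed_Un[OF zariski_closed_point[of Q n], of A] by simp
qed (rule zariski_closed_empty)

lemma irreducible_closed_point: "Q \<in> proj_space n \<Longrightarrow> irreducible_closed n {Q}"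
  unfolding irreducible_closed_def using zariski_closed_point by blast

text \<open>A finite set is the union of one of its points and the rest, and both are
  closed.\<close>

lemma irreducible_closed_finite:
  assumes "irreducible_closed n Z" "finite Z"
  shows "\<exists>Q. Z = {Q}"
proof -
  have Z: "Z \<subseteq> proj_space n" "Z \<noteq> {}" using assms(1) zariski_closed_subset
    unfolding irreducible_closed_def by blast+
  then obtain Q where Q: "Q \<in> Z" by blast
  have "zariski_closed n {Q}" "zariski_closed n (Z - {Q})"
    using Q Z assms(2) by (auto intro!: zariski_closed_finite)
  moreover have "Z \<subseteq> {Q} \<union> (Z - {Q})" by blast
  ultimately have "Z \<subseteq> {Q} \<or> Z \<subseteq> Z - {Q}" using assms(1) unfolding irreducible_closed_def by meson
  then show ?thesis using Q by blast
qed

section \<open>Curves with the cofinite topology\<close>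

text \<open>Proper closed subsets of an irreducible curve are finite. Taken as an axiom, this yields
  irreducibility, the dimension and a usable form of \<open>near\<close> with no reference to the
  equations of the curve.\<close>

locale cofinite_curve =
  fixes n :: nat and X :: "'k::field ppoint set"
  assumes subset: "X \<subseteq> proj_space n" and closed: "zariski_closed n X" and infinite: "infinite X"
    and cofinite: "\<And>Z. zariski_closed n Z \<Longrightarrow> \<not> X \<subseteq> Z \<Longrightarrow> finite (X \<inter> Z)"
begin

lemma near_iff: "near n X Q \<phi> \<longleftrightarrow> Q \<in> X \<and> \<phi> Q \<and> finite {R \<in> X. \<not> \<phi> R}"
proof
  assume "near n X Q \<phi>"
  then obtain U where U: "U \<subseteq> X" "zariski_closed n (X - U)" "Q \<in> U" "\<And>R. R \<in> U \<Longrightarrow> \<phi> R"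
    unfolding near_def by blast
  have "finite (X \<inter> (X - U))" by (rule cofinite[OF U(2)]) (use U in blast)
  then have "finite {R \<in> X. \<not> \<phi> R}" by (rule rev_finite_subset) (use U in blast)
  then show "Q \<in> X \<and> \<phi> Q \<and> finite {R \<in> X. \<not> \<phi> R}" using U by blast
next
  assume a: "Q \<in> X \<and> \<phi> Q \<and> finite {R \<in> X. \<not> \<phi> R}"
  have "X - {R \<in> X. \<phi> R} = {R \<in> X. \<not> \<phi> R}" by blast
  moreover have "zariski_closed n {R \<in> X. \<not> \<phi> R}"
    by (rule zariski_closed_finite) (use a subset in auto)
  ultimately show "near n X Q \<phi>" unfolding near_def
    by (intro exI[of _ "{R \<in> X. \<phi> R}"]) (use a in auto)
qed

lemma near_mono: "near n X Q \<phi> \<Longrightarrow> (\<And>R. R \<in> X \<Longrightarrow> \<phi> R \<Longrightarrow> \<psi> R) \<Longrightarrow> near n X Q \<psi>"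
  unfolding near_iff by (auto elim!: rev_finite_subset)

lemma near_conj: "near n X Q \<phi> \<Longrightarrow> near n X Q \<psi> \<Longrightarrow> near n X Q (\<lambda>R. \<phi> R \<and> \<psi> R)"
proof -
  assume "near n X Q \<phi>" "near n X Q \<psi>"
  moreover have "{R \<in> X. \<not> (\<phi> R \<and> \<psi> R)} = {R \<in> X. \<not> \<phi> R} \<union> {R \<in> X. \<not> \<psi> R}" by blast
  ultimately show ?thesis unfolding near_iff by simp
qed

lemma near_at: "near n X Q \<phi> \<Longrightarrow> \<phi> Q"
  by (simp add: near_iff)

lemma near_true: "Q \<in> X \<Longrightarrow> (\<And>R. R \<in> X \<Longrightarrow> \<phi> R) \<Longrightarrow> near n X Q \<phi>"
  unfolding near_iff by (metis (mono_tags, lifting) empty_Collect_eq finite.emptyI)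

lemma irreducible: "irreducible_closed n X"
  unfolding irreducible_closed_def
proof (intro conjI allI impI)
  fix A B assume AB: "zariski_closed n A \<and> zariski_closed n B \<and> X \<subseteq> A \<union> B"
  show "X \<subseteq> A \<or> X \<subseteq> B"
  proof (rule ccontr)
    assume "\<not> (X \<subseteq> A \<or> X \<subseteq> B)"
    then have "finite (X \<inter> A \<union> X \<inter> B)" using AB cofinite by blast
    moreover have "X \<inter> A \<union> X \<inter> B = X" using AB by blast
    ultimately show False using infinite by simp
  qed
qed (use closed infinite in auto)

lemma finite_closed: "zariski_closed n Z \<Longrightarrow> Z \<subset> X \<Longrightarrow> finite Z"
  using cofinite[of Z] by (simp add: inf.absorb2 less_le_not_le)

lemma dim_eq_1: "zariski_dim n X = enat 1"
  unfolding zariski_dim_def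
proof (rule antisym[OF Sup_least Sup_upper])
  fix e assume "e \<in> {enat d |d. \<exists>C. (\<forall>i\<le>d. irreducible_closed n (C i) \<and> C i \<subseteq> X) \<and>
                         (\<forall>i<d. C i \<subset> C (Suc i))}"
  then obtain d C where e: "e = enat d" and C: "\<forall>i\<le>d. irreducible_closed n (C i) \<and> C i \<subseteq> X"
    "\<forall>i<d. C i \<subset> C (Suc i)" by blast
  have "\<not> 2 \<le> d"
  proof
    assume "2 \<le> d"
    then have c: "C 0 \<subset> C (Suc 0)" "C (Suc 0) \<subset> C (Suc (Suc 0))" using C(2) by auto
    \<comment> \<open>The middle of a chain of length 2 is a proper closed subset, hence finite, and
      by irreducibility a single point. That leaves nothing for \<open>C 0\<close>.\<close>
    have "C (Suc 0) \<subset> X" 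
      by (rule psubset_subset_trans[OF c(2)]) (use C(1) \<open>2 \<le> d\<close> in simp)
    moreover have irr: "irreducible_closed n (C (Suc 0))" using C(1) \<open>2 \<le> d\<close> by simp
    ultimately have "finite (C (Suc 0))" 
      using finite_closed[of "C (Suc 0)"] by (simp add: irreducible_closed_def)
    then obtain R where "C (Suc 0) = {R}" using irreducible_closed_finite[OF irr] by blast
    then have "C 0 = {}" using c(1) by auto
    moreover have "irreducible_closed n (C 0)" using C(1) by simp
    ultimately show False by (simp add: irreducible_closed_def)
  qed
  then show "e \<le> enat 1" using e by simp
next
  obtain Q where Q: "Q \<in> X" using infinite by fastforce
  define C where "C = (\<lambda>i::nat. if i = 0 then {Q} else X)"
  have "\<forall>i\<le>1. irreducible_closed n (C i) \<and> C i \<subseteq> X"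
    using Q subset irreducible irreducible_closed_point by (auto simp: C_def)
  moreover have "X \<noteq> {Q}" using infinite by auto
  then have "\<forall>i<1. C i \<subset> C (Suc i)" using Q by (auto simp: C_def)
  ultimately show "enat 1 \<in> {enat d |d. \<exists>C. (\<forall>i\<le>d. irreducible_closed n (C i) \<and> C i \<subseteq> X) \<and>
                         (\<forall>i<d. C i \<subset> C (Suc i))}" by blast
qed

lemma rep_in_X: "R \<in> X \<Longrightarrow> rep R \<in> R" "R \<in> X \<Longrightarrow> R = point (rep R)"
  using rep_in in_proj_spaceD(1) subset by blast+

lemma regular_at_iff:
  "regular_at n X f Q \<longleftrightarrow>
     (\<exists>d F G. form_fun n d F \<and> form_fun n d G \<and>
        near n X Q (\<lambda>R. G (rep R) \<noteq> 0 \<and> f R = F (rep R) / G (rep R)))"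
proof
  assume "regular_at n X f Q"
  then obtain d a b where ab: "a \<in> forms n d" "b \<in> forms n d"
    "near n X Q (\<lambda>R. \<forall>v\<in>R. mpoly_eval v b \<noteq> 0 \<and> f R = mpoly_eval v a / mpoly_eval v b)"
    unfolding regular_at_def by blast
  then show "\<exists>d F G. form_fun n d F \<and> form_fun n d G \<and>
        near n X Q (\<lambda>R. G (rep R) \<noteq> 0 \<and> f R = F (rep R) / G (rep R))"
    using near_mono[OF ab(3), of "\<lambda>R. mpoly_eval (rep R) b \<noteq> 0 \<and> f R = mpoly_eval (rep R) a / mpoly_eval (rep R) b"]
      rep_in_X(1) mpoly_imp_form_fun[OF ab(1)] mpoly_imp_form_fun[OF ab(2)] by blast
next
  assume "\<exists>d F G. form_fun n d F \<and> form_fun n d G \<and>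
        near n X Q (\<lambda>R. G (rep R) \<noteq> 0 \<and> f R = F (rep R) / G (rep R))"
  then obtain d F G where FG: "form_fun n d F" "form_fun n d G"
    "near n X Q (\<lambda>R. G (rep R) \<noteq> 0 \<and> f R = F (rep R) / G (rep R))" by blast
  obtain a where a: "a \<in> forms n d" "\<And>v. mpoly_eval v a = F v" using form_fun_imp_mpoly[OF FG(1)] by blast
  obtain b where b: "b \<in> forms n d" "\<And>v. mpoly_eval v b = G v" using form_fun_imp_mpoly[OF FG(2)] by blast
  have "near n X Q (\<lambda>R. \<forall>v\<in>R. mpoly_eval v b \<noteq> 0 \<and> f R = mpoly_eval v a / mpoly_eval v b)"
  proof (rule near_mono[OF FG(3)], rule ballI)
    fix R v assume R: "R \<in> X" "G (rep R) \<noteq> 0 \<and> f R = F (rep R) / G (rep R)" "v \<in> R"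
    have v: "v \<in> point (rep R)" using R rep_in_X by blast
    show "mpoly_eval v b \<noteq> 0 \<and> f R = mpoly_eval v a / mpoly_eval v b"
      unfolding a b using R form_fun_zero_iff[OF FG(2) v] form_fun_quotient_eq[OF FG(1,2) v] by simp
  qed
  then show "regular_at n X f Q" using a b unfolding regular_at_def by blast
qed

lemma near_form_nonzero:
  assumes "form_fun n d F" "Q \<in> X" "F (rep Q) \<noteq> 0"
  shows "near n X Q (\<lambda>R. F (rep R) \<noteq> 0)"
proof -
  let ?Z = "{R \<in> proj_space n. F (rep R) = 0}"
  have "zariski_closed n ?Z" unfolding zariski_closed_iff
    by (rule exI[of _ "{F}"]) (use assms in auto)
  moreover have "\<not> X \<subseteq> ?Z" using assms by blast
  ultimately have "finite (X \<inter> ?Z)" by (rule cofinite)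
  moreover have "{R \<in> X. \<not> F (rep R) \<noteq> 0} \<subseteq> X \<inter> ?Z" using subset by blast
  ultimately show ?thesis unfolding near_iff using assms finite_subset by blast
qed

lemma regular_atD: "regular_at n X f Q \<Longrightarrow> Q \<in> X"
  unfolding regular_at_iff near_iff by blast

lemma regular_at_cong:
  assumes "regular_at n X f Q" "near n X Q (\<lambda>R. g R = f R)"
  shows "regular_at n X g Q"
proof -
  obtain d F G where "form_fun n d F" "form_fun n d G"
    and a: "near n X Q (\<lambda>R. G (rep R) \<noteq> 0 \<and> f R = F (rep R) / G (rep R))"
    using assms(1) unfolding regular_at_iff by blast
  moreover have "near n X Q (\<lambda>R. G (rep R) \<noteq> 0 \<and> g R = F (rep R) / G (rep R))"
    by (rule near_mono[OF near_conj[OF a assms(2)]]) simp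
  ultimately show ?thesis unfolding regular_at_iff by blast
qed

lemma regular_at_const: "Q \<in> X \<Longrightarrow> regular_at n X (\<lambda>_. c) Q"
  unfolding regular_at_iff
  by (rule exI[of _ 0], rule exI[of _ "\<lambda>_. c"], rule exI[of _ "\<lambda>_. 1"])
    (auto intro: form_fun.const near_true)

lemma regular_at_add:
  assumes "regular_at n X f Q" "regular_at n X g Q"
  shows "regular_at n X (\<lambda>R. f R + g R) Q"
proof -
  obtain d F G where FG: "form_fun n d F" "form_fun n d G"
    and a: "near n X Q (\<lambda>R. G (rep R) \<noteq> 0 \<and> f R = F (rep R) / G (rep R))"
    using assms(1) unfolding regular_at_iff by blast
  obtain e F' G' where FG': "form_fun n e F'" "form_fun n e G'"
    and a': "near n X Q (\<lambda>R. G' (rep R) \<noteq> 0 \<and> g R = F' (rep R) / G' (rep R))"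
    using assms(2) unfolding regular_at_iff by blast
  have "near n X Q (\<lambda>R. G (rep R) * G' (rep R) \<noteq> 0 \<and>
      f R + g R = (F (rep R) * G' (rep R) + G (rep R) * F' (rep R)) / (G (rep R) * G' (rep R)))"
    by (rule near_mono[OF near_conj[OF a a']]) (simp add: field_simps)
  moreover have "form_fun n (d + e) (\<lambda>v. F v * G' v + G v * F' v)" "form_fun n (d + e) (\<lambda>v. G v * G' v)"
    using FG FG' by (auto intro!: form_fun.add form_fun_mult)
  ultimately show ?thesis unfolding regular_at_iff by blast
qed

lemma regular_at_mult:
  assumes "regular_at n X f Q" "regular_at n X g Q"
  shows "regular_at n X (\<lambda>R. f R * g R) Q"
proof -
  obtain d F G where FG: "form_fun n d F" "form_fun n d G"
    and a: "near n X Q (\<lambda>R. G (rep R) \<noteq> 0 \<and> f R = F (rep R) / G (rep R))"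
    using assms(1) unfolding regular_at_iff by blast
  obtain e F' G' where FG': "form_fun n e F'" "form_fun n e G'"
    and a': "near n X Q (\<lambda>R. G' (rep R) \<noteq> 0 \<and> g R = F' (rep R) / G' (rep R))"
    using assms(2) unfolding regular_at_iff by blast
  have "near n X Q (\<lambda>R. G (rep R) * G' (rep R) \<noteq> 0 \<and>
      f R * g R = (F (rep R) * F' (rep R)) / (G (rep R) * G' (rep R)))"
    by (rule near_mono[OF near_conj[OF a a']]) simp
  moreover have "form_fun n (d + e) (\<lambda>v. F v * F' v)" "form_fun n (d + e) (\<lambda>v. G v * G' v)"
    using FG FG' by (auto intro!: form_fun_mult)
  ultimately show ?thesis unfolding regular_at_iff by blast
qed

lemma regular_at_near_nonzero:
  assumes "regular_at n X f Q" "f Q \<noteq> 0"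
  shows "near n X Q (\<lambda>R. f R \<noteq> 0)"
proof -
  obtain d F G where FG: "form_fun n d F" "form_fun n d G"
    and a: "near n X Q (\<lambda>R. G (rep R) \<noteq> 0 \<and> f R = F (rep R) / G (rep R))"
    using assms(1) unfolding regular_at_iff by blast
  have "near n X Q (\<lambda>R. F (rep R) \<noteq> 0)"
    by (rule near_form_nonzero[OF FG(1) regular_atD[OF assms(1)]]) (use near_at[OF a] assms(2) in auto)
  from near_conj[OF a this] show ?thesis by (rule near_mono) auto
qed

lemma regular_at_inverse:
  assumes "regular_at n X f Q" "f Q \<noteq> 0"
  shows "regular_at n X (\<lambda>R. inverse (f R)) Q"
proof -
  obtain d F G where FG: "form_fun n d F" "form_fun n d G"
    and a: "near n X Q (\<lambda>R. G (rep R) \<noteq> 0 \<and> f R = F (rep R) / G (rep R))"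
    using assms(1) unfolding regular_at_iff by blast
  have "near n X Q (\<lambda>R. F (rep R) \<noteq> 0 \<and> inverse (f R) = G (rep R) / F (rep R))"
    by (rule near_mono[OF near_conj[OF a regular_at_near_nonzero[OF assms]]]) auto
  then show ?thesis using FG unfolding regular_at_iff by blast
qed

lemma regular_at_diff:
  "regular_at n X f Q \<Longrightarrow> regular_at n X g Q \<Longrightarrow> regular_at n X (\<lambda>R. f R - g R) Q"
  using regular_at_add[of f Q "\<lambda>R. -1 * g R"] regular_at_mult[of "\<lambda>_. -1" Q g]
    regular_at_const[of Q "-1"] regular_atD[of f Q] by simp

lemma regular_at_power: "regular_at n X f Q \<Longrightarrow> regular_at n X (\<lambda>R. f R ^ e) Q"
  by (induction e) (auto intro: regular_at_mult regular_at_const dest: regular_atD)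

lemma regular_at_poly: "regular_at n X f Q \<Longrightarrow> regular_at n X (\<lambda>R. poly p (f R)) Q"
  by (induction p) (auto intro!: regular_at_add regular_at_mult regular_at_const dest: regular_atD)

lemma regular_at_sum:
  "finite I \<Longrightarrow> Q \<in> X \<Longrightarrow> (\<And>i. i \<in> I \<Longrightarrow> regular_at n X (f i) Q) \<Longrightarrow> regular_at n X (\<lambda>R. \<Sum>i\<in>I. f i R) Q"
  by (induction rule: finite_induct) (auto intro!: regular_at_add regular_at_const)

definition ratio :: "nat \<Rightarrow> nat \<Rightarrow> 'k ppoint \<Rightarrow> 'k" where
  "ratio i j R = rep R i / rep R j"

lemma regular_at_ratio:
  assumes "i \<le> n" "j \<le> n" "Q \<in> X" "rep Q j \<noteq> 0"
  shows "regular_at n X (ratio i j) Q"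
proof -
  have "near n X Q (\<lambda>R. rep R j \<noteq> 0)"
    using near_form_nonzero[OF form_fun_coordinate[OF assms(2)]] assms by blast
  then have "near n X Q (\<lambda>R. rep R j \<noteq> 0 \<and> ratio i j R = rep R i / rep R j)"
    by (rule near_mono) (simp add: ratio_def)
  then show ?thesis unfolding regular_at_iff using assms form_fun_coordinate by blast
qed

lemma generate_maximal_ideal_1:
  "generate_maximal_ideal n X Q 1 (\<lambda>_. t) \<longleftrightarrow> regular_at n X t Q \<and> t Q = 0 \<and>
     (\<forall>s. regular_at n X s Q \<and> s Q = 0 \<longrightarrow>
        (\<exists>u. regular_at n X u Q \<and> near n X Q (\<lambda>R. s R = u R * t R)))"
  (is "?L \<longleftrightarrow> ?R")
proof
  assume L: ?L
  have "\<exists>u. regular_at n X u Q \<and> near n X Q (\<lambda>R. s R = u R * t R)"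
    if s: "regular_at n X s Q \<and> s Q = 0" for s
  proof -
    obtain u where u: "\<forall>i<1::nat. regular_at n X (u i) Q" "near n X Q (\<lambda>R. s R = (\<Sum>i<1. u i R * t R))"
      using L s unfolding generate_maximal_ideal_def by blast
    have "near n X Q (\<lambda>R. s R = u 0 R * t R)" by (rule near_mono[OF u(2)]) simp
    then show ?thesis using u(1) by (intro exI[of _ "u 0"]) simp
  qed
  then show ?R using L unfolding generate_maximal_ideal_def by simp
next
  assume R: ?R
  have "\<exists>u. (\<forall>i<1. regular_at n X (u i) Q) \<and> near n X Q (\<lambda>R. s R = (\<Sum>i<1::nat. u i R * t R))"
    if s: "regular_at n X s Q \<and> s Q = 0" for s
  proof -
    obtain u where u: "regular_at n X u Q" "near n X Q (\<lambda>R. s R = u R * t R)"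
      using R s by blast
    have "near n X Q (\<lambda>R. s R = (\<Sum>i<1::nat. u R * t R))" by (rule near_mono[OF u(2)]) simp
    then show ?thesis using u(1) by (intro exI[of _ "\<lambda>_. u"]) simp
  qed
  then show ?L using R unfolding generate_maximal_ideal_def by simp
qed

text \<open>In the local ring at \<open>Q\<close>, the function is congruent to its value at
  \<open>Q\<close> modulo the ideal generated by \<open>t\<close>. Such functions form a ring, so it
  is enough to test coordinates in order to see that \<open>t\<close> generates the maximal
  ideal.\<close>

definition const_mod :: "('k ppoint \<Rightarrow> 'k) \<Rightarrow> 'k ppoint \<Rightarrow> ('k ppoint \<Rightarrow> 'k) \<Rightarrow> bool" where
  "const_mod t Q f \<longleftrightarrow> regular_at n X f Q \<and>
     (\<exists>u. regular_at n X u Q \<and> near n X Q (\<lambda>R. f R = f Q + u R * t R))"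

lemma const_mod_const: "Q \<in> X \<Longrightarrow> const_mod t Q (\<lambda>_. c)"
  unfolding const_mod_def
  by (auto intro!: regular_at_const exI[of _ "\<lambda>_. 0"] near_true)

lemma const_mod_add:
  assumes "const_mod t Q f" "const_mod t Q g"
  shows "const_mod t Q (\<lambda>R. f R + g R)"
proof -
  obtain u where u: "regular_at n X u Q" "near n X Q (\<lambda>R. f R = f Q + u R * t R)"
    using assms(1) unfolding const_mod_def by blast
  obtain w where w: "regular_at n X w Q" "near n X Q (\<lambda>R. g R = g Q + w R * t R)"
    using assms(2) unfolding const_mod_def by blast
  have "near n X Q (\<lambda>R. f R + g R = f Q + g Q + (u R + w R) * t R)"
    by (rule near_mono[OF near_conj[OF u(2) w(2)]]) (simp add: algebra_simps)
  then show ?thesis using assms u w unfolding const_mod_def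
    by (intro conjI exI[of _ "\<lambda>R. u R + w R"]) (auto intro: regular_at_add)
qed

lemma const_mod_mult:
  assumes "const_mod t Q f" "const_mod t Q g"
  shows "const_mod t Q (\<lambda>R. f R * g R)"
proof -
  obtain u where u: "regular_at n X u Q" "near n X Q (\<lambda>R. f R = f Q + u R * t R)"
    using assms(1) unfolding const_mod_def by blast
  obtain w where w: "regular_at n X w Q" "near n X Q (\<lambda>R. g R = g Q + w R * t R)"
    using assms(2) unfolding const_mod_def by blast
  have reg: "regular_at n X f Q" "regular_at n X g Q" using assms by (auto simp: const_mod_def)
  note Q = regular_atD[OF reg(1)]
  have "near n X Q (\<lambda>R. f R * g R = f Q * g Q + (u R * g R + f Q * w R) * t R)"
  proof (rule near_mono[OF near_conj[OF u(2) w(2)]], elim conjE)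
    fix R assume f: "f R = f Q + u R * t R" and g: "g R = g Q + w R * t R"
    have "f R * g R = f Q * g R + u R * t R * g R" by (subst f) (simp add: algebra_simps)
    also have "f Q * g R = f Q * g Q + f Q * w R * t R" by (subst g) (simp add: algebra_simps)
    finally show "f R * g R = f Q * g Q + (u R * g R + f Q * w R) * t R" by (simp add: algebra_simps)
  qed
  moreover have "regular_at n X (\<lambda>R. u R * g R + f Q * w R) Q"
    using u w reg Q by (intro regular_at_add regular_at_mult regular_at_const)
  ultimately show ?thesis using reg unfolding const_mod_def by (blast intro: regular_at_mult)
qed

lemma const_mod_power: "const_mod t Q f \<Longrightarrow> const_mod t Q (\<lambda>R. f R ^ e)"
proof (induction e)
  case 0
  then have "Q \<in> X" using regular_atD by (auto simp: const_mod_def)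
  then show ?case using const_mod_const by simp
qed (simp add: const_mod_mult)

lemma const_mod_cong:
  assumes "const_mod t Q f" "near n X Q (\<lambda>R. g R = f R)"
  shows "const_mod t Q g"
proof -
  obtain u where u: "regular_at n X u Q" "near n X Q (\<lambda>R. f R = f Q + u R * t R)"
    using assms(1) unfolding const_mod_def by blast
  have "near n X Q (\<lambda>R. g R = g Q + u R * t R)"
    by (rule near_mono[OF near_conj[OF u(2) assms(2)]]) (use near_at[OF assms(2)] in auto)
  then show ?thesis using assms u regular_at_cong unfolding const_mod_def by blast
qed

lemma const_mod_multiple:
  assumes "regular_at n X u Q" "regular_at n X t Q" "t Q = 0"
  shows "const_mod t Q (\<lambda>R. u R * t R)"
  unfolding const_mod_def using assms regular_atD[OF assms(1)]
  by (auto intro!: regular_at_mult exI[of _ u] near_true)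

text \<open>Dividing by the coordinate \<open>j\<close>, which is nonzero at \<open>Q\<close>, turns
  the numerator and denominator of a regular function into polynomials in the ratios. If the
  function vanishes at \<open>Q\<close>, so does its numerator, which is then a multiple of
  \<open>t\<close>; the denominator is a unit.\<close>

lemma generate_maximal_idealI:
  assumes Q: "Q \<in> X" and j: "j \<le> n" "rep Q j \<noteq> 0"
    and t: "regular_at n X t Q" "t Q = 0"
    and coords: "\<And>i. i \<le> n \<Longrightarrow> const_mod t Q (ratio i j)"
  shows "generate_maximal_ideal n X Q 1 (\<lambda>_. t)"
  unfolding generate_maximal_ideal_1
proof (intro conjI allI impI t)
  fix s assume s: "regular_at n X s Q \<and> s Q = 0"
  then obtain d F G where FG: "form_fun n d F" "form_fun n d G"
    and a: "near n X Q (\<lambda>R. G (rep R) \<noteq> 0 \<and> s R = F (rep R) / G (rep R))"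
    unfolding regular_at_iff by blast
  have form: "const_mod t Q (\<lambda>R. K (\<lambda>i. ratio i j R))" if "form_fun n e K" for e K
    using that
    by (induction rule: form_fun.induct)
      (auto intro: const_mod_const[OF Q] const_mod_add const_mod_mult coords)
  have nj: "near n X Q (\<lambda>R. rep R j \<noteq> 0)"
    using near_form_nonzero[OF form_fun_coordinate[OF j(1)]] Q j by blast
  have homog: "K (\<lambda>i. ratio i j R) = inverse (rep R j) ^ e * K (rep R)" if "form_fun n e K" for e K R
    using form_fun_homogeneous[OF that, of "inverse (rep R j)" "rep R"]
    by (simp add: ratio_def divide_inverse mult.commute)
  define f g where "f = (\<lambda>R. F (\<lambda>i. ratio i j R))" and "g = (\<lambda>R. G (\<lambda>i. ratio i j R))"
  have fg: "near n X Q (\<lambda>R. g R \<noteq> 0 \<and> s R = f R / g R)"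
    by (rule near_mono[OF near_conj[OF a nj]])
      (simp add: f_def g_def homog[OF FG(1)] homog[OF FG(2)])
  have "f Q = 0" using near_at[OF fg] s by auto
  then obtain u where u: "regular_at n X u Q" "near n X Q (\<lambda>R. f R = u R * t R)"
    using form[OF FG(1)] unfolding const_mod_def f_def by auto
  have "regular_at n X g Q" using form[OF FG(2)] unfolding const_mod_def g_def by blast
  then have "regular_at n X (\<lambda>R. u R * inverse (g R)) Q"
    using near_at[OF fg] u by (intro regular_at_mult regular_at_inverse) auto
  moreover have "near n X Q (\<lambda>R. s R = u R * inverse (g R) * t R)"
    by (rule near_mono[OF near_conj[OF fg u(2)]]) (simp add: field_simps)
  ultimately show "\<exists>u. regular_at n X u Q \<and> near n X Q (\<lambda>R. s R = u R * t R)" by blast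
qed

end

section \<open>The coordinate ring of a cyclic trigonal curve\<close>

text \<open>Degree bounds for forms on the curve are phrased through the indices of nonzero
  coefficients: with \<open>degree 0 = 0\<close>, a bound such as
  \<open>degree q + k + 1 \<le> (k + 2) * d\<close> would fail for \<open>q = 0\<close> and
  \<open>d = 0\<close>. This carries bounds of that kind over to products.\<close>

lemma coeff_mult_nonzero:
  assumes "poly.coeff (p * q) i \<noteq> (0::'a::comm_semiring_0)"
  shows "\<exists>j l. i = j + l \<and> poly.coeff p j \<noteq> 0 \<and> poly.coeff q l \<noteq> 0"
proof -
  have "(\<Sum>j\<le>i. poly.coeff p j * poly.coeff q (i - j)) \<noteq> 0" using assms by (simp add: coeff_mult)
  then obtain j where "j \<in> {..i}" "poly.coeff p j * poly.coeff q (i - j) \<noteq> 0"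
    by (meson sum.not_neutral_contains_not_neutral)
  then show ?thesis by (intro exI[of _ j] exI[of _ "i - j"]) auto
qed

lemma degree_add_less_left:
  fixes t s :: "'a::ab_group_add poly"
  assumes "degree s < degree t"
  shows "t + s \<noteq> 0 \<and> degree (t + s) = degree t"
  using degree_add_eq_left[OF assms] assms by auto

lemma finite_roots_power3: "finite {y::'k::field. y ^ 3 = c}"
proof -
  have "finite {y. poly [:-c, 0, 0, 1:] y = 0}" by (rule poly_roots_finite) simp
  moreover have "poly [:-c, 0, 0, 1:] y = y ^ 3 - c" for y by (simp add: power3_eq_cube)
  ultimately show ?thesis by simp
qed

type_synonym 'k triple = "'k poly \<times> 'k poly \<times> 'k poly"

locale trigonal =
  fixes a b :: "'k::{alg_closed_field, field_char_0} poly" and k :: nat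
  assumes degree_a: "degree a = k + 2" and degree_b: "degree b = k"
    and disjoint_roots: "poly a x = 0 \<Longrightarrow> poly b x \<noteq> 0"
    and simple_a: "a = [:- x, 1:] * c \<Longrightarrow> poly c x \<noteq> 0"
    and simple_b: "b = [:- x, 1:] * c \<Longrightarrow> poly c x \<noteq> 0"
begin

lemma a_nonzero: "a \<noteq> 0"
  using degree_a by auto

text \<open>For \<open>k = 0\<close> the degree does not exclude \<open>b = 0\<close>, but
  \<open>a\<close> has a root, and there \<open>b\<close> does not vanish.\<close>

lemma b_nonzero: "b \<noteq> 0"
proof -
  obtain x where "poly a x = 0" using alg_closed_imp_poly_has_root[of a] degree_a by auto
  then show ?thesis using disjoint_roots by force
qed

text \<open>The equations are the 2 by 2 minors of the matrix with rows \<open>(b, y, z)\<close> and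
  \<open>(y, z, a)\<close>. They make \<open>y\<close> and \<open>z\<close> cube roots of
  \<open>a * b^2\<close> and \<open>a^2 * b\<close>, matched so that their product is
  \<open>a * b\<close>.\<close>

definition curve :: "('k \<times> 'k \<times> 'k) set" where
  "curve = {(x, y, z). y ^ 2 = poly b x * z \<and> y * z = poly a x * poly b x \<and> z ^ 2 = poly a x * y}"

text \<open>The triple \<open>(p, q, r)\<close> stands for the function \<open>p(x) + q(x) y + r(x) z\<close> on the curve.\<close>

fun ev :: "'k triple \<Rightarrow> 'k \<times> 'k \<times> 'k \<Rightarrow> 'k" where
  "ev (p, q, r) (x, y, z) = poly p x + poly q x * y + poly r x * z"

fun mul :: "'k triple \<Rightarrow> 'k triple \<Rightarrow> 'k triple" where
  "mul (p, q, r) (p', q', r') =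
     (p * p' + a * b * (q * r' + r * q'), p * q' + q * p' + a * r * r', p * r' + r * p' + b * q * q')"

text \<open>This is the product of the conjugates
  \<open>p + \<omega>^i q y + \<omega>^(2 i) r z\<close> over the three cube roots of unity.\<close>

fun norm3 :: "'k triple \<Rightarrow> 'k poly" where
  "norm3 (p, q, r) = p ^ 3 + a * b ^ 2 * q ^ 3 + a ^ 2 * b * r ^ 3 - 3 * (a * b * p * q * r)"

text \<open>The product of the two other conjugates, so that a triple times its \<open>adj\<close>
  is the norm.\<close>

fun adj :: "'k triple \<Rightarrow> 'k triple" where
  "adj (p, q, r) = (p ^ 2 - a * b * q * r, a * r ^ 2 - p * q, b * q ^ 2 - p * r)"

text \<open>The pole order at the point at infinity.\<close>

fun wt :: "'k triple \<Rightarrow> nat" where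
  "wt (p, q, r) = max (3 * degree p) (max (if q = 0 then 0 else 3 * degree q + 3 * k + 2)
     (if r = 0 then 0 else 3 * degree r + 3 * k + 4))"

lemma curveD:
  assumes "(x, y, z) \<in> curve"
  shows "y ^ 2 = poly b x * z" "y * z = poly a x * poly b x" "z ^ 2 = poly a x * y"
    "y ^ 3 = poly a x * poly b x ^ 2" "z ^ 3 = poly a x ^ 2 * poly b x"
proof -
  show e: "y ^ 2 = poly b x * z" "y * z = poly a x * poly b x" "z ^ 2 = poly a x * y"
    using assms by (auto simp: curve_def)
  have "y ^ 3 = y * y ^ 2" by (simp add: power3_eq_cube power2_eq_square)
  also have "\<dots> = poly b x * (y * z)" by (simp add: e(1))
  finally show "y ^ 3 = poly a x * poly b x ^ 2" by (simp add: e(2) power2_eq_square)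
  have "z ^ 3 = z * z ^ 2" by (simp add: power3_eq_cube power2_eq_square)
  also have "\<dots> = poly a x * (y * z)" by (simp add: e(3))
  finally show "z ^ 3 = poly a x ^ 2 * poly b x" by (simp add: e(2) power2_eq_square)
qed

lemma ev_mul: "w \<in> curve \<Longrightarrow> ev (mul S T) w = ev S w * ev T w"
proof -
  assume w: "w \<in> curve"
  obtain x y z where [simp]: "w = (x, y, z)" by (cases w)
  obtain p q r where [simp]: "S = (p, q, r)" by (cases S)
  obtain p' q' r' where [simp]: "T = (p', q', r')" by (cases T)
  have e: "y * y = poly b x * z" "y * z = poly a x * poly b x" "z * z = poly a x * y"
    using curveD[of x y z] w by (auto simp: power2_eq_square)
  have "ev S w * ev T w = poly p x * poly p' x + (poly q x * poly r' x + poly r x * poly q' x) * (y * z)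
     + (poly p x * poly q' x + poly q x * poly p' x) * y + poly r x * poly r' x * (z * z)
     + (poly p x * poly r' x + poly r x * poly p' x) * z + poly q x * poly q' x * (y * y)"
    by (simp add: algebra_simps)
  also have "\<dots> = ev (mul S T) w" unfolding e by (simp add: algebra_simps)
  finally show ?thesis ..
qed

lemma norm3_mul: "norm3 (mul S T) = norm3 S * norm3 T"
proof -
  obtain p q r where [simp]: "S = (p, q, r)" by (cases S)
  obtain p' q' r' where [simp]: "T = (p', q', r')" by (cases T)
  show ?thesis by simp algebra
qed

lemma mul_adj: "mul T (adj T) = (norm3 T, 0, 0)"
  by (cases T) (simp add: algebra_simps power2_eq_square power3_eq_cube)

lemma mul_commute: "mul S T = mul T S"
  by (cases S; cases T) (simp add: algebra_simps)

lemma mul_assoc: "mul (mul S T) U = mul S (mul T U)"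
  by (cases S; cases T; cases U) (simp add: algebra_simps)

lemma norm3_wt:
  assumes "T \<noteq> (0, 0, 0)"
  shows "norm3 T \<noteq> 0" "degree (norm3 T) = wt T"
proof -
  obtain p q r where T: "T = (p, q, r)" by (cases T)
  define t1 where "t1 = p ^ 3"
  define t2 where "t2 = a * b ^ 2 * q ^ 3"
  define t3 where "t3 = a ^ 2 * b * r ^ 3"
  define t4 where "t4 = 3 * (a * b * p * q * r)"
  have N: "norm3 T = t1 + t2 + t3 - t4" by (simp add: T t1_def t2_def t3_def t4_def)
  have d1: "degree t1 = 3 * degree p" 
    by (cases "p = 0") (auto simp: t1_def degree_power_eq)
  have d2: "degree t2 = (if q = 0 then 0 else 3 * degree q + 3 * k + 2)"
    using a_nonzero b_nonzero
    by (auto simp: t2_def degree_mult_eq degree_power_eq degree_a degree_b)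
  have d3: "degree t3 = (if r = 0 then 0 else 3 * degree r + 3 * k + 4)"
    using a_nonzero b_nonzero
    by (auto simp: t3_def degree_mult_eq degree_power_eq degree_a degree_b)
  have three: "degree (3 * u) = degree u" for u :: "'k poly"
    using degree_smult_eq[of "3::'k" u] by (simp add: numeral_poly)
  have d4: "t4 = 0 \<or> q \<noteq> 0 \<and> r \<noteq> 0 \<and> p \<noteq> 0 \<and> degree t4 = 2 * k + 2 + degree p + degree q + degree r"
    using a_nonzero b_nonzero
    by (auto simp: t4_def three degree_mult_eq degree_a degree_b)
  have main: "norm3 T \<noteq> 0 \<and> degree (norm3 T) = wt T"
  \<comment> \<open>In weight 0 the default degree 0 of vanishing terms collides with that of
    \<open>t1\<close>, and residues modulo 3 separate nothing. There \<open>q = r = 0\<close> and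
    the norm is the nonzero constant \<open>p ^ 3\<close>.\<close>
  proof (cases "wt T = 0")
    case True
    then have "q = 0" "r = 0" "degree p = 0" by (auto simp: T split: if_splits)
    then have "norm3 T = t1" "p \<noteq> 0" using assms by (auto simp: T t1_def)
    then show ?thesis using True d1 \<open>degree p = 0\<close> by (simp add: t1_def)
  next
    case False
    have add: ?thesis if "norm3 T = t + (s1 + s2 - s3)" "degree t = wt T" "degree s1 < wt T"
      "degree s2 < wt T" "degree s3 < wt T" for t s1 s2 s3
      using that degree_add_less_left[of "s1 + s2 - s3" t] degree_diff_less[of "s1 + s2" "wt T" s3]
        degree_add_less[of s1 "wt T" s2] by simp
    \<comment> \<open>When \<open>t4 \<noteq> 0\<close>, its degree is the mean of the degrees of
      \<open>t1\<close>, \<open>t2\<close>, \<open>t3\<close>. These differ modulo 3, so the mean is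
      below the maximum.\<close>
    have t4: "degree t4 < wt T"
    proof (cases "t4 = 0")
      case False
      then have *: "q \<noteq> 0" "r \<noteq> 0" "degree t4 = 2 * k + 2 + degree p + degree q + degree r"
        using d4 by auto
      then have "3 * degree p \<le> wt T" "3 * degree q + 3 * k + 2 \<le> wt T" "3 * degree r + 3 * k + 4 \<le> wt T"
        by (auto simp: T)
      then show ?thesis using *(3) by presburger
    qed (use False in simp)
    have "wt T = degree t1 \<or> wt T = degree t2 \<or> wt T = degree t3"
      unfolding d1 d2 d3 by (simp add: T max_def)
    moreover have le: "degree t1 \<le> wt T" "degree t2 \<le> wt T" "degree t3 \<le> wt T"
      unfolding d1 d2 d3 by (auto simp: T)
    moreover have ne: "degree t1 = wt T \<Longrightarrow> degree t2 \<noteq> wt T \<and> degree t3 \<noteq> wt T"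
      "degree t2 = wt T \<Longrightarrow> degree t3 \<noteq> wt T"
      using False unfolding d1 d2 d3 by (cases "q = 0"; cases "r = 0"; simp; presburger)+
    ultimately consider "degree t1 = wt T" "degree t2 < wt T" "degree t3 < wt T"
      | "degree t2 = wt T" "degree t1 < wt T" "degree t3 < wt T"
      | "degree t3 = wt T" "degree t1 < wt T" "degree t2 < wt T"
      by (metis order_le_less)
    then show ?thesis
    proof cases
      case 1 then show ?thesis by (intro add[of t1 t2 t3 t4]) (use t4 N in \<open>simp_all add: algebra_simps\<close>)
    next
      case 2 then show ?thesis by (intro add[of t2 t1 t3 t4]) (use t4 N in \<open>simp_all add: algebra_simps\<close>)
    next
      case 3 then show ?thesis by (intro add[of t3 t1 t2 t4]) (use t4 N in \<open>simp_all add: algebra_simps\<close>)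
    qed
  qed
  then show "norm3 T \<noteq> 0" "degree (norm3 T) = wt T" by auto
qed

lemma norm3_root: "(x, y, z) \<in> curve \<Longrightarrow> ev T (x, y, z) = 0 \<Longrightarrow> poly (norm3 T) x = 0"
  using ev_mul[of "(x, y, z)" T "adj T"] by (simp add: mul_adj)

lemma finite_fibre: "finite {w \<in> curve. fst w = x}"
proof -
  have "{w \<in> curve. fst w = x} \<subseteq>
      {x} \<times> {y. y ^ 3 = poly a x * poly b x ^ 2} \<times> {z. z ^ 3 = poly a x ^ 2 * poly b x}"
    using curveD(4,5) by fastforce
  then show ?thesis by (rule finite_subset) (intro finite_cartesian_product finite_roots_power3, simp)
qed

text \<open>The norm is a multiple of the triple, so zeros lie over the finitely many roots of the
  norm, each with a finite fibre.\<close>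

lemma finite_zeros:
  assumes "T \<noteq> (0, 0, 0)"
  shows "finite {w \<in> curve. ev T w = 0}"
proof -
  have "{w \<in> curve. ev T w = 0} \<subseteq> (\<Union>x\<in>{x. poly (norm3 T) x = 0}. {w \<in> curve. fst w = x})"
  proof
    fix w assume w: "w \<in> {w \<in> curve. ev T w = 0}"
    then show "w \<in> (\<Union>x\<in>{x. poly (norm3 T) x = 0}. {w \<in> curve. fst w = x})"
      using norm3_root[of "fst w" "fst (snd w)" "snd (snd w)" T] by simp
  qed
  moreover have "finite (\<Union>x\<in>{x. poly (norm3 T) x = 0}. {w \<in> curve. fst w = x})"
    using poly_roots_finite[OF norm3_wt(1)[OF assms]] finite_fibre by blast
  ultimately show ?thesis by (rule finite_subset)
qed

lemma curve_over: "\<exists>y z. (x, y, z) \<in> curve"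
proof (cases "poly a x * poly b x = 0")
  case True
  then show ?thesis by (intro exI[of _ 0]) (auto simp: curve_def)
next
  case False
  obtain y where y: "y ^ 3 = poly a x * poly b x ^ 2" using nth_root_exists[of 3] by auto
  then have y0: "y \<noteq> 0" using False by auto
  define z where "z = poly a x * poly b x / y"
  have "y ^ 2 = poly b x * z" using y y0
    by (simp add: z_def field_simps power2_eq_square power3_eq_cube)
  moreover have "y * z = poly a x * poly b x" using y0 by (simp add: z_def)
  moreover have "z ^ 2 = poly a x * y"
  proof -
    have "z ^ 2 * y ^ 2 = poly a x * y * y ^ 2"
      using y y0 by (simp add: z_def field_simps power2_eq_square power3_eq_cube)
    then show ?thesis using y0 by simp
  qed
  ultimately show ?thesis by (auto simp: curve_def)
qed

lemma infinite_curve: "infinite curve"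
proof
  assume "finite curve"
  moreover have "fst ` curve = UNIV" using curve_over by (force simp: image_iff)
  ultimately show False using infinite_UNIV_char_0 by (metis finite_imageI)
qed

lemma ev_zero_cofinite:
  assumes "finite {w \<in> curve. ev T w \<noteq> 0}"
  shows "T = (0, 0, 0)"
proof (rule ccontr)
  assume "T \<noteq> (0, 0, 0)"
  then have "finite ({w \<in> curve. ev T w = 0} \<union> {w \<in> curve. ev T w \<noteq> 0})"
    using finite_zeros assms by blast
  moreover have "{w \<in> curve. ev T w = 0} \<union> {w \<in> curve. ev T w \<noteq> 0} = curve" by blast
  ultimately show False using infinite_curve by simp
qed

text \<open>An identity principle: identities between functions off a finite set become identities
  between triples, whose components and weights can be compared.\<close>

lemma ev_eq_cofinite:
  assumes "finite {w \<in> curve. ev S w \<noteq> ev T w}"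
  shows "S = T"
proof -
  obtain p q r where S: "S = (p, q, r)" by (cases S)
  obtain p' q' r' where T: "T = (p', q', r')" by (cases T)
  have "ev (p - p', q - q', r - r') w = ev S w - ev T w" for w
    by (cases w) (simp add: S T algebra_simps)
  then have "(p - p', q - q', r - r') = (0, 0, 0)"
    by (intro ev_zero_cofinite) (use assms in simp)
  then show ?thesis by (simp add: S T)
qed


section \<open>The projective model\<close>

text \<open>The largest pole order is 3 k + 6, attained only by \<open>x^(k+2)\<close>; dividing by
  this coordinate gives a chart at infinity. The coordinate \<open>x * y\<close>, of order 3 k + 5,
  secures smoothness there: its ratio has a simple zero, while \<open>z\<close>, \<open>y\<close>
  and the lower powers of \<open>x\<close> give zeros of order at least 2.\<close>

fun emb :: "'k \<times> 'k \<times> 'k \<Rightarrow> nat \<Rightarrow> 'k" where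
  "emb (x, y, z) i = (if i \<le> k + 2 then x ^ i else if i = k + 3 then y else if i = k + 4 then x * y
     else if i = k + 5 then z else 0)"

definition inf_vec :: "nat \<Rightarrow> 'k" where
  "inf_vec i = (if i = k + 2 then 1 else 0)"

definition Pinf :: "'k ppoint" where
  "Pinf = point inf_vec"

definition X :: "'k ppoint set" where
  "X = insert Pinf ((\<lambda>w. point (emb w)) ` curve)"

text \<open>A form of degree \<open>d\<close> has pole order at most \<open>3 (k + 2) d\<close> at infinity, and its value there is
  the coefficient of \<open>x ^ ((k + 2) d)\<close>.\<close>

lemma form_fun_on_curve:
  assumes "form_fun (k + 5) d F"
  shows "\<exists>p q r. (\<forall>w\<in>curve. F (emb w) = ev (p, q, r) w) \<and>
     poly.coeff p ((k + 2) * d) = F inf_vec \<and>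
     (\<forall>i. poly.coeff p i \<noteq> 0 \<longrightarrow> i \<le> (k + 2) * d) \<and>
     (\<forall>i. poly.coeff q i \<noteq> 0 \<longrightarrow> i + k + 1 \<le> (k + 2) * d) \<and>
     (\<forall>i. poly.coeff r i \<noteq> 0 \<longrightarrow> i + k + 2 \<le> (k + 2) * d)"
  using assms
\<comment> \<open>The offsets are rounded up thirds of pole orders:
  \<open>3 i + 3 k + 2 \<le> 3 (k + 2) d\<close> amounts to
  \<open>i + k + 1 \<le> (k + 2) d\<close>, and \<open>3 i + 3 k + 4\<close> leads to
  \<open>i + k + 2\<close> in the same way.\<close>
proof (induction rule: form_fun.induct)
  case (const c)
  show ?case
    by (rule exI[of _ "[:c:]"], rule exI[of _ 0], rule exI[of _ 0])
      (auto simp: coeff_pCons split: nat.splits)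
next
  case (zero d)
  show ?case by (rule exI[of _ 0], rule exI[of _ 0], rule exI[of _ 0]) auto
next
  case (add d F G)
  obtain p q r where 1: "\<forall>w\<in>curve. F (emb w) = ev (p, q, r) w"
     "poly.coeff p ((k + 2) * d) = F inf_vec"
     "\<forall>i. poly.coeff p i \<noteq> 0 \<longrightarrow> i \<le> (k + 2) * d"
     "\<forall>i. poly.coeff q i \<noteq> 0 \<longrightarrow> i + k + 1 \<le> (k + 2) * d"
     "\<forall>i. poly.coeff r i \<noteq> 0 \<longrightarrow> i + k + 2 \<le> (k + 2) * d"
    using add.IH(1) by blast
  obtain p' q' r' where 2: "\<forall>w\<in>curve. G (emb w) = ev (p', q', r') w"
     "poly.coeff p' ((k + 2) * d) = G inf_vec"
     "\<forall>i. poly.coeff p' i \<noteq> 0 \<longrightarrow> i \<le> (k + 2) * d"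
     "\<forall>i. poly.coeff q' i \<noteq> 0 \<longrightarrow> i + k + 1 \<le> (k + 2) * d"
     "\<forall>i. poly.coeff r' i \<noteq> 0 \<longrightarrow> i + k + 2 \<le> (k + 2) * d"
    using add.IH(2) by blast
  show ?case
  proof (rule exI[of _ "p + p'"], rule exI[of _ "q + q'"], rule exI[of _ "r + r'"], intro conjI allI impI ballI)
    fix w assume "w \<in> curve"
    then show "F (emb w) + G (emb w) = ev (p + p', q + q', r + r') w"
      using 1(1) 2(1) by (cases w) (simp add: algebra_simps)
  next
    show "poly.coeff (p + p') ((k + 2) * d) = F inf_vec + G inf_vec" using 1(2) 2(2) by simp
  next
    fix i assume "poly.coeff (p + p') i \<noteq> 0"
    then have "poly.coeff p i \<noteq> 0 \<or> poly.coeff p' i \<noteq> 0" by auto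
    then show "i \<le> (k + 2) * d" using 1(3) 2(3) by blast
  next
    fix i assume "poly.coeff (q + q') i \<noteq> 0"
    then have "poly.coeff q i \<noteq> 0 \<or> poly.coeff q' i \<noteq> 0" by auto
    then show "i + k + 1 \<le> (k + 2) * d" using 1(4) 2(4) by blast
  next
    fix i assume "poly.coeff (r + r') i \<noteq> 0"
    then have "poly.coeff r i \<noteq> 0 \<or> poly.coeff r' i \<noteq> 0" by auto
    then show "i + k + 2 \<le> (k + 2) * d" using 1(5) 2(5) by blast
  qed
next
  case (coord j d F)
  obtain p q r where *: "\<forall>w\<in>curve. F (emb w) = ev (p, q, r) w"
     "poly.coeff p ((k + 2) * d) = F inf_vec"
     "\<And>i. poly.coeff p i \<noteq> 0 \<Longrightarrow> i \<le> (k + 2) * d"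
     "\<And>i. poly.coeff q i \<noteq> 0 \<Longrightarrow> i + k + 1 \<le> (k + 2) * d"
     "\<And>i. poly.coeff r i \<noteq> 0 \<Longrightarrow> i + k + 2 \<le> (k + 2) * d"
    using coord.IH by blast
  define D where "D = (k + 2) * d"
  have D: "(k + 2) * Suc d = D + k + 2" by (simp add: D_def)
  note * = *[folded D_def]
  have da: "poly.coeff a i \<noteq> 0 \<Longrightarrow> i \<le> k + 2" and db: "poly.coeff b i \<noteq> 0 \<Longrightarrow> i \<le> k" for i
    using le_degree[of a i] le_degree[of b i] by (auto simp: degree_a degree_b)
  have dab: "poly.coeff (a * b) i \<noteq> 0 \<Longrightarrow> i \<le> 2 * k + 2" for i
    using le_degree[of "a * b" i] a_nonzero b_nonzero by (simp add: degree_mult_eq degree_a degree_b)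
  consider "j \<le> k + 2" | "j = k + 3" | "j = k + 4" | "j = k + 5" using coord(1) by linarith
  then show ?case
  proof cases
    case 1
    show ?thesis unfolding D
    proof (rule exI[of _ "monom 1 j * p"], rule exI[of _ "monom 1 j * q"], rule exI[of _ "monom 1 j * r"],
        intro conjI allI impI ballI)
      fix w assume w: "w \<in> curve"
      then show "emb w j * F (emb w) = ev (monom 1 j * p, monom 1 j * q, monom 1 j * r) w"
        using *(1) 1 by (cases w) (simp add: algebra_simps poly_monom)
    next
      show "poly.coeff (monom 1 j * p) (D + k + 2) = inf_vec j * F inf_vec"
      proof (cases "j = k + 2")
        case True
        then show ?thesis using *(2) by (simp add: coeff_monom_mult inf_vec_def)
      next
        case False
        then have "poly.coeff p (D + k + 2 - j) = 0" using *(3)[of "D + k + 2 - j"] 1 by fastforce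
        then show ?thesis using False by (simp add: coeff_monom_mult inf_vec_def)
      qed
    next
      fix i assume "poly.coeff (monom 1 j * p) i \<noteq> 0"
      then show "i \<le> D + k + 2" using *(3)[of "i - j"] 1 by (auto simp: coeff_monom_mult split: if_splits)
    next
      fix i assume "poly.coeff (monom 1 j * q) i \<noteq> 0"
      then show "i + k + 1 \<le> D + k + 2" using *(4)[of "i - j"] 1 by (auto simp: coeff_monom_mult split: if_splits)
    next
      fix i assume "poly.coeff (monom 1 j * r) i \<noteq> 0"
      then show "i + k + 2 \<le> D + k + 2" using *(5)[of "i - j"] 1 by (auto simp: coeff_monom_mult split: if_splits)
    qed
  next
    case 2
    \<comment> \<open>Multiplication by \<open>y\<close> sends \<open>p + q y + r z\<close> to
      \<open>a b r + p y + b q z\<close>. The new first component stays below the top index, in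
      accordance with \<open>inf_vec (k + 3) = 0\<close>.\<close>
    have b1: "i \<le> D + k" if "poly.coeff (a * b * r) i \<noteq> 0" for i
      using coeff_mult_nonzero[OF that] dab *(5) by fastforce
    show ?thesis unfolding D
    proof (rule exI[of _ "a * b * r"], rule exI[of _ p], rule exI[of _ "b * q"],
        intro conjI allI impI ballI)
      fix w assume w: "w \<in> curve"
      then have "emb w j * F (emb w) = ev (mul (0, 1, 0) (p, q, r)) w"
        using *(1) 2 ev_mul[OF w, of "(0, 1, 0)" "(p, q, r)"] by (cases w) simp
      then show "emb w j * F (emb w) = ev (a * b * r, p, b * q) w" by simp
    next
      show "poly.coeff (a * b * r) (D + k + 2) = inf_vec j * F inf_vec"
        using b1[of "D + k + 2"] 2 by (fastforce simp: inf_vec_def)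
    next
      fix i assume "poly.coeff (a * b * r) i \<noteq> 0" then show "i \<le> D + k + 2" using b1[of i] by simp
    next
      fix i assume "poly.coeff p i \<noteq> 0" then show "i + k + 1 \<le> D + k + 2" using *(3)[of i] by simp
    next
      fix i assume "poly.coeff (b * q) i \<noteq> 0"
      from coeff_mult_nonzero[OF this] show "i + k + 2 \<le> D + k + 2" using db *(4) by fastforce
    qed
  next
    case 3
    have b1: "i \<le> D + k" if "poly.coeff (a * b * r) i \<noteq> 0" for i
      using coeff_mult_nonzero[OF that] dab *(5) by fastforce
    show ?thesis unfolding D
    proof (rule exI[of _ "pCons 0 (a * b * r)"], rule exI[of _ "pCons 0 p"], rule exI[of _ "pCons 0 (b * q)"],
        intro conjI allI impI ballI)
      fix w assume w: "w \<in> curve"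
      then have "emb w j * F (emb w) = fst w * ev (mul (0, 1, 0) (p, q, r)) w"
        using *(1) 3 ev_mul[OF w, of "(0, 1, 0)" "(p, q, r)"] by (cases w) simp
      then show "emb w j * F (emb w) = ev (pCons 0 (a * b * r), pCons 0 p, pCons 0 (b * q)) w"
        by (cases w) (simp add: algebra_simps)
    next
      show "poly.coeff (pCons 0 (a * b * r)) (D + k + 2) = inf_vec j * F inf_vec"
        using b1[of "D + k + 1"] 3 by (fastforce simp: inf_vec_def coeff_pCons)
    next
      fix i assume "poly.coeff (pCons 0 (a * b * r)) i \<noteq> 0"
      then show "i \<le> D + k + 2" using b1[of "i - 1"] by (cases i) auto
    next
      fix i assume "poly.coeff (pCons 0 p) i \<noteq> 0"
      then show "i + k + 1 \<le> D + k + 2" using *(3)[of "i - 1"] by (cases i) auto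
    next
      fix i assume "poly.coeff (pCons 0 (b * q)) i \<noteq> 0"
      then obtain i' where i': "i = Suc i'" "poly.coeff (b * q) i' \<noteq> 0" by (cases i) auto
      from coeff_mult_nonzero[OF i'(2)] show "i + k + 2 \<le> D + k + 2" using db *(4) i'(1) by fastforce
    qed
  next
    case 4
    have b1: "i \<le> D + k + 1" if "poly.coeff (a * b * q) i \<noteq> 0" for i
      using coeff_mult_nonzero[OF that] dab *(4) by fastforce
    show ?thesis unfolding D
    proof (rule exI[of _ "a * b * q"], rule exI[of _ "a * r"], rule exI[of _ p],
        intro conjI allI impI ballI)
      fix w assume w: "w \<in> curve"
      then have "emb w j * F (emb w) = ev (mul (0, 0, 1) (p, q, r)) w"
        using *(1) 4 ev_mul[OF w, of "(0, 0, 1)" "(p, q, r)"] by (cases w) simp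
      then show "emb w j * F (emb w) = ev (a * b * q, a * r, p) w" by simp
    next
      show "poly.coeff (a * b * q) (D + k + 2) = inf_vec j * F inf_vec"
        using b1[of "D + k + 2"] 4 by (fastforce simp: inf_vec_def)
    next
      fix i assume "poly.coeff (a * b * q) i \<noteq> 0" then show "i \<le> D + k + 2" using b1[of i] by simp
    next
      fix i assume "poly.coeff (a * r) i \<noteq> 0"
      from coeff_mult_nonzero[OF this] show "i + k + 1 \<le> D + k + 2" using da *(5) by fastforce
    next
      fix i assume "poly.coeff p i \<noteq> 0" then show "i + k + 2 \<le> D + k + 2" using *(3)[of i] by simp
    qed
  qed
qed

end

context trigonal
begin

lemma emb_coords:
  "i \<le> k + 2 \<Longrightarrow> emb (x, y, z) i = x ^ i" "emb (x, y, z) (k + 3) = y"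
  "emb (x, y, z) (k + 4) = x * y" "emb (x, y, z) (k + 5) = z"
  by simp_all

lemma emb_0: "emb w 0 = 1"
  by (cases w) simp

lemma emb_high: "k + 5 < i \<Longrightarrow> emb w i = 0"
  by (cases w) simp

lemma point_emb_in_proj_space: "point (emb w) \<in> proj_space (k + 5)"
  unfolding in_proj_space_iff using emb_0 emb_high by (metis le0 zero_neq_one)

lemma Pinf_in_proj_space: "Pinf \<in> proj_space (k + 5)"
  unfolding in_proj_space_iff Pinf_def
  by (rule exI[of _ inf_vec]) (auto simp: inf_vec_def intro!: exI[of _ "k + 2"])

lemma X_subset: "X \<subseteq> proj_space (k + 5)"
  using point_emb_in_proj_space Pinf_in_proj_space by (auto simp: X_def)

lemma rep_point:
  assumes "point v \<in> proj_space (k + 5)"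
  obtains c where "c \<noteq> 0" "rep (point v) = (\<lambda>i. c * v i)"
  using rep_in[OF assms] by (auto simp: point_def)

lemma form_zero_point_iff:
  assumes "form_fun (k + 5) d F" "point v \<in> proj_space (k + 5)"
  shows "F (rep (point v)) = 0 \<longleftrightarrow> F v = 0"
  using form_fun_zero_iff[OF assms(1) rep_in[OF assms(2)]] .

definition form_a :: "(nat \<Rightarrow> 'k) \<Rightarrow> 'k" where
  "form_a v = (\<Sum>i\<le>k + 2. poly.coeff a i * v i)"

text \<open>A linear form that restricts to \<open>x^s * b(x)\<close> on the curve. The one with
  \<open>s = 0\<close> vanishes at infinity and the one with \<open>s = 2\<close> does not; both
  behaviours are used.\<close>

definition form_b :: "nat \<Rightarrow> (nat \<Rightarrow> 'k) \<Rightarrow> 'k" where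
  "form_b s v = (\<Sum>i\<le>k. poly.coeff b i * v (i + s))"

lemma form_a_emb: "form_a (emb (x, y, z)) = poly a x"
  by (simp add: form_a_def poly_altdef degree_a)

lemma form_b_emb: "s \<le> 2 \<Longrightarrow> form_b s (emb (x, y, z)) = x ^ s * poly b x"
  by (simp add: form_b_def poly_altdef degree_b sum_distrib_left power_add mult_ac)

lemma form_a: "form_fun (k + 5) 1 form_a"
  unfolding form_a_def
  by (intro form_fun_sum form_fun_scale form_fun_coordinate) auto

lemma form_b: "s \<le> 2 \<Longrightarrow> form_fun (k + 5) 1 (form_b s)"
  unfolding form_b_def
  by (intro form_fun_sum form_fun_scale form_fun_coordinate) auto

lemma form_a_inf: "form_a inf_vec = poly.coeff a (k + 2)"
  by (simp add: form_a_def inf_vec_def)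

lemma form_b_inf: "form_b 0 inf_vec = 0" "form_b 2 inf_vec = poly.coeff b k"
  by (simp_all add: form_b_def inf_vec_def if_distrib cong: if_cong)

text \<open>All forms vanishing on \<open>X\<close> serve as equations, but the quadrics
  \<open>e1\<close> to \<open>e7\<close> among them already cut out \<open>X\<close>. Where the
  coordinate 0 vanishes they leave just the point at infinity; elsewhere they return the affine
  equations.\<close>

lemma X_closed: "zariski_closed (k + 5) X"
proof -
  define S where "S = {F. (\<exists>d. form_fun (k + 5) d F) \<and> (\<forall>w\<in>curve. F (emb w) = 0) \<and> F inf_vec = 0}"
  have "Q \<in> X" if Q: "Q \<in> proj_space (k + 5)" and z: "\<And>F. F \<in> S \<Longrightarrow> F (rep Q) = 0" for Q
  proof -
    define v where "v = rep Q"
    have v: "v \<in> Q" "Q = point v" unfolding v_def using rep_in[OF Q] in_proj_spaceD(1)[OF Q] by auto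
    note high = in_proj_spaceD(2)[OF Q v(1)]
    have quad: "f v * g v = f' v * g' v"
      if "form_fun (k + 5) 1 f" "form_fun (k + 5) 1 g" "form_fun (k + 5) 1 f'" "form_fun (k + 5) 1 g'"
        and "\<And>x y z. (x, y, z) \<in> curve \<Longrightarrow>
          f (emb (x, y, z)) * g (emb (x, y, z)) = f' (emb (x, y, z)) * g' (emb (x, y, z))"
        and "f inf_vec * g inf_vec = f' inf_vec * g' inf_vec" for f g f' g'
    proof -
      have "form_fun (k + 5) (1 + 1) (\<lambda>v. f v * g v - f' v * g' v)"
        using that by (intro form_fun_diff form_fun_mult)
      then have "(\<lambda>v. f v * g v - f' v * g' v) \<in> S" using that unfolding S_def by auto
      then show ?thesis using z unfolding v_def by fastforce
    qed
    note forms = form_fun_coordinate[of _ "k + 5", unfolded One_nat_def] form_a[unfolded One_nat_def]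
      form_b[unfolded One_nat_def]
    have e1: "v 0 * v (i + 1) = v 1 * v i" if "i \<le> k + 1" for i
      by (rule quad) (use that in \<open>auto intro!: forms simp del: emb.simps simp: emb_coords inf_vec_def\<close>)
    have e2: "v (i + 1) * v (i + 1) = v i * v (i + 2)" if "i \<le> k" for i
      by (rule quad) (use that in \<open>auto intro!: forms simp del: emb.simps simp: emb_coords inf_vec_def\<close>)
    have e3: "v 0 * v (k + 4) = v 1 * v (k + 3)"
      by (rule quad) (auto intro!: forms simp del: emb.simps simp: emb_coords inf_vec_def)
    have e4: "v (k + 3) * v (k + 3) = form_b 0 v * v (k + 5)"
      by (rule quad)
        (auto intro!: forms simp del: emb.simps simp: emb_coords form_b_emb form_b_inf inf_vec_def curve_def power2_eq_square)
    have e5: "v (k + 3) * v (k + 5) = form_a v * form_b 0 v"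
      by (rule quad)
        (auto intro!: forms simp del: emb.simps simp: emb_coords form_a_emb form_b_emb form_b_inf curve_def inf_vec_def[of "k + 3"] inf_vec_def[of "k + 5"])
    have e6: "v (k + 5) * v (k + 5) = form_a v * v (k + 3)"
      by (rule quad)
        (auto intro!: forms simp del: emb.simps simp: emb_coords form_a_emb inf_vec_def curve_def power2_eq_square)
    \<comment> \<open>This comes from \<open>(x y)^2 = x^2 b(x) z\<close>. On the hyperplane at
      infinity it forces the coordinate \<open>k + 4\<close> to vanish.\<close>
    have e7: "v (k + 4) * v (k + 4) = form_b 2 v * v (k + 5)"
      by (rule quad)
        (auto intro!: forms simp del: emb.simps simp: emb_coords form_b_emb inf_vec_def curve_def power2_eq_square mult_ac)
    show "Q \<in> X"
    proof (cases "v 0 = 0")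
      case True
      \<comment> \<open>By \<open>e2\<close> the square of each coordinate is the product of its
        neighbours, so zeros propagate upwards and stop just before \<open>k + 2\<close>.\<close>
      have v0: "v i = 0" if "i \<le> k + 1" for i
        using that
      proof (induction i)
        case (Suc i)
        then show ?case using e2[of i] by simp
      qed (rule True)
      have "form_b 0 v = 0" unfolding form_b_def by (rule sum.neutral) (simp add: v0)
      then have "v (k + 3) = 0" using e4 by simp
      moreover have "v (k + 5) = 0" using e6 calculation by simp
      moreover have "v (k + 4) = 0" using e7 calculation by simp
      ultimately have "v i = v (k + 2) * inf_vec i" for i
      proof -
        assume a: "v (k + 3) = 0" "v (k + 5) = 0" "v (k + 4) = 0"
        consider "i \<le> k + 1" | "i = k + 2" | "i = k + 3" | "i = k + 4" | "i = k + 5" | "k + 5 < i"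
          by linarith
        then show "v i = v (k + 2) * inf_vec i" using a high v0 by cases (auto simp: inf_vec_def)
      qed
      then have eq: "v = (\<lambda>i. v (k + 2) * inf_vec i)" by (rule ext)
      have "v (k + 2) \<noteq> 0"
      proof
        assume "v (k + 2) = 0"
        then have "v i = 0" for i using eq by (metis mult_zero_left)
        then show False using in_proj_spaceD(3)[OF Q v(1)] by blast
      qed
      then have "v \<in> point inf_vec" unfolding point_def using eq by blast
      then show ?thesis using v point_eq unfolding X_def Pinf_def by blast
    next
      case False
      define c where "c = v 0"
      define x y z where "x = v 1 / c" and "y = v (k + 3) / c" and "z = v (k + 5) / c"
      have c: "c \<noteq> 0" using False by (simp add: c_def)
      have pow: "v i = c * x ^ i" if "i \<le> k + 2" for i
        using that
      proof (induction i)
        case (Suc i)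
        have "v 1 = c * x" using c by (simp add: x_def)
        then have "c * v (i + 1) = c * (c * x ^ Suc i)"
          using e1[of i] Suc by (simp add: c_def[symmetric] mult_ac)
        then show ?case using c by simp
      qed (simp add: c_def)
      have "v (k + 4) = c * (x * y)"
        using e3 c by (simp add: x_def y_def c_def[symmetric] field_simps)
      moreover have "v (k + 3) = c * y" "v (k + 5) = c * z" using c by (simp_all add: y_def z_def)
      ultimately have "v i = c * emb (x, y, z) i" for i
      proof -
        assume a: "v (k + 4) = c * (x * y)" "v (k + 3) = c * y" "v (k + 5) = c * z"
        consider "i \<le> k + 2" | "i = k + 3" | "i = k + 4" | "i = k + 5" | "k + 5 < i" by linarith
        then show "v i = c * emb (x, y, z) i" using a high pow by cases auto
      qed
      then have eq: "v = (\<lambda>i. c * emb (x, y, z) i)" by (rule ext)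
      have A: "form_a v = c * poly a x"
        unfolding eq using form_fun_homogeneous[OF form_a] by (simp add: form_a_emb del: emb.simps)
      have B: "form_b 0 v = c * poly b x"
        unfolding eq using form_fun_homogeneous[OF form_b[of 0]] by (simp add: form_b_emb del: emb.simps)
      have "(x, y, z) \<in> curve"
        using e4 e5 e6 c unfolding A B \<open>v (k + 3) = c * y\<close> \<open>v (k + 5) = c * z\<close>
        by (simp add: curve_def power2_eq_square)
      moreover have "v \<in> point (emb (x, y, z))" unfolding point_def using eq c by blast
      ultimately show ?thesis using v point_eq unfolding X_def by blast
    qed
  qed
  moreover have "F (rep Q) = 0" if Q: "Q \<in> X" and F: "F \<in> S" for Q F
  proof -
    obtain d where d: "form_fun (k + 5) d F" using F by (auto simp: S_def)
    obtain v where v: "Q = point v" "F v = 0" using Q F by (auto simp: X_def Pinf_def S_def)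
    then show ?thesis using form_zero_point_iff[OF d, of v] X_subset Q by auto
  qed
  ultimately have "X = {Q \<in> proj_space (k + 5). \<forall>F\<in>S. F (rep Q) = 0}"
    using X_subset by blast
  moreover have "\<forall>F\<in>S. \<exists>d. form_fun (k + 5) d F" by (simp add: S_def)
  ultimately show ?thesis unfolding zariski_closed_iff by blast
qed

lemma rep_emb:
  obtains c where "c \<noteq> 0" "rep (point (emb w)) = (\<lambda>i. c * emb w i)"
  using rep_point[OF point_emb_in_proj_space] .

lemma rep_Pinf:
  obtains c where "c \<noteq> 0" "rep Pinf = (\<lambda>i. c * inf_vec i)"
  using rep_point[of inf_vec] Pinf_in_proj_space by (auto simp: Pinf_def)

lemma inj_emb: "inj (\<lambda>w. point (emb w))"
proof (rule injI)
  fix w w' assume eq: "point (emb w) = point (emb w')"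
  then have "emb w \<in> point (emb w')" using in_point_self by metis
  then obtain c where "emb w = (\<lambda>i. c * emb w' i)" by (auto simp: point_def)
  then have c: "emb w i = c * emb w' i" for i by (rule fun_cong)
  have "c = 1" using c[of 0] by (simp add: emb_0)
  then have "emb w i = emb w' i" for i using c by simp
  from this[of 1] this[of "k + 3"] this[of "k + 5"] show "w = w'" by (cases w; cases w') simp
qed

lemma Pinf_not_emb: "Pinf \<noteq> point (emb w)"
proof
  assume "Pinf = point (emb w)"
  then have "inf_vec \<in> point (emb w)" using in_point_self Pinf_def by metis
  then show False by (auto simp: point_def inf_vec_def fun_eq_iff emb_0 dest!: spec[of _ 0])
qed

lemma X_infinite: "infinite X"
  using infinite_curve finite_imageD[of "\<lambda>w. point (emb w)" curve] inj_on_subset[OF inj_emb]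
  by (auto simp: X_def)

text \<open>A form that is nonzero somewhere on \<open>X\<close> restricts to a nonzero triple,
  which has finitely many zeros.\<close>

lemma X_cofinite:
  assumes Z: "zariski_closed (k + 5) Z" and "\<not> X \<subseteq> Z"
  shows "finite (X \<inter> Z)"
proof -
  obtain S where S: "\<forall>F\<in>S. \<exists>d. form_fun (k + 5) d F" "Z = {Q \<in> proj_space (k + 5). \<forall>F\<in>S. F (rep Q) = 0}"
    using Z unfolding zariski_closed_iff by blast
  obtain Q F where Q: "Q \<in> X" and F: "F \<in> S" "F (rep Q) \<noteq> 0" using assms(2) X_subset S(2) by blast
  obtain d where d: "form_fun (k + 5) d F" using S(1) F(1) by blast
  obtain p q r where T: "\<And>w. w \<in> curve \<Longrightarrow> F (emb w) = ev (p, q, r) w" "poly.coeff p ((k + 2) * d) = F inf_vec"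
    using form_fun_on_curve[OF d] by blast
  have nz: "(p, q, r) \<noteq> (0, 0, 0)"
  proof
    assume "(p, q, r) = (0, 0, 0)"
    then have z: "F (emb w) = 0" if "w \<in> curve" for w using T(1)[OF that] by (cases w) simp
    have zi: "F inf_vec = 0" using T(2) \<open>(p, q, r) = (0, 0, 0)\<close> by simp
    obtain v where "Q = point v" "F v = 0" using Q z zi by (auto simp: X_def Pinf_def)
    then show False using form_zero_point_iff[OF d, of v] F(2) X_subset Q by auto
  qed
  have "X \<inter> Z \<subseteq> insert Pinf ((\<lambda>w. point (emb w)) ` {w \<in> curve. ev (p, q, r) w = 0})"
  proof
    fix R assume R: "R \<in> X \<inter> Z"
    show "R \<in> insert Pinf ((\<lambda>w. point (emb w)) ` {w \<in> curve. ev (p, q, r) w = 0})"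
    proof (cases "R = Pinf")
      case False
      then obtain w where w: "w \<in> curve" "R = point (emb w)" using R by (auto simp: X_def)
      have "F (rep R) = 0" using R S(2) F(1) by blast
      then have "F (emb w) = 0"
        using form_zero_point_iff[OF d point_emb_in_proj_space] w(2) by simp
      then show ?thesis using T(1)[OF w(1)] w by simp
    qed simp
  qed
  then show ?thesis using finite_zeros[OF nz] finite_subset by blast
qed

end

sublocale trigonal \<subseteq> cofinite_curve "k + 5" X
  using X_subset X_closed X_infinite X_cofinite by unfold_locales

section \<open>Local parameters and smoothness\<close>

context cofinite_curve
begin

lemma const_mod_self: "regular_at n X t Q \<Longrightarrow> t Q = 0 \<Longrightarrow> const_mod t Q t"
  using const_mod_multiple[of "\<lambda>_. 1" Q t] regular_at_const regular_atD by simp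

text \<open>In \<open>g^3 - g(Q)^3 = (g - g(Q)) * e\<close> the factor \<open>e\<close> has the
  value \<open>3 * g(Q)^2\<close> at \<open>Q\<close> and is a unit. So \<open>g - g(Q)\<close> is a
  multiple of \<open>p(f) - p(f(Q))\<close>, hence of \<open>f - f(Q)\<close>.\<close>

lemma const_mod_cube_root:
  assumes f: "regular_at n X f Q" and g: "regular_at n X g Q" "g Q \<noteq> 0" and three: "(3::'k) \<noteq> 0"
    and cube: "near n X Q (\<lambda>R. g R ^ 3 = poly p (f R))"
  shows "const_mod (\<lambda>R. f R - f Q) Q g"
proof -
  define h where "h = synthetic_div p (f Q)"
  define e where "e = (\<lambda>R. g R ^ 2 + g R * g Q + g Q ^ 2)"
  have Q: "Q \<in> X" using regular_atD[OF f] .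
  have h: "poly p s - poly p (f Q) = (s - f Q) * poly h s" for s
  proof -
    have "poly ([:- f Q, 1:] * h + [:poly p (f Q):]) s = poly p s"
      unfolding h_def by (simp only: synthetic_div_correct')
    then show ?thesis by (simp add: algebra_simps)
  qed
  have e: "regular_at n X e Q" unfolding e_def
    by (intro regular_at_add regular_at_mult regular_at_power regular_at_const Q g)
  have "e Q = 3 * g Q ^ 2" by (simp add: e_def power2_eq_square)
  then have eQ: "e Q \<noteq> 0" using g three by simp
  define u where "u = (\<lambda>R. poly h (f R) * inverse (e R))"
  have "regular_at n X u Q" unfolding u_def
    by (intro regular_at_mult regular_at_poly regular_at_inverse f e eQ)
  moreover have "near n X Q (\<lambda>R. g R = g Q + u R * (f R - f Q))"
  proof (rule near_mono[OF near_conj[OF cube regular_at_near_nonzero[OF e eQ]]], elim conjE)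
    fix R assume R: "g R ^ 3 = poly p (f R)" "e R \<noteq> 0"
    have "(g R - g Q) * e R = g R ^ 3 - g Q ^ 3"
      by (simp add: e_def power2_eq_square power3_eq_cube algebra_simps)
    also have "\<dots> = (f R - f Q) * poly h (f R)" using R(1) near_at[OF cube] h by simp
    finally show "g R = g Q + u R * (f R - f Q)" using R(2) by (simp add: u_def field_simps)
  qed
  ultimately show ?thesis unfolding const_mod_def using g by blast
qed

end

context trigonal
begin

lemma ratio_emb: "ratio i j (point (emb w)) = emb w i / emb w j"
  using rep_emb[of w] by (metis ratio_def mult_divide_mult_cancel_left)

lemma ratio_emb_0: "ratio i 0 (point (emb w)) = emb w i"
  by (simp add: ratio_emb emb_0)

lemma ratio_Pinf: "ratio i (k + 2) Pinf = inf_vec i"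
  using rep_Pinf by (metis ratio_def mult_divide_mult_cancel_left inf_vec_def div_by_1)

lemma point_emb_in_X: "w \<in> curve \<Longrightarrow> point (emb w) \<in> X"
  by (simp add: X_def)

lemma Pinf_in_X: "Pinf \<in> X"
  by (simp add: X_def)

lemma near_affine:
  assumes "w \<in> curve" and "\<And>w. w \<in> curve \<Longrightarrow> \<phi> (point (emb w))"
  shows "near (k + 5) X (point (emb w)) \<phi>"
proof -
  have "{R \<in> X. \<not> \<phi> R} \<subseteq> {Pinf}" using assms(2) by (auto simp: X_def)
  then show ?thesis unfolding near_iff using assms point_emb_in_X finite_subset by blast
qed

lemma near_infinity:
  assumes "\<phi> Pinf"
    and "\<And>x y z. (x, y, z) \<in> curve \<Longrightarrow> x \<noteq> 0 \<Longrightarrow> y \<noteq> 0 \<Longrightarrow> z \<noteq> 0 \<Longrightarrow> poly a x \<noteq> 0 \<Longrightarrow> poly b x \<noteq> 0 \<Longrightarrow>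
      \<phi> (point (emb (x, y, z)))"
  shows "near (k + 5) X Pinf \<phi>"
proof -
  \<comment> \<open>Its value is \<open>x * b(x) * y\<close>. Where this is nonzero, the equations
    of the curve make \<open>z\<close> and \<open>a(x)\<close> nonzero as well, so only finitely
    many points of the curve are discarded.\<close>
  let ?T = "(0, [:0, 1:] * b, 0)"
  have "{R \<in> X. \<not> \<phi> R} \<subseteq> (\<lambda>w. point (emb w)) ` {w \<in> curve. ev ?T w = 0}"
  proof
    fix R assume R: "R \<in> {R \<in> X. \<not> \<phi> R}"
    then obtain x y z where w: "(x, y, z) \<in> curve" "R = point (emb (x, y, z))"
      using assms(1) by (auto simp: X_def)
    have "ev ?T (x, y, z) = 0"
    proof (rule ccontr)
      assume "ev ?T (x, y, z) \<noteq> 0"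
      then have nz: "x \<noteq> 0" "poly b x \<noteq> 0" "y \<noteq> 0" by auto
      then have "z \<noteq> 0" using curveD(1)[OF w(1)] by auto
      moreover have "poly a x \<noteq> 0" using curveD(2)[OF w(1)] nz calculation by auto
      ultimately show False using assms(2)[OF w(1)] nz R w(2) by blast
    qed
    then show "R \<in> (\<lambda>w. point (emb w)) ` {w \<in> curve. ev ?T w = 0}" using w by blast
  qed
  moreover have "finite {w \<in> curve. ev ?T w = 0}" by (rule finite_zeros) (use b_nonzero in auto)
  ultimately show ?thesis unfolding near_iff using assms(1) Pinf_in_X
    by (meson finite_imageI finite_subset)
qed

lemma regular_affine_coord:
  assumes "w \<in> curve" "i \<le> k + 5"
  shows "regular_at (k + 5) X (ratio i 0) (point (emb w))"
proof (rule regular_at_ratio)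
  obtain c where "c \<noteq> 0" "rep (point (emb w)) = (\<lambda>i. c * emb w i)" by (rule rep_emb)
  then show "rep (point (emb w)) 0 \<noteq> 0" by (simp add: emb_0)
qed (use assms point_emb_in_X in auto)

lemma generate_affine:
  assumes w: "w \<in> curve" and t: "regular_at (k + 5) X t (point (emb w))" "t (point (emb w)) = 0"
    and x: "const_mod t (point (emb w)) (ratio 1 0)" and y: "const_mod t (point (emb w)) (ratio (k + 3) 0)"
    and z: "const_mod t (point (emb w)) (ratio (k + 5) 0)"
  shows "generate_maximal_ideal (k + 5) X (point (emb w)) 1 (\<lambda>_. t)"
proof (rule generate_maximal_idealI[where j = 0])
  obtain c where "c \<noteq> 0" "rep (point (emb w)) = (\<lambda>i. c * emb w i)" by (rule rep_emb)
  then show "rep (point (emb w)) 0 \<noteq> 0" by (simp add: emb_0)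
next
  fix i assume "i \<le> k + 5"
  then consider "i \<le> k + 2" | "i = k + 3" | "i = k + 4" | "i = k + 5" by linarith
  then show "const_mod t (point (emb w)) (ratio i 0)"
  proof cases
    case 1
    show ?thesis
    proof (rule const_mod_cong[OF const_mod_power[OF x, of i]], rule near_affine[OF w])
      fix w' show "ratio i 0 (point (emb w')) = ratio 1 0 (point (emb w')) ^ i"
        unfolding ratio_emb_0 using 1 by (cases w') simp
    qed
  next
    case 3
    show ?thesis
    proof (rule const_mod_cong[OF const_mod_mult[OF x y]], rule near_affine[OF w])
      fix w'
      show "ratio i 0 (point (emb w')) = ratio 1 0 (point (emb w')) * ratio (k + 3) 0 (point (emb w'))"
        unfolding ratio_emb_0 using 3 by (cases w') simp
    qed
  qed (use y z in simp_all)
qed (use point_emb_in_X[OF w] t in auto)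

text \<open>Where \<open>y\<close> and \<open>z\<close> are nonzero, the cube roots are unramified
  and \<open>x - x(Q)\<close> is a parameter. Over a simple root of \<open>a\<close>,
  \<open>y^3 = a * b^2\<close> is a unit times \<open>x - x(Q)\<close>, so \<open>y\<close> is a
  parameter, and \<open>z = y^2 / b\<close>. Over a simple root of \<open>b\<close>,
  \<open>y\<close> and \<open>z\<close> change roles.\<close>

lemma smooth_affine:
  assumes w: "(x\<^sub>0, y\<^sub>0, z\<^sub>0) \<in> curve"
  shows "\<exists>t. generate_maximal_ideal (k + 5) X (point (emb (x\<^sub>0, y\<^sub>0, z\<^sub>0))) 1 (\<lambda>_. t)"
proof -
  define Q where "Q = point (emb (x\<^sub>0, y\<^sub>0, z\<^sub>0))"
  define fx fy fz where "fx = ratio 1 0" and "fy = ratio (k + 3) 0" and "fz = ratio (k + 5) 0"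
  have reg: "regular_at (k + 5) X fx Q" "regular_at (k + 5) X fy Q" "regular_at (k + 5) X fz Q"
    unfolding fx_def fy_def fz_def Q_def by (rule regular_affine_coord[OF w], simp)+
  have val: "fx (point (emb (x, y, z))) = x" "fy (point (emb (x, y, z))) = y"
    "fz (point (emb (x, y, z))) = z" for x y z
    by (simp_all add: fx_def fy_def fz_def ratio_emb_0)
  note Qval = val[of x\<^sub>0 y\<^sub>0 z\<^sub>0, folded Q_def]
  have nearI: "near (k + 5) X Q \<phi>" if "\<And>x y z. (x, y, z) \<in> curve \<Longrightarrow> \<phi> (point (emb (x, y, z)))" for \<phi>
    unfolding Q_def by (rule near_affine[OF w]) (use that in auto)
  note QX = regular_atD[OF reg(1)]
  have gen: "\<exists>t. generate_maximal_ideal (k + 5) X Q 1 (\<lambda>_. t)"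
    if "regular_at (k + 5) X t Q" "t Q = 0" "const_mod t Q fx" "const_mod t Q fy" "const_mod t Q fz" for t
    using generate_affine[OF w, of t] that unfolding Q_def fx_def fy_def fz_def by blast
  have ya: "near (k + 5) X Q (\<lambda>R. fy R ^ 3 = poly (a * b ^ 2) (fx R))"
    by (rule nearI) (simp add: val curveD(4))
  have za: "near (k + 5) X Q (\<lambda>R. fz R ^ 3 = poly (a ^ 2 * b) (fx R))"
    by (rule nearI) (simp add: val curveD(5))
  consider "y\<^sub>0 \<noteq> 0 \<and> z\<^sub>0 \<noteq> 0" | "poly a x\<^sub>0 = 0" | "poly b x\<^sub>0 = 0"
    using curveD(2)[OF w] by fastforce
  then have "\<exists>t. generate_maximal_ideal (k + 5) X Q 1 (\<lambda>_. t)"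
  proof cases
    case 1
    let ?t = "\<lambda>R. fx R - fx Q"
    have t: "regular_at (k + 5) X ?t Q" by (intro regular_at_diff reg regular_at_const QX)
    show ?thesis
    proof (rule gen[of ?t])
      show "const_mod ?t Q fx" unfolding const_mod_def
        using reg regular_at_const[OF QX, of 1]
        by (intro conjI exI[of _ "\<lambda>_. 1"]) (auto intro: near_true QX)
      show "const_mod ?t Q fy" by (rule const_mod_cube_root[OF _ _ _ _ ya]) (use reg 1 Qval in auto)
      show "const_mod ?t Q fz" by (rule const_mod_cube_root[OF _ _ _ _ za]) (use reg 1 Qval in auto)
    qed (use t in auto)
  next
    case 2
    then have bx: "poly b x\<^sub>0 \<noteq> 0" using disjoint_roots by blast
    have y0: "y\<^sub>0 = 0" using curveD(4)[OF w] 2 by simp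
    have "[:- x\<^sub>0, 1:] dvd a" using 2 poly_eq_0_iff_dvd by metis
    then obtain c where c: "a = [:- x\<^sub>0, 1:] * c" by (rule dvdE)
    have cx: "poly c x\<^sub>0 \<noteq> 0" by (rule simple_a[OF c])
    have nb: "regular_at (k + 5) X (\<lambda>R. poly b (fx R)) Q" and
      nc: "regular_at (k + 5) X (\<lambda>R. poly (c * b ^ 2) (fx R)) Q"
      by (intro regular_at_poly reg)+
    have nb0: "poly b (fx Q) \<noteq> 0" and nc0: "poly (c * b ^ 2) (fx Q) \<noteq> 0" using bx cx Qval by auto
    show ?thesis
    proof (rule gen[of fy])
      show "const_mod fy Q fy" by (rule const_mod_self) (use reg Qval y0 in auto)
      show "const_mod fy Q fz"
      proof (rule const_mod_cong[OF const_mod_multiple])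
        show "regular_at (k + 5) X (\<lambda>R. fy R * inverse (poly b (fx R))) Q"
          by (intro regular_at_mult regular_at_inverse nb nb0 reg)
        have e: "near (k + 5) X Q (\<lambda>R. fy R ^ 2 = poly b (fx R) * fz R)"
          by (rule nearI) (simp add: val curveD(1))
        show "near (k + 5) X Q (\<lambda>R. fz R = fy R * inverse (poly b (fx R)) * fy R)"
          by (rule near_mono[OF near_conj[OF e regular_at_near_nonzero[OF nb nb0]]])
            (simp add: field_simps power2_eq_square)
      qed (use reg Qval y0 in auto)
      show "const_mod fy Q fx" unfolding const_mod_def
      proof (intro conjI exI)
        show "regular_at (k + 5) X (\<lambda>R. fy R ^ 2 * inverse (poly (c * b ^ 2) (fx R))) Q"
          by (intro regular_at_mult regular_at_power regular_at_inverse nc nc0 reg)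
        show "near (k + 5) X Q (\<lambda>R. fx R = fx Q + fy R ^ 2 * inverse (poly (c * b ^ 2) (fx R)) * fy R)"
        proof (rule near_mono[OF near_conj[OF ya regular_at_near_nonzero[OF nc nc0]]], elim conjE)
          fix R assume R: "fy R ^ 3 = poly (a * b ^ 2) (fx R)" "poly (c * b ^ 2) (fx R) \<noteq> 0"
          have "fy R ^ 2 * fy R = fy R ^ 3" by (simp add: power2_eq_square power3_eq_cube)
          also have "\<dots> = (fx R - x\<^sub>0) * poly (c * b ^ 2) (fx R)"
            unfolding R(1) by (subst c) (simp add: algebra_simps)
          finally have "fy R ^ 2 * inverse (poly (c * b ^ 2) (fx R)) * fy R = fx R - x\<^sub>0"
            using R(2) by (simp add: field_simps)
          then show "fx R = fx Q + fy R ^ 2 * inverse (poly (c * b ^ 2) (fx R)) * fy R"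
            using Qval by simp
        qed
      qed (use reg in auto)
    qed (use reg Qval y0 in auto)
  next
    case 3
    then have ax: "poly a x\<^sub>0 \<noteq> 0" using disjoint_roots by blast
    have z0: "z\<^sub>0 = 0" using curveD(5)[OF w] 3 by simp
    have "[:- x\<^sub>0, 1:] dvd b" using 3 poly_eq_0_iff_dvd by metis
    then obtain c where c: "b = [:- x\<^sub>0, 1:] * c" by (rule dvdE)
    have cx: "poly c x\<^sub>0 \<noteq> 0" by (rule simple_b[OF c])
    have na: "regular_at (k + 5) X (\<lambda>R. poly a (fx R)) Q" and
      nc: "regular_at (k + 5) X (\<lambda>R. poly (c * a ^ 2) (fx R)) Q"
      by (intro regular_at_poly reg)+
    have na0: "poly a (fx Q) \<noteq> 0" and nc0: "poly (c * a ^ 2) (fx Q) \<noteq> 0" using ax cx Qval by auto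
    show ?thesis
    proof (rule gen[of fz])
      show "const_mod fz Q fz" by (rule const_mod_self) (use reg Qval z0 in auto)
      show "const_mod fz Q fy"
      proof (rule const_mod_cong[OF const_mod_multiple])
        show "regular_at (k + 5) X (\<lambda>R. fz R * inverse (poly a (fx R))) Q"
          by (intro regular_at_mult regular_at_inverse na na0 reg)
        have e: "near (k + 5) X Q (\<lambda>R. fz R ^ 2 = poly a (fx R) * fy R)"
          by (rule nearI) (simp add: val curveD(3))
        show "near (k + 5) X Q (\<lambda>R. fy R = fz R * inverse (poly a (fx R)) * fz R)"
          by (rule near_mono[OF near_conj[OF e regular_at_near_nonzero[OF na na0]]])
            (simp add: field_simps power2_eq_square)
      qed (use reg Qval z0 in auto)
      show "const_mod fz Q fx" unfolding const_mod_def
      proof (intro conjI exI)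
        show "regular_at (k + 5) X (\<lambda>R. fz R ^ 2 * inverse (poly (c * a ^ 2) (fx R))) Q"
          by (intro regular_at_mult regular_at_power regular_at_inverse nc nc0 reg)
        show "near (k + 5) X Q (\<lambda>R. fx R = fx Q + fz R ^ 2 * inverse (poly (c * a ^ 2) (fx R)) * fz R)"
        proof (rule near_mono[OF near_conj[OF za regular_at_near_nonzero[OF nc nc0]]], elim conjE)
          fix R assume R: "fz R ^ 3 = poly (a ^ 2 * b) (fx R)" "poly (c * a ^ 2) (fx R) \<noteq> 0"
          have "fz R ^ 2 * fz R = fz R ^ 3" by (simp add: power2_eq_square power3_eq_cube)
          also have "\<dots> = (fx R - x\<^sub>0) * poly (c * a ^ 2) (fx R)"
            unfolding R(1) by (subst c) (simp add: algebra_simps)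
          finally have "fz R ^ 2 * inverse (poly (c * a ^ 2) (fx R)) * fz R = fx R - x\<^sub>0"
            using R(2) by (simp add: field_simps)
          then show "fx R = fx Q + fz R ^ 2 * inverse (poly (c * a ^ 2) (fx R)) * fz R"
            using Qval by simp
        qed
      qed (use reg in auto)
    qed (use reg Qval z0 in auto)
  qed
  then show ?thesis unfolding Q_def .
qed

text \<open>The function \<open>y / x ^ (k + 1)\<close>, a uniformizer at infinity.\<close>

definition \<tau> :: "'k ppoint \<Rightarrow> 'k" where
  "\<tau> = ratio (k + 4) (k + 2)"

text \<open>\<open>fa\<close> and \<open>fb\<close> extend \<open>a / x^(k+2)\<close> and
  \<open>b / x^k\<close> to infinity, where they are units because their values there are leading
  coefficients.\<close>

definition fa :: "'k ppoint \<Rightarrow> 'k" where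
  "fa R = form_a (\<lambda>i. ratio i (k + 2) R)"

definition fb :: "'k ppoint \<Rightarrow> 'k" where
  "fb R = form_b 2 (\<lambda>i. ratio i (k + 2) R)"

lemma tau_emb: "\<tau> (point (emb (x, y, z))) = x * y / x ^ (k + 2)"
  by (simp add: \<tau>_def ratio_emb)

lemma tau_Pinf: "\<tau> Pinf = 0"
  unfolding \<tau>_def ratio_Pinf by (simp add: inf_vec_def)

lemma ratio_emb_inverse:
  "(\<lambda>i. ratio i (k + 2) (point (emb (x, y, z)))) = (\<lambda>i. inverse (x ^ (k + 2)) * emb (x, y, z) i)"
  unfolding ratio_emb emb_coords(1)[OF order_refl] divide_inverse by (simp only: mult.commute)

lemma fa_emb: "fa (point (emb (x, y, z))) = poly a x / x ^ (k + 2)"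
  unfolding fa_def ratio_emb_inverse form_fun_homogeneous[OF form_a] form_a_emb
  by (simp add: divide_inverse mult.commute)

lemma fb_emb: "x \<noteq> 0 \<Longrightarrow> fb (point (emb (x, y, z))) = poly b x / x ^ k"
  unfolding fb_def ratio_emb_inverse form_fun_homogeneous[OF form_b[OF order_refl]]
    form_b_emb[OF order_refl]
  by (simp add: field_simps power2_eq_square)

lemma fa_Pinf: "fa Pinf \<noteq> 0"
  unfolding fa_def ratio_Pinf form_a_inf using leading_coeff_neq_0[of a] a_nonzero degree_a by simp

lemma fb_Pinf: "fb Pinf \<noteq> 0"
  unfolding fb_def ratio_Pinf form_b_inf using leading_coeff_neq_0[of b] b_nonzero degree_b by simp

lemma regular_ratio_Pinf: "i \<le> k + 5 \<Longrightarrow> regular_at (k + 5) X (ratio i (k + 2)) Pinf"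
proof (rule regular_at_ratio[OF _ _ Pinf_in_X])
  obtain c where "c \<noteq> 0" "rep Pinf = (\<lambda>i. c * inf_vec i)" by (rule rep_Pinf)
  then show "rep Pinf (k + 2) \<noteq> 0" by (simp add: inf_vec_def)
qed auto

lemma regular_tau: "regular_at (k + 5) X \<tau> Pinf"
  unfolding \<tau>_def by (rule regular_ratio_Pinf) simp

lemma regular_fa: "regular_at (k + 5) X fa Pinf"
  unfolding fa_def form_a_def
  by (intro regular_at_sum regular_at_mult regular_at_const regular_ratio_Pinf Pinf_in_X) auto

lemma regular_fb: "regular_at (k + 5) X fb Pinf"
  unfolding fb_def form_b_def
  by (intro regular_at_sum regular_at_mult regular_at_const regular_ratio_Pinf Pinf_in_X) auto

text \<open>The equations give \<open>1 / x = \<tau>^3 / (fa * fb^2)\<close> and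
  \<open>z / x^(k+2) = \<tau>^2 / fb\<close>. The other coordinate ratios are powers of
  \<open>1 / x\<close>, \<open>\<tau>\<close> itself and \<open>\<tau> / x\<close>.\<close>

lemma generate_infinity: "generate_maximal_ideal (k + 5) X Pinf 1 (\<lambda>_. \<tau>)"
proof (rule generate_maximal_idealI[where j = "k + 2"])
  obtain c where "c \<noteq> 0" "rep Pinf = (\<lambda>i. c * inf_vec i)" by (rule rep_Pinf)
  then show "rep Pinf (k + 2) \<noteq> 0" by (simp add: inf_vec_def)
next
  have w: "const_mod \<tau> Pinf (ratio (k + 1) (k + 2))"
  proof (rule const_mod_cong[OF const_mod_multiple[OF _ regular_tau tau_Pinf]])
    show "regular_at (k + 5) X (\<lambda>R. \<tau> R ^ 2 * (inverse (fa R) * inverse (fb R) ^ 2)) Pinf"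
      by (intro regular_at_mult regular_at_power regular_at_inverse regular_tau regular_fa regular_fb
          fa_Pinf fb_Pinf)
    show "near (k + 5) X Pinf
       (\<lambda>R. ratio (k + 1) (k + 2) R = \<tau> R ^ 2 * (inverse (fa R) * inverse (fb R) ^ 2) * \<tau> R)"
    proof (rule near_infinity)
      fix x y z assume c: "(x, y, z) \<in> curve" "x \<noteq> 0" "y \<noteq> 0" "poly a x \<noteq> 0" "poly b x \<noteq> 0"
      let ?R = "point (emb (x, y, z))"
      have "\<tau> ?R ^ 2 * (inverse (fa ?R) * inverse (fb ?R) ^ 2) * \<tau> ?R =
         (x * y / x ^ (k + 2)) ^ 3 / (poly a x / x ^ (k + 2) * (poly b x / x ^ k) ^ 2)"
        unfolding tau_emb fa_emb fb_emb[OF c(2)]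
        by (simp add: power2_eq_square power3_eq_cube divide_inverse mult_ac)
      also have "(x * y / x ^ (k + 2)) ^ 3 = x ^ 3 * (poly a x * poly b x ^ 2) / (x ^ (k + 2)) ^ 3"
        unfolding curveD(4)[OF c(1), symmetric] by (simp only: power_mult_distrib power_divide)
      also have "x ^ 3 * (poly a x * poly b x ^ 2) / (x ^ (k + 2)) ^ 3 /
          (poly a x / x ^ (k + 2) * (poly b x / x ^ k) ^ 2) = x ^ (k + 1) / x ^ (k + 2)"
        using c by (simp add: field_simps power2_eq_square power3_eq_cube)
      also have "\<dots> = ratio (k + 1) (k + 2) ?R" unfolding ratio_emb by simp
      finally show "ratio (k + 1) (k + 2) ?R =
        \<tau> ?R ^ 2 * (inverse (fa ?R) * inverse (fb ?R) ^ 2) * \<tau> ?R" ..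
    next
      show "ratio (k + 1) (k + 2) Pinf =
          \<tau> Pinf ^ 2 * (inverse (fa Pinf) * inverse (fb Pinf) ^ 2) * \<tau> Pinf"
        unfolding ratio_Pinf by (simp add: inf_vec_def tau_Pinf)
    qed
  qed
  have y: "const_mod \<tau> Pinf (ratio (k + 4) (k + 2))"
    using const_mod_self[OF regular_tau tau_Pinf] by (simp add: \<tau>_def)
  fix i assume "i \<le> k + 5"
  then consider "i \<le> k + 2" | "i = k + 3" | "i = k + 4" | "i = k + 5" by linarith
  then show "const_mod \<tau> Pinf (ratio i (k + 2))"
  proof cases
    case 1
    show ?thesis
    proof (rule const_mod_cong[OF const_mod_power[OF w, of "k + 2 - i"]], rule near_infinity)
      fix x y z assume c: "(x, y, z) \<in> curve" "x \<noteq> 0"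
      have "x ^ (k + 2) = x ^ i * x ^ (k + 2 - i)" using 1 by (simp flip: power_add)
      moreover have "ratio (k + 1) (k + 2) (point (emb (x, y, z))) = inverse x"
        unfolding ratio_emb using c by (simp add: field_simps)
      ultimately show "ratio i (k + 2) (point (emb (x, y, z))) =
          ratio (k + 1) (k + 2) (point (emb (x, y, z))) ^ (k + 2 - i)"
        unfolding ratio_emb emb_coords(1)[OF 1] emb_coords(1)[OF order_refl]
        using c by (simp add: divide_inverse power_inverse)
    next
      show "ratio i (k + 2) Pinf = ratio (k + 1) (k + 2) Pinf ^ (k + 2 - i)"
        unfolding ratio_Pinf using 1 by (auto simp: inf_vec_def power_0_left)
    qed
  next
    case 2
    show ?thesis
    proof (rule const_mod_cong[OF const_mod_mult[OF w y]], rule near_infinity)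
      show "ratio i (k + 2) Pinf = ratio (k + 1) (k + 2) Pinf * ratio (k + 4) (k + 2) Pinf"
        unfolding ratio_Pinf using 2 by (simp add: inf_vec_def)
    qed (use 2 in \<open>simp add: ratio_emb field_simps\<close>)
  next
    case 4
    show ?thesis
    proof (rule const_mod_cong[OF const_mod_multiple[OF _ regular_tau tau_Pinf]])
      show "regular_at (k + 5) X (\<lambda>R. \<tau> R * inverse (fb R)) Pinf"
        by (intro regular_at_mult regular_at_inverse regular_tau regular_fb fb_Pinf)
      show "near (k + 5) X Pinf (\<lambda>R. ratio i (k + 2) R = \<tau> R * inverse (fb R) * \<tau> R)"
      proof (rule near_infinity)
        fix x y z assume c: "(x, y, z) \<in> curve" "x \<noteq> 0" "poly b x \<noteq> 0"
        show "ratio i (k + 2) (point (emb (x, y, z))) =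
          \<tau> (point (emb (x, y, z))) * inverse (fb (point (emb (x, y, z)))) * \<tau> (point (emb (x, y, z)))"
          unfolding tau_emb fb_emb[OF c(2)] ratio_emb using 4 c curveD(1)[OF c(1)]
          by (simp add: field_simps power2_eq_square)
      next
        show "ratio i (k + 2) Pinf = \<tau> Pinf * inverse (fb Pinf) * \<tau> Pinf"
          unfolding ratio_Pinf using 4 by (simp add: inf_vec_def tau_Pinf)
      qed
    qed
  qed (use y in simp)
qed (use Pinf_in_X regular_tau tau_Pinf in auto)

lemma smooth_curve: "smooth_projective_curve (k + 5) X"
  unfolding smooth_projective_variety_def
proof (intro conjI ballI)
  fix Q assume "Q \<in> X"
  then consider "Q = Pinf" | x y z where "(x, y, z) \<in> curve" "Q = point (emb (x, y, z))"
    by (auto simp: X_def)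
  then show "\<exists>t. generate_maximal_ideal (k + 5) X Q 1 t"
    using generate_infinity smooth_affine by cases blast+
qed (use irreducible dim_eq_1 in auto)

end

section \<open>Triples as functions, and regular functions as fractions of triples\<close>

context trigonal
begin

text \<open>The value 0 at infinity and off the curve follows the convention of \<open>H0\<close>,
  so members of \<open>H0\<close> can be equal to such functions literally.\<close>

definition fn :: "'k triple \<Rightarrow> 'k ppoint \<Rightarrow> 'k" where
  "fn T R = (if R \<in> X - {Pinf} then ev T (ratio 1 0 R, ratio (k + 3) 0 R, ratio (k + 5) 0 R) else 0)"

lemma fn_emb: "w \<in> curve \<Longrightarrow> fn T (point (emb w)) = ev T w"
  using point_emb_in_X[of w] Pinf_not_emb[of w] unfolding fn_def ratio_emb_0 by (cases w) auto

lemma fn_outside: "R \<notin> X - {Pinf} \<Longrightarrow> fn T R = 0"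
  unfolding fn_def by (rule if_not_P)

lemma fn_eqI:
  assumes "\<And>R. R \<notin> X - {Pinf} \<Longrightarrow> f R = 0" and "\<And>w. w \<in> curve \<Longrightarrow> f (point (emb w)) = ev T w"
  shows "f = fn T"
proof
  fix R
  show "f R = fn T R"
  proof (cases "R \<in> X - {Pinf}")
    case True
    then obtain w where "w \<in> curve" "R = point (emb w)" by (auto simp: X_def)
    then show ?thesis using assms(2) fn_emb by simp
  qed (use assms(1) fn_outside in simp)
qed

lemma regular_fn:
  assumes "w \<in> curve"
  shows "regular_at (k + 5) X (fn T) (point (emb w))"
proof -
  obtain p q r where T: "T = (p, q, r)" by (cases T)
  let ?f = "\<lambda>R. poly p (ratio 1 0 R) + poly q (ratio 1 0 R) * ratio (k + 3) 0 R +
    poly r (ratio 1 0 R) * ratio (k + 5) 0 R"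
  have "regular_at (k + 5) X ?f (point (emb w))"
    by (intro regular_at_add regular_at_mult regular_at_poly regular_affine_coord assms) auto
  moreover have "near (k + 5) X (point (emb w)) (\<lambda>R. fn T R = ?f R)"
  proof (rule near_affine[OF assms])
    fix w' assume "w' \<in> curve"
    then show "fn T (point (emb w')) = ?f (point (emb w'))"
      unfolding fn_emb[OF \<open>w' \<in> curve\<close>] ratio_emb_0 T by (cases w') simp
  qed
  ultimately show ?thesis by (rule regular_at_cong)
qed

lemma finite_curve_exceptions:
  assumes "near (k + 5) X Q \<phi>"
  shows "finite {w \<in> curve. \<not> \<phi> (point (emb w))}"
proof -
  have "(\<lambda>w. point (emb w)) ` {w \<in> curve. \<not> \<phi> (point (emb w))} \<subseteq> {R \<in> X. \<not> \<phi> R}"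
    using point_emb_in_X by auto
  then have "finite ((\<lambda>w. point (emb w)) ` {w \<in> curve. \<not> \<phi> (point (emb w))})"
    using assms finite_subset unfolding near_iff by blast
  then show ?thesis by (rule finite_imageD) (rule inj_on_subset[OF inj_emb], simp)
qed

lemma wt_le_iff:
  "wt (p, q, r) \<le> m \<longleftrightarrow> 3 * degree p \<le> m \<and> (q = 0 \<or> 3 * degree q + 3 * k + 2 \<le> m) \<and>
     (r = 0 \<or> 3 * degree r + 3 * k + 4 \<le> m)"
  by auto

text \<open>The forms of a local quotient restrict to triples. At infinity the denominator, of
  degree \<open>d\<close> as a form, does not vanish; its triple thus has weight at least
  \<open>3 * (k + 2) * d\<close>, which bounds the weight of the numerator.\<close>

lemma local_fraction:
  assumes "regular_at (k + 5) X f Q"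
  obtains A B where "finite {w \<in> curve. f (point (emb w)) * ev B w \<noteq> ev A w}"
    and "\<And>w. w \<in> curve \<Longrightarrow> Q = point (emb w) \<Longrightarrow> ev B w \<noteq> 0 \<and> f Q * ev B w = ev A w"
    and "Q = Pinf \<Longrightarrow> B \<noteq> (0, 0, 0) \<and> wt A \<le> wt B"
proof -
  obtain d F G where FG: "form_fun (k + 5) d F" "form_fun (k + 5) d G"
    and near: "near (k + 5) X Q (\<lambda>R. G (rep R) \<noteq> 0 \<and> f R = F (rep R) / G (rep R))"
    using assms unfolding regular_at_iff by blast
  obtain p q r where A: "\<And>w. w \<in> curve \<Longrightarrow> F (emb w) = ev (p, q, r) w"
     "\<And>i. poly.coeff p i \<noteq> 0 \<Longrightarrow> i \<le> (k + 2) * d"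
     "\<And>i. poly.coeff q i \<noteq> 0 \<Longrightarrow> i + k + 1 \<le> (k + 2) * d"
     "\<And>i. poly.coeff r i \<noteq> 0 \<Longrightarrow> i + k + 2 \<le> (k + 2) * d"
    using form_fun_on_curve[OF FG(1)] by blast
  obtain p' q' r' where B: "\<And>w. w \<in> curve \<Longrightarrow> G (emb w) = ev (p', q', r') w"
     "poly.coeff p' ((k + 2) * d) = G inf_vec"
    using form_fun_on_curve[OF FG(2)] by blast
  have frac: "ev (p', q', r') w \<noteq> 0 \<and> f (point (emb w)) * ev (p', q', r') w = ev (p, q, r) w"
    if w: "w \<in> curve" and R: "G (rep (point (emb w))) \<noteq> 0 \<and>
      f (point (emb w)) = F (rep (point (emb w))) / G (rep (point (emb w)))" for w
  proof -
    have rep: "rep (point (emb w)) \<in> point (emb w)" using rep_in[OF point_emb_in_proj_space] .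
    show ?thesis
      using R form_fun_zero_iff[OF FG(2) rep] form_fun_quotient_eq[OF FG rep]
      unfolding A(1)[OF w] B(1)[OF w] by simp
  qed
  show thesis
  proof (rule that[of "(p', q', r')" "(p, q, r)"])
    show "finite {w \<in> curve. f (point (emb w)) * ev (p', q', r') w \<noteq> ev (p, q, r) w}"
      by (rule rev_finite_subset[OF finite_curve_exceptions[OF near]]) (use frac in blast)
  next
    fix w assume "w \<in> curve" "Q = point (emb w)"
    then show "ev (p', q', r') w \<noteq> 0 \<and> f Q * ev (p', q', r') w = ev (p, q, r) w"
      using frac near_at[OF near] by blast
  next
    assume Q: "Q = Pinf"
    have "rep Pinf \<in> point inf_vec" using rep_in[OF Pinf_in_proj_space] unfolding Pinf_def .
    then have "G inf_vec \<noteq> 0" using near_at[OF near] form_fun_zero_iff[OF FG(2)] Q by blast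
    then have nz: "poly.coeff p' ((k + 2) * d) \<noteq> 0" using B(2) by simp
    then have "p' \<noteq> 0" by auto
    have "3 * ((k + 2) * d) \<le> wt (p', q', r')" using le_degree[OF nz] by simp
    moreover have "wt (p, q, r) \<le> 3 * ((k + 2) * d)"
    proof -
      have "degree p \<le> (k + 2) * d" by (cases "p = 0", simp, rule A(2), simp)
      moreover have "q = 0 \<or> degree q + k + 1 \<le> (k + 2) * d" using A(3)[of "degree q"] by auto
      moreover have "r = 0 \<or> degree r + k + 2 \<le> (k + 2) * d" using A(4)[of "degree r"] by auto
      ultimately show ?thesis unfolding wt_le_iff by linarith
    qed
    ultimately show "(p', q', r') \<noteq> (0, 0, 0) \<and> wt (p, q, r) \<le> wt (p', q', r')"
      using \<open>p' \<noteq> 0\<close> by auto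
  qed
qed


section \<open>Functions regular away from infinity\<close>

lemma primitive_cube_root: obtains \<omega> :: 'k where "1 + \<omega> + \<omega> ^ 2 = 0" "\<omega> ^ 3 = 1"
proof -
  obtain \<omega> :: 'k where "poly [:1, 1, 1:] \<omega> = 0"
    using alg_closed_imp_poly_has_root[of "[:1, 1, 1::'k:]"] by auto
  then have *: "1 + \<omega> + \<omega> ^ 2 = 0" by (simp add: algebra_simps power2_eq_square)
  have "\<omega> ^ 3 - 1 = (\<omega> - 1) * (1 + \<omega> + \<omega> ^ 2)"
    by (simp add: algebra_simps power2_eq_square power3_eq_cube)
  then have "\<omega> ^ 3 = 1" using * by simp
  with * show thesis by (rule that)
qed

text \<open>Away from the roots of \<open>a * b\<close> the cube roots of unity move a point through
  three points of the fibre, and vanishing at all three kills each component. Over a root of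
  \<open>a * b\<close> there is just the point with \<open>y = z = 0\<close>, whose value sees only
  \<open>p\<close>; there the components of the identity of triples are compared instead.\<close>

lemma vanish_on_fibre:
  assumes g: "poly g x\<^sub>0 = 0"
    and frac: "\<And>w. w \<in> curve \<Longrightarrow> \<exists>A B. ev B w \<noteq> 0 \<and> mul (g, 0, 0) A = mul (p, q, r) B"
  shows "poly p x\<^sub>0 = 0 \<and> poly q x\<^sub>0 = 0 \<and> poly r x\<^sub>0 = 0"
proof (cases "poly a x\<^sub>0 * poly b x\<^sub>0 = 0")
  case True
  have "(x\<^sub>0, 0, 0) \<in> curve" using True by (simp add: curve_def)
  then obtain A B where AB: "ev B (x\<^sub>0, 0, 0) \<noteq> 0" "mul (g, 0, 0) A = mul (p, q, r) B"
    using frac by blast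
  obtain p\<^sub>1 q\<^sub>1 r\<^sub>1 where A: "A = (p\<^sub>1, q\<^sub>1, r\<^sub>1)" by (cases A)
  obtain p' q' r' where B: "B = (p', q', r')" by (cases B)
  have p': "poly p' x\<^sub>0 \<noteq> 0" using AB(1) by (simp add: B)
  have "g * p\<^sub>1 = p * p' + a * b * (q * r' + r * q')" "g * q\<^sub>1 = p * q' + q * p' + a * r * r'"
    "g * r\<^sub>1 = p * r' + r * p' + b * q * q'"
    using AB(2) by (simp_all add: A B)
  then have e: "poly (g * p\<^sub>1) x\<^sub>0 = poly (p * p' + a * b * (q * r' + r * q')) x\<^sub>0"
     "poly (g * q\<^sub>1) x\<^sub>0 = poly (p * q' + q * p' + a * r * r') x\<^sub>0"
     "poly (g * r\<^sub>1) x\<^sub>0 = poly (p * r' + r * p' + b * q * q') x\<^sub>0" by metis+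
  have p0: "poly p x\<^sub>0 = 0" using e(1) g True p' by auto
  show ?thesis
  \<comment> \<open>A root of \<open>a\<close> removes \<open>r\<close> from the second component,
    which gives \<open>q\<close> and then \<open>r\<close> from the third; for a root of
    \<open>b\<close> the order is reversed.\<close>
  proof (cases "poly a x\<^sub>0 = 0")
    case True
    then have "poly q x\<^sub>0 = 0" using e(2) g p0 p' by simp
    then show ?thesis using e(3) g p0 p' by simp
  next
    case False
    then have "poly b x\<^sub>0 = 0" using \<open>poly a x\<^sub>0 * poly b x\<^sub>0 = 0\<close> by simp
    then have "poly r x\<^sub>0 = 0" using e(3) g p0 p' by simp
    then show ?thesis using e(2) g p0 p' by simp
  qed
next
  case False
  have zero: "ev (p, q, r) w = 0" if w: "w \<in> curve" "fst w = x\<^sub>0" for w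
  proof -
    obtain A B where AB: "ev B w \<noteq> 0" "mul (g, 0, 0) A = mul (p, q, r) B"
      using frac[OF w(1)] by blast
    have "ev (g, 0, 0) w = 0" using g w(2) by (cases w) simp
    then have "ev (p, q, r) w * ev B w = 0"
      using ev_mul[OF w(1), of "(g, 0, 0)" A] ev_mul[OF w(1), of "(p, q, r)" B] AB(2) by simp
    then show ?thesis using AB(1) by simp
  qed
  obtain y z where w: "(x\<^sub>0, y, z) \<in> curve" using curve_over by blast
  have yz: "y \<noteq> 0" "z \<noteq> 0" using curveD(2)[OF w] False by auto
  obtain \<omega> :: 'k where om: "1 + \<omega> + \<omega> ^ 2 = 0" "\<omega> ^ 3 = 1" by (rule primitive_cube_root)
  have om4: "\<omega> ^ 4 = \<omega>" using om(2) by (simp add: power4_eq_xxxx power3_eq_cube mult.assoc)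
  have w1: "(x\<^sub>0, \<omega> * y, \<omega> ^ 2 * z) \<in> curve"
    using curveD(1-3)[OF w] om(2) om4
    by (simp add: curve_def power_mult_distrib mult_ac flip: power_mult)
      (simp add: power2_eq_square power3_eq_cube mult_ac)
  have w2: "(x\<^sub>0, \<omega> ^ 2 * y, \<omega> * z) \<in> curve"
    using curveD(1-3)[OF w] om(2) om4
    by (simp add: curve_def power_mult_distrib mult_ac flip: power_mult)
      (simp add: power2_eq_square power3_eq_cube mult_ac)
  define P Q R where "P = poly p x\<^sub>0" and "Q = poly q x\<^sub>0 * y" and "R = poly r x\<^sub>0 * z"
  have e: "P + Q + R = 0" "P + \<omega> * Q + \<omega> ^ 2 * R = 0" "P + \<omega> ^ 2 * Q + \<omega> * R = 0"
    using zero[OF w] zero[OF w1] zero[OF w2] by (simp_all add: P_def Q_def R_def mult_ac)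
  \<comment> \<open>Fourier inversion over the cube roots of unity, with correction terms that
    vanish by the relations for \<open>\<omega>\<close>.\<close>
  have "3 * P = (P + Q + R) + (P + \<omega> * Q + \<omega> ^ 2 * R) + (P + \<omega> ^ 2 * Q + \<omega> * R) - (1 + \<omega> + \<omega> ^ 2) * (Q + R)"
    by (simp add: algebra_simps)
  then have "P = 0" using e om by simp
  moreover have "3 * Q = (P + Q + R) + \<omega> ^ 2 * (P + \<omega> * Q + \<omega> ^ 2 * R) + \<omega> * (P + \<omega> ^ 2 * Q + \<omega> * R)
      - (1 + \<omega> + \<omega> ^ 2) * (P + R) - (\<omega> ^ 4 - \<omega>) * R - 2 * (\<omega> ^ 3 - 1) * Q"
    by (simp add: algebra_simps power2_eq_square power3_eq_cube power4_eq_xxxx)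
  then have "Q = 0" using e om om4 by simp
  ultimately have "R = 0" using e(1) by simp
  then show ?thesis using \<open>P = 0\<close> \<open>Q = 0\<close> yz by (simp add: P_def Q_def R_def)
qed

text \<open>The denominator \<open>g\<close> can be divided by any of its linear factors: where it vanishes, so does \<open>G\<close>.\<close>

lemma clear_denominator:
  assumes "g \<noteq> 0"
    and "\<And>w. w \<in> curve \<Longrightarrow> \<exists>A B. ev B w \<noteq> 0 \<and> f w * ev B w = ev A w \<and> mul (g, 0, 0) A = mul G B"
  shows "\<exists>T. \<forall>w\<in>curve. f w = ev T w"
  using assms
proof (induction "degree g" arbitrary: g G)
  case 0
  then obtain c where c: "g = [:c:]" "c \<noteq> 0" using degree_eq_zeroE by (metis pCons_0_0)
  have "f w = ev (mul ([:inverse c:], 0, 0) G) w" if w: "w \<in> curve" for w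
  proof -
    obtain A B where AB: "ev B w \<noteq> 0" "f w * ev B w = ev A w" "mul (g, 0, 0) A = mul G B"
      using 0(3)[OF w] by blast
    have sc: "ev ([:s:], 0, 0) w = s" for s by (cases w) simp
    have "c * ev A w = ev G w * ev B w"
      using ev_mul[OF w, of "(g, 0, 0)" A] ev_mul[OF w, of G B] AB(3) by (simp add: c sc)
    then have "c * f w * ev B w = ev G w * ev B w" using AB(2) by (simp add: mult.assoc)
    then have "c * f w = ev G w" using AB(1) by simp
    then have "f w = inverse c * ev G w" using c(2) by (simp add: field_simps)
    then show ?thesis unfolding ev_mul[OF w] sc .
  qed
  then show ?case by blast
next
  case (Suc d)
  obtain x\<^sub>0 where x0: "poly g x\<^sub>0 = 0" using alg_closed_imp_poly_has_root[of g] Suc(2) by auto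
  obtain p q r where G: "G = (p, q, r)" by (cases G)
  have "poly p x\<^sub>0 = 0 \<and> poly q x\<^sub>0 = 0 \<and> poly r x\<^sub>0 = 0"
  proof (rule vanish_on_fibre[OF x0])
    fix w assume "w \<in> curve"
    from Suc(4)[OF this] show "\<exists>A B. ev B w \<noteq> 0 \<and> mul (g, 0, 0) A = mul (p, q, r) B"
      unfolding G by blast
  qed
  then obtain p' q' r' where G': "p = [:- x\<^sub>0, 1:] * p'" "q = [:- x\<^sub>0, 1:] * q'" "r = [:- x\<^sub>0, 1:] * r'"
    by (metis poly_eq_0_iff_dvd dvdE)
  obtain g' where g': "g = [:- x\<^sub>0, 1:] * g'" using x0 by (metis poly_eq_0_iff_dvd dvdE)
  then have "g' \<noteq> 0" using Suc(3) by auto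
  then have "degree g = Suc (degree g')" unfolding g' by (subst degree_mult_eq) auto
  then have "d = degree g'" using Suc(2) by simp
  then show ?case
  proof (rule Suc(1)[OF _ \<open>g' \<noteq> 0\<close>, of "(p', q', r')"])
    fix w assume "w \<in> curve"
    then obtain A B where AB: "ev B w \<noteq> 0" "f w * ev B w = ev A w" "mul (g, 0, 0) A = mul G B"
      using Suc(4) by blast
    have l: "mul (h * u, 0, 0) S = mul (h, 0, 0) (mul (u, 0, 0) S)" for h u S
      by (cases S) (simp add: mult.assoc)
    have "mul G B = mul ([:- x\<^sub>0, 1:], 0, 0) (mul (p', q', r') B)"
      unfolding G G' mul_assoc[symmetric] by simp
    then have e: "mul ([:- x\<^sub>0, 1:], 0, 0) (mul (g', 0, 0) A) = mul ([:- x\<^sub>0, 1:], 0, 0) (mul (p', q', r') B)"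
      using AB(3) unfolding g' l by simp
    have cancel: "S = T" if "mul (h, 0, 0) S = mul (h, 0, 0) T" "h \<noteq> 0" for h S T
      using that by (cases S; cases T) simp
    have "mul (g', 0, 0) A = mul (p', q', r') B" by (rule cancel[OF e]) simp
    then show "\<exists>A B. ev B w \<noteq> 0 \<and> f w * ev B w = ev A w \<and> mul (g', 0, 0) A = mul (p', q', r') B"
      using AB by blast
  qed
qed

text \<open>Multiplied by the conjugate of its denominator, one local fraction
  \<open>A\<^sub>0 / B\<^sub>0\<close> acquires the denominator \<open>norm3 B\<^sub>0\<close>, a
  polynomial in \<open>x\<close>. Every other local fraction agrees with it off a finite set, hence
  as an identity of triples, which is what clearing the denominator requires.\<close>

lemma regular_on_affine:
  assumes reg: "\<And>w. w \<in> curve \<Longrightarrow> regular_at (k + 5) X f (point (emb w))"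
  shows "\<exists>T. \<forall>w\<in>curve. f (point (emb w)) = ev T w"
proof -
  define h where "h = (\<lambda>w. f (point (emb w)))"
  have loc: "\<exists>A B. ev B w \<noteq> 0 \<and> h w * ev B w = ev A w \<and> finite {w \<in> curve. h w * ev B w \<noteq> ev A w}"
    if w: "w \<in> curve" for w
  proof (rule local_fraction[OF reg[OF w]])
    fix A B
    assume "finite {w \<in> curve. f (point (emb w)) * ev B w \<noteq> ev A w}"
      and "\<And>u. u \<in> curve \<Longrightarrow> point (emb w) = point (emb u) \<Longrightarrow>
        ev B u \<noteq> 0 \<and> f (point (emb w)) * ev B u = ev A u"
    then show ?thesis using w unfolding h_def by blast
  qed
  obtain v where v: "v \<in> curve" using curve_over by blast
  obtain A\<^sub>0 B\<^sub>0 where 0: "ev B\<^sub>0 v \<noteq> 0" "finite {w \<in> curve. h w * ev B\<^sub>0 w \<noteq> ev A\<^sub>0 w}"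
    using loc[OF v] by blast
  have "B\<^sub>0 \<noteq> (0, 0, 0)" using 0(1) by (cases v) auto
  then have "norm3 B\<^sub>0 \<noteq> 0" by (rule norm3_wt)
  moreover have "\<exists>A B. ev B w \<noteq> 0 \<and> h w * ev B w = ev A w \<and>
      mul (norm3 B\<^sub>0, 0, 0) A = mul (mul A\<^sub>0 (adj B\<^sub>0)) B" if w: "w \<in> curve" for w
  proof -
    obtain A B where AB: "ev B w \<noteq> 0" "h w * ev B w = ev A w" "finite {w \<in> curve. h w * ev B w \<noteq> ev A w}"
      using loc[OF w] by blast
    have eq: "mul B\<^sub>0 A = mul A\<^sub>0 B"
    proof (rule ev_eq_cofinite, rule finite_subset[OF _ finite_UnI[OF 0(2) AB(3)]], rule subsetI, rule ccontr)
      fix u assume u: "u \<in> {w \<in> curve. ev (mul B\<^sub>0 A) w \<noteq> ev (mul A\<^sub>0 B) w}"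
        "u \<notin> {w \<in> curve. h w * ev B\<^sub>0 w \<noteq> ev A\<^sub>0 w} \<union> {w \<in> curve. h w * ev B w \<noteq> ev A w}"
      then have "u \<in> curve" "ev A\<^sub>0 u = h u * ev B\<^sub>0 u" "ev A u = h u * ev B u" by auto
      then show False using u(1) by (simp add: ev_mul mult_ac)
    qed
    have "mul (norm3 B\<^sub>0, 0, 0) A = mul (adj B\<^sub>0) (mul B\<^sub>0 A)"
      unfolding mul_adj[symmetric] by (metis mul_assoc mul_commute)
    also have "\<dots> = mul (mul A\<^sub>0 (adj B\<^sub>0)) B"
      unfolding eq by (metis mul_assoc mul_commute)
    finally show ?thesis using AB by blast
  qed
  ultimately show ?thesis using clear_denominator[of "norm3 B\<^sub>0" h] unfolding h_def by blast
qed

end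

section \<open>Pole orders and dimensions\<close>

context vector_space
begin

text \<open>The finite spanning set matters because \<open>dim\<close> is 0 on spaces of infinite
  dimension. A basis of \<open>U\<close> together with \<open>v\<close> stays independent and
  extends to a basis of \<open>V\<close>.\<close>

lemma dim_less_dim:
  assumes U: "subspace U" "U \<subseteq> V" and v: "v \<in> V" "v \<notin> U" and V: "V \<subseteq> span S" "finite S"
  shows "dim U < dim V"
proof -
  obtain B where B: "B \<subseteq> U" "independent B" "U \<subseteq> span B" "card B = dim U"
    using basis_exists by blast
  have "span B \<subseteq> U" using B(1) U(1) by (rule span_minimal)
  then have "v \<notin> span B" using v(2) by blast
  then have ind: "independent (insert v B)" using B(2) by (simp add: independent_insert)
  obtain C where C: "insert v B \<subseteq> C" "C \<subseteq> V" "independent C" "V \<subseteq> span C"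
    using maximal_independent_subset_extend[of "insert v B" V] B(1) U(2) v(1) ind by blast
  have fin: "finite C" using independent_span_bound[OF V(2) C(3)] C(2) V(1) by blast
  have "card C = dim V" by (rule basis_card_eq_dim[OF C(2,4,3)])
  moreover have "card (insert v B) \<le> card C" by (rule card_mono[OF fin C(1)])
  moreover have "v \<notin> B" using \<open>v \<notin> span B\<close> span_base[of v B] by auto
  moreover have "finite B" by (rule finite_subset[OF _ fin]) (use C(1) in auto)
  ultimately show ?thesis using B(4) by simp
qed

end

context trigonal
begin

lemma wt_mul:
  assumes "S \<noteq> (0, 0, 0)" "T \<noteq> (0, 0, 0)"
  shows "mul S T \<noteq> (0, 0, 0)" "wt (mul S T) = wt S + wt T"
proof -
  have nz: "norm3 (mul S T) \<noteq> 0"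
    unfolding norm3_mul using norm3_wt(1)[OF assms(1)] norm3_wt(1)[OF assms(2)] by simp
  moreover have "norm3 (0, 0, 0) = 0" by simp
  ultimately show "mul S T \<noteq> (0, 0, 0)" by metis
  then have "wt (mul S T) = degree (norm3 S * norm3 T)" using norm3_wt(2) norm3_mul by metis
  also have "\<dots> = wt S + wt T"
    using norm3_wt[OF assms(1)] norm3_wt[OF assms(2)] by (simp add: degree_mult_eq)
  finally show "wt (mul S T) = wt S + wt T" .
qed

fun pow :: "'k triple \<Rightarrow> nat \<Rightarrow> 'k triple" where
  "pow T 0 = (1, 0, 0)"
| "pow T (Suc i) = mul T (pow T i)"

lemma ev_pow: "w \<in> curve \<Longrightarrow> ev (pow T i) w = ev T w ^ i"
proof (induction i)
  case 0
  then show ?case by (cases w) simp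
qed (simp add: ev_mul)

lemma wt_pow: "T \<noteq> (0, 0, 0) \<Longrightarrow> pow T i \<noteq> (0, 0, 0) \<and> wt (pow T i) = i * wt T"
  by (induction i) (auto simp: wt_mul)

text \<open>If \<open>f \<tau> ^ (i - j)\<close> is regular at infinity, then \<open>f\<close> has a pole of order at most \<open>i - j\<close> there.\<close>

lemma pole_bound:
  assumes u: "regular_at (k + 5) X u Pinf"
    and eq: "near (k + 5) X Pinf (\<lambda>R. R \<noteq> Pinf \<longrightarrow> f R * \<tau> R ^ i = u R * \<tau> R ^ j)"
    and f: "\<And>w. w \<in> curve \<Longrightarrow> f (point (emb w)) = ev T w" and T: "T \<noteq> (0, 0, 0)"
  shows "wt T + j \<le> i"
proof -
  have "\<exists>A B. finite {w \<in> curve. u (point (emb w)) * ev B w \<noteq> ev A w} \<and>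
      B \<noteq> (0, 0, 0) \<and> wt A \<le> wt B"
    by (rule local_fraction[OF u]) blast
  then obtain A B where fin: "finite {w \<in> curve. u (point (emb w)) * ev B w \<noteq> ev A w}"
    and B: "B \<noteq> (0, 0, 0)" and wt: "wt A \<le> wt B"
    by blast
  define Y where "Y = (0 :: 'k poly, [:0, 1:] :: 'k poly, 0 :: 'k poly)"
  define Z where "Z = (monom 1 (k + 2) :: 'k poly, 0 :: 'k poly, 0 :: 'k poly)"
  have Y: "Y \<noteq> (0, 0, 0)" "wt Y = 3 * k + 5" by (simp_all add: Y_def)
  have Z: "Z \<noteq> (0, 0, 0)" "wt Z = 3 * k + 6"
    by (simp_all add: Z_def degree_monom_eq monom_eq_0_iff del: add_2_eq_Suc')
  have evYZ: "ev Y (x, y, z) = x * y" "ev Z (x, y, z) = x ^ (k + 2)" for x y z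
    by (simp_all add: Y_def Z_def poly_monom del: add_2_eq_Suc')
  \<comment> \<open>With \<open>\<tau> = Y / Z\<close> and \<open>u = A / B\<close>, clearing
    denominators in \<open>f \<tau>^i = u \<tau>^j\<close> gives \<open>L = M\<close>. As
    \<open>wt Z = wt Y + 1\<close>, comparing weights yields
    \<open>wt T + wt B + j = wt A + i\<close>.\<close>
  define L where "L = mul (mul T B) (mul (pow Y i) (pow Z j))"
  define M where "M = mul A (mul (pow Y j) (pow Z i))"
  have "L = M"
  proof (rule ev_eq_cofinite, rule finite_subset[OF _ finite_UnI[OF fin
      finite_UnI[OF finite_curve_exceptions[OF eq] finite_fibre[of 0]]]], rule subsetI, rule ccontr)
    fix w assume w: "w \<in> {w \<in> curve. ev L w \<noteq> ev M w}"
      and ne: "w \<notin> {w \<in> curve. u (point (emb w)) * ev B w \<noteq> ev A w} \<union>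
         ({w \<in> curve. \<not> (point (emb w) \<noteq> Pinf \<longrightarrow> f (point (emb w)) * \<tau> (point (emb w)) ^ i =
             u (point (emb w)) * \<tau> (point (emb w)) ^ j)} \<union> {w \<in> curve. fst w = 0})"
    obtain x y z where xyz: "w = (x, y, z)" by (cases w)
    have c: "w \<in> curve" using w by simp
    have x: "x ^ (k + 2) \<noteq> 0" using ne c xyz by auto
    define s t where "s = x * y" and "t = x ^ (k + 2)"
    have t0: "t \<noteq> 0" unfolding t_def by (rule x)
    have tau: "\<tau> (point (emb w)) = s / t" unfolding xyz tau_emb s_def t_def ..
    have A: "ev A w = u (point (emb w)) * ev B w" using ne c by simp
    have "f (point (emb w)) * \<tau> (point (emb w)) ^ i = u (point (emb w)) * \<tau> (point (emb w)) ^ j"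
      using ne c Pinf_not_emb[of w] by simp
    then have "ev T w * (s / t) ^ i = u (point (emb w)) * (s / t) ^ j"
      unfolding f[OF c] tau .
    then have e: "ev T w * s ^ i * t ^ j = u (point (emb w)) * s ^ j * t ^ i"
      using t0 by (simp add: power_divide field_simps)
    have YZ: "ev Y w = s" "ev Z w = t" unfolding xyz evYZ s_def t_def by auto
    have "ev L w = ev T w * s ^ i * t ^ j * ev B w"
      unfolding L_def ev_mul[OF c] ev_pow[OF c] YZ by (simp add: mult_ac)
    also have "\<dots> = ev M w"
      unfolding M_def ev_mul[OF c] ev_pow[OF c] YZ A e by (simp add: mult_ac)
    finally show False using w by simp
  qed
  have L: "L \<noteq> (0, 0, 0)" "wt L = wt T + wt B + (i * (3 * k + 5) + j * (3 * k + 6))"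
    unfolding L_def using T B Y Z wt_mul wt_pow by auto
  have "A \<noteq> (0, 0, 0)"
  proof
    assume "A = (0, 0, 0)"
    then have "M = (0, 0, 0)" unfolding M_def by (cases "mul (pow Y j) (pow Z i)") simp
    then show False using L(1) \<open>L = M\<close> by simp
  qed
  then have "wt M = wt A + (j * (3 * k + 5) + i * (3 * k + 6))"
    unfolding M_def using Y Z wt_mul wt_pow by auto
  then have "wt T + wt B + (i * (3 * k + 5) + j * (3 * k + 6)) = wt A + (j * (3 * k + 5) + i * (3 * k + 6))"
    using L(2) \<open>L = M\<close> by simp
  then show ?thesis using wt by (simp add: algebra_simps)
qed

lemma near_tau_nonzero: "near (k + 5) X Pinf (\<lambda>R. R \<noteq> Pinf \<longrightarrow> \<tau> R \<noteq> 0)"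
  by (rule near_infinity) (simp_all add: tau_emb)

text \<open>The uniformizer \<open>t\<close> in \<open>ord_ge\<close> is arbitrary, so it is
  compared with \<open>\<tau>\<close>. For \<open>m \<ge> 0\<close> powers of
  \<open>\<tau> / t\<close> have to be regular, for \<open>m < 0\<close> those of
  \<open>t / \<tau>\<close>.\<close>

lemma ord_ge_imp_wt_le:
  assumes ord: "ord_ge (k + 5) X Pinf f (- m)"
    and f: "\<And>w. w \<in> curve \<Longrightarrow> f (point (emb w)) = ev T w" and T: "T \<noteq> (0, 0, 0)"
  shows "int (wt T) \<le> m"
proof -
  obtain t u where gen: "generate_maximal_ideal (k + 5) X Pinf 1 (\<lambda>_. t)"
    and u: "regular_at (k + 5) X u Pinf"
    and eq: "near (k + 5) X Pinf (\<lambda>R. R \<noteq> Pinf \<longrightarrow> f R = u R * t R powi (- m))"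
    using ord unfolding ord_ge_def by blast
  obtain c where c: "regular_at (k + 5) X c Pinf" "near (k + 5) X Pinf (\<lambda>R. \<tau> R = c R * t R)"
    using gen regular_tau tau_Pinf unfolding generate_maximal_ideal_1 by blast
  obtain c' where c': "regular_at (k + 5) X c' Pinf" "near (k + 5) X Pinf (\<lambda>R. t R = c' R * \<tau> R)"
    using gen generate_infinity unfolding generate_maximal_ideal_1 by blast
  show ?thesis
  proof (cases "0 \<le> m")
    case True
    then obtain i where i: "m = int i" using nonneg_int_cases by blast
    have "wt T + 0 \<le> i"
    proof (rule pole_bound[OF _ _ f T])
      show "regular_at (k + 5) X (\<lambda>R. u R * c R ^ i) Pinf"
        by (intro regular_at_mult regular_at_power u c)
      show "near (k + 5) X Pinf (\<lambda>R. R \<noteq> Pinf \<longrightarrow> f R * \<tau> R ^ i = u R * c R ^ i * \<tau> R ^ 0)"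
      proof (rule near_mono[OF near_conj[OF eq near_conj[OF c(2) near_tau_nonzero]]], intro impI)
        fix R assume a: "(R \<noteq> Pinf \<longrightarrow> f R = u R * t R powi - m) \<and> \<tau> R = c R * t R \<and> (R \<noteq> Pinf \<longrightarrow> \<tau> R \<noteq> 0)"
          and "R \<noteq> Pinf"
        then have e: "f R = u R * t R powi - int i" "\<tau> R = c R * t R" "\<tau> R \<noteq> 0" using i by auto
        then have "t R \<noteq> 0" by auto
        then have "t R powi - int i * t R ^ i = 1" by (simp add: power_int_minus)
        then show "f R * \<tau> R ^ i = u R * c R ^ i * \<tau> R ^ 0"
          unfolding e(1,2) by (simp add: power_mult_distrib mult_ac)
      qed
    qed
    then show ?thesis using i by simp
  next
    case False
    then obtain j where j: "- m = int j" using nonneg_int_cases[of "- m"] by auto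
    have "wt T + j \<le> 0"
    proof (rule pole_bound[OF _ _ f T])
      show "regular_at (k + 5) X (\<lambda>R. u R * c' R ^ j) Pinf"
        by (intro regular_at_mult regular_at_power u c')
      show "near (k + 5) X Pinf (\<lambda>R. R \<noteq> Pinf \<longrightarrow> f R * \<tau> R ^ 0 = u R * c' R ^ j * \<tau> R ^ j)"
        by (rule near_mono[OF near_conj[OF eq c'(2)]]) (simp add: j power_mult_distrib)
    qed
    then show ?thesis using j by linarith
  qed
qed

lemma ord_ge_fn:
  assumes "wt T \<le> m"
  shows "ord_ge (k + 5) X Pinf (fn T) (- int m)"
proof -
  obtain p q r where T: "T = (p, q, r)" by (cases T)
  define \<rho> where "\<rho> = (\<lambda>R. fa R * fb R ^ 2)"
  have rho: "regular_at (k + 5) X \<rho> Pinf" unfolding \<rho>_def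
    by (intro regular_at_mult regular_at_power regular_fa regular_fb)
  \<comment> \<open>Substituting \<open>x = \<rho> / \<tau>^3\<close>,
    \<open>y = \<tau> * x^(k+1)\<close> and \<open>z = \<tau>^2 * x^(k+2) / fb\<close> turns each
    term times \<open>\<tau>^m\<close> into a regular function. The exponents of
    \<open>\<tau>\<close> are \<open>m\<close> minus the pole orders \<open>3 i\<close>,
    \<open>3 i + 3 k + 2\<close>, \<open>3 i + 3 k + 4\<close>, so the weight bound keeps the
    truncated subtractions exact for nonzero components.\<close>
  define u where "u = (\<lambda>R. (\<Sum>i\<le>degree p. poly.coeff p i * (\<tau> R ^ (m - 3 * i) * \<rho> R ^ i)) +
    (\<Sum>i\<le>degree q. poly.coeff q i * (\<tau> R ^ (m + 1 - 3 * (i + k + 1)) * \<rho> R ^ (i + k + 1))) +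
    (\<Sum>i\<le>degree r. poly.coeff r i * (\<tau> R ^ (m + 2 - 3 * (i + k + 2)) * \<rho> R ^ (i + k + 2))) * inverse (fb R))"
  have "regular_at (k + 5) X u Pinf" unfolding u_def
    by (intro regular_at_add regular_at_mult regular_at_sum regular_at_const regular_at_power
        regular_at_inverse regular_tau rho regular_fb fb_Pinf Pinf_in_X) auto
  moreover have "near (k + 5) X Pinf (\<lambda>R. R \<noteq> Pinf \<longrightarrow> fn T R = u R * \<tau> R powi (- int m))"
  proof (rule near_infinity)
    fix x y z assume c: "(x, y, z) \<in> curve" "x \<noteq> 0" "y \<noteq> 0" "z \<noteq> 0" "poly a x \<noteq> 0" "poly b x \<noteq> 0"
    define R where "R = point (emb (x, y, z))"
    define t where "t = \<tau> R"
    have t: "t = x * y / x ^ (k + 2)" unfolding t_def R_def tau_emb ..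
    have t0: "t \<noteq> 0" unfolding t using c by simp
    have fb: "fb R = poly b x / x ^ k" unfolding R_def by (rule fb_emb[OF c(2)])
    have ty: "t * x ^ (k + 1) = y" using c by (simp add: t)
    have tz: "t ^ 2 * x ^ (k + 2) * inverse (fb R) = z"
    proof -
      have "t ^ 2 * x ^ (k + 2) * inverse (fb R) = (t * x ^ (k + 1)) ^ 2 / poly b x"
        using c by (simp add: fb field_simps power2_eq_square)
      then show ?thesis using curveD(1)[OF c(1)] c(6) by (simp only: ty) simp
    qed
    have rho_eq: "\<rho> R = t ^ 3 * x"
    proof -
      have "t ^ 3 * x * x ^ (3 * k + 2) = (t * x ^ (k + 1)) ^ 3"
        by (simp add: power_mult_distrib mult_ac flip: power_mult power_Suc power_add)
          (simp add: algebra_simps power_add power3_eq_cube power2_eq_square)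
      also have "\<dots> = poly a x * poly b x ^ 2" unfolding ty by (rule curveD(4)[OF c(1)])
      also have "\<dots> = \<rho> R * x ^ (3 * k + 2)"
        unfolding \<rho>_def R_def fa_emb fb_emb[OF c(2)] using c
        by (simp add: field_simps power_add power2_eq_square power3_eq_cube power_mult mult_ac)
      finally show ?thesis using c by simp
    qed
    have mon: "t ^ l * x ^ e = t ^ (l - 3 * e) * \<rho> R ^ e" if "3 * e \<le> l" for l e
    proof -
      have "t ^ l = t ^ (l - 3 * e) * (t ^ 3) ^ e"
        using that by (simp flip: power_mult power_add)
      then show ?thesis unfolding rho_eq power_mult_distrib by (simp add: mult.assoc)
    qed
    have P: "poly p x * t ^ m = (\<Sum>i\<le>degree p. poly.coeff p i * (t ^ (m - 3 * i) * \<rho> R ^ i))"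
      unfolding poly_altdef sum_distrib_right
    proof (rule sum.cong[OF refl])
      fix i assume "i \<in> {..degree p}"
      then have "3 * i \<le> m" using assms unfolding T wt_le_iff by auto
      from mon[OF this] show "poly.coeff p i * x ^ i * t ^ m = poly.coeff p i * (t ^ (m - 3 * i) * \<rho> R ^ i)"
        by (simp add: mult_ac)
    qed
    have Q: "poly q x * y * t ^ m =
        (\<Sum>i\<le>degree q. poly.coeff q i * (t ^ (m + 1 - 3 * (i + k + 1)) * \<rho> R ^ (i + k + 1)))"
      unfolding poly_altdef sum_distrib_right
    proof (rule sum.cong[OF refl])
      fix i assume i: "i \<in> {..degree q}"
      show "poly.coeff q i * x ^ i * y * t ^ m =
          poly.coeff q i * (t ^ (m + 1 - 3 * (i + k + 1)) * \<rho> R ^ (i + k + 1))"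
      proof (cases "q = 0")
        case False
        then have "3 * (i + k + 1) \<le> m + 1" using assms i unfolding T wt_le_iff by auto
        from mon[OF this] have "t ^ (m + 1 - 3 * (i + k + 1)) * \<rho> R ^ (i + k + 1) =
            t ^ m * x ^ i * (t * x ^ (k + 1))"
          by (simp only: power_add power_one_right mult_ac)
        then show ?thesis unfolding ty by (simp add: mult_ac)
      qed simp
    qed
    have Z: "poly r x * z * t ^ m = (\<Sum>i\<le>degree r. poly.coeff r i *
        (t ^ (m + 2 - 3 * (i + k + 2)) * \<rho> R ^ (i + k + 2))) * inverse (fb R)"
      unfolding poly_altdef sum_distrib_right
    proof (rule sum.cong[OF refl])
      fix i assume i: "i \<in> {..degree r}"
      show "poly.coeff r i * x ^ i * z * t ^ m =
          poly.coeff r i * (t ^ (m + 2 - 3 * (i + k + 2)) * \<rho> R ^ (i + k + 2)) * inverse (fb R)"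
      proof (cases "r = 0")
        case False
        then have le: "3 * (i + k + 2) \<le> m + 2" using assms i unfolding T wt_le_iff by auto
        have "t ^ (m + 2 - 3 * (i + k + 2)) * \<rho> R ^ (i + k + 2) * inverse (fb R) =
            t ^ m * x ^ i * (t ^ 2 * x ^ (k + 2) * inverse (fb R))"
          unfolding mon[OF le, symmetric] by (simp only: power_add mult_ac)
        then show ?thesis unfolding tz by (simp add: mult_ac)
      qed simp
    qed
    have "ev T (x, y, z) * t ^ m = u R"
      unfolding u_def t_def[symmetric] P[symmetric] Q[symmetric] Z[symmetric] T
      by (simp add: algebra_simps)
    then have "ev T (x, y, z) = u R * \<tau> R powi (- int m)"
      using t0 unfolding t_def by (simp add: power_int_minus field_simps)
    then have "fn T R = u R * \<tau> R powi (- int m)" unfolding R_def fn_emb[OF c(1)] .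
    then show "point (emb (x, y, z)) \<noteq> Pinf \<longrightarrow> fn T (point (emb (x, y, z))) =
        u (point (emb (x, y, z))) * \<tau> (point (emb (x, y, z))) powi - int m"
      unfolding R_def by blast
  qed simp
  ultimately show ?thesis using generate_infinity unfolding ord_ge_def by blast
qed

text \<open>The zero triple has weight 0 by convention but belongs to every space, also for negative
  \<open>m\<close>; hence it is listed separately.\<close>

lemma H0_eq: "H0 (k + 5) X Pinf m = fn ` {T. T = (0, 0, 0) \<or> int (wt T) \<le> m}"
proof (intro set_eqI iffI)
  fix f assume f: "f \<in> H0 (k + 5) X Pinf m"
  then have "regular_at (k + 5) X f (point (emb w))" if "w \<in> curve" for w
    using point_emb_in_X[OF that] Pinf_not_emb[of w] unfolding H0_def by auto
  then obtain T where T: "\<And>w. w \<in> curve \<Longrightarrow> f (point (emb w)) = ev T w"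
    using regular_on_affine by blast
  have "f = fn T" by (rule fn_eqI) (use f T in \<open>auto simp: H0_def\<close>)
  moreover have "T = (0, 0, 0) \<or> int (wt T) \<le> m"
    using ord_ge_imp_wt_le[of f m T] f T unfolding H0_def by blast
  ultimately show "f \<in> fn ` {T. T = (0, 0, 0) \<or> int (wt T) \<le> m}" by blast
next
  fix f assume "f \<in> fn ` {T. T = (0, 0, 0) \<or> int (wt T) \<le> m}"
  then obtain T where T: "f = fn T" "T = (0, 0, 0) \<or> int (wt T) \<le> m" by blast
  have "ord_ge (k + 5) X Pinf (fn T) (- m)"
  proof (cases "T = (0, 0, 0)")
    case True
    have z: "fn T R = 0" for R unfolding fn_def True by simp
    have "near (k + 5) X Pinf (\<lambda>R. R \<noteq> Pinf \<longrightarrow> fn T R = 0 * \<tau> R powi - m)"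
      by (rule near_true[OF Pinf_in_X]) (simp add: z)
    then show ?thesis unfolding ord_ge_def
      using generate_infinity regular_at_const[OF Pinf_in_X, of 0] by blast
  next
    case False
    then have "wt T \<le> nat m" "0 \<le> m" using T(2) by linarith+
    then show ?thesis using ord_ge_fn[of T "nat m"] by simp
  qed
  moreover have "regular_at (k + 5) X (fn T) Q" if Q: "Q \<in> X - {Pinf}" for Q
  proof -
    obtain w where "w \<in> curve" "Q = point (emb w)" using Q unfolding X_def by blast
    then show ?thesis using regular_fn by simp
  qed
  ultimately show "f \<in> H0 (k + 5) X Pinf m" unfolding H0_def T(1) using fn_outside by blast
qed

lemma fn_inj: "fn S = fn T \<Longrightarrow> S = T"
proof (rule ev_eq_cofinite)
  assume "fn S = fn T"
  then have "ev S w = ev T w" if "w \<in> curve" for w using fn_emb[OF that] by metis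
  then have "{w \<in> curve. ev S w \<noteq> ev T w} = {}" by blast
  then show "finite {w \<in> curve. ev S w \<noteq> ev T w}" by (simp only: finite.emptyI)
qed

lemma fn_add: "fn (p, q, r) R + fn (p', q', r') R = fn (p + p', q + q', r + r') R"
  unfolding fn_def by (auto simp: algebra_simps)

lemma fn_scale: "c * fn (p, q, r) R = fn (smult c p, smult c q, smult c r) R"
  unfolding fn_def by (auto simp: algebra_simps)

lemma in_H0E:
  assumes "f \<in> H0 (k + 5) X Pinf m"
  obtains p q r where "f = fn (p, q, r)" "(p, q, r) = (0, 0, 0) \<or> int (wt (p, q, r)) \<le> m"
proof -
  obtain T where T: "f = fn T" "T = (0, 0, 0) \<or> int (wt T) \<le> m" using assms unfolding H0_eq by blast
  show thesis by (rule that[of "fst T" "fst (snd T)" "snd (snd T)"]) (use T in simp_all)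
qed

lemma in_H0I: "T = (0, 0, 0) \<or> int (wt T) \<le> m \<Longrightarrow> fn T \<in> H0 (k + 5) X Pinf m"
  unfolding H0_eq by blast

lemma subspace_H0: "fun_space.subspace (H0 (k + 5) X Pinf m)"
proof (rule fun_space.subspaceI)
  have "0 = fn (0, 0, 0)" by (rule ext) (simp add: fn_def)
  then show "0 \<in> H0 (k + 5) X Pinf m" unfolding H0_eq by blast
next
  fix f g assume "f \<in> H0 (k + 5) X Pinf m" "g \<in> H0 (k + 5) X Pinf m"
  then obtain p q r p' q' r' where f: "f = fn (p, q, r)" "(p, q, r) = (0, 0, 0) \<or> int (wt (p, q, r)) \<le> m"
    and g: "g = fn (p', q', r')" "(p', q', r') = (0, 0, 0) \<or> int (wt (p', q', r')) \<le> m"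
    by (elim in_H0E)
  have "f + g = fn (p + p', q + q', r + r')" unfolding f g by (simp add: fun_eq_iff fn_add)
  moreover have "(p + p', q + q', r + r') = (0, 0, 0) \<or> int (wt (p + p', q + q', r + r')) \<le> m"
  proof (cases "0 \<le> m")
    case True
    have "wt (0, 0, 0) \<le> nat m" by simp
    then have "wt (p, q, r) \<le> nat m" "wt (p', q', r') \<le> nat m" using f(2) g(2) True by (metis le_nat_iff)+
    then have "wt (p + p', q + q', r + r') \<le> nat m"
      unfolding wt_le_iff using degree_add_le_max[of p p'] degree_add_le_max[of q q'] degree_add_le_max[of r r']
      by (auto simp: max_def split: if_splits)
    then have "int (wt (p + p', q + q', r + r')) \<le> m" by (simp only: le_nat_iff[OF True])
    then show ?thesis by (rule disjI2)
  qed (use f(2) g(2) in auto)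
  ultimately show "f + g \<in> H0 (k + 5) X Pinf m" using in_H0I by simp
next
  fix c f assume "f \<in> H0 (k + 5) X Pinf m"
  then obtain p q r where f: "f = fn (p, q, r)" "(p, q, r) = (0, 0, 0) \<or> int (wt (p, q, r)) \<le> m"
    by (rule in_H0E)
  have "(\<lambda>R. c * f R) = fn (smult c p, smult c q, smult c r)" unfolding f by (simp add: fun_eq_iff fn_scale)
  moreover have "(smult c p, smult c q, smult c r) = (0, 0, 0) \<or> int (wt (smult c p, smult c q, smult c r)) \<le> m"
    using f(2) by (cases "c = 0") auto
  ultimately show "(\<lambda>R. c * f R) \<in> H0 (k + 5) X Pinf m" using in_H0I by simp
qed

definition monomials :: "nat \<Rightarrow> 'k triple set" where
  "monomials m = (\<lambda>i. (monom 1 i, 0, 0)) ` {..m} \<union> (\<lambda>i. (0, monom 1 i, 0)) ` {..m} \<union>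
     (\<lambda>i. (0, 0, monom 1 i)) ` {..m}"

text \<open>What counts is that the spanning set is finite; exponents up to \<open>m\<close> are a
  crude bound.\<close>

lemma H0_subset_span: "H0 (k + 5) X Pinf (int m) \<subseteq> fun_space.span (fn ` monomials m)"
proof
  fix f assume "f \<in> H0 (k + 5) X Pinf (int m)"
  then obtain p q r where f: "f = fn (p, q, r)" "(p, q, r) = (0, 0, 0) \<or> int (wt (p, q, r)) \<le> int m"
    by (rule in_H0E)
  have "wt (0, 0, 0) \<le> m" by simp
  with f(2) have w: "wt (p, q, r) \<le> m" by (metis of_nat_le_iff)
  have dp: "degree p \<le> m" "degree q \<le> m" "degree r \<le> m" using w unfolding wt_le_iff by auto
  have sum_apply: "(\<Sum>i\<in>I. h i) R = (\<Sum>i\<in>I. h i R)" for I :: "nat set" and h :: "nat \<Rightarrow> 'k ppoint \<Rightarrow> 'k" and R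
    by (induction I rule: infinite_finite_induct) simp_all
  have span: "(\<lambda>R. \<Sum>i\<le>degree s. poly.coeff s i * g i R) \<in> fun_space.span (fn ` monomials m)"
    if "\<And>i. i \<le> m \<Longrightarrow> g i \<in> fn ` monomials m" "degree s \<le> m" for s g
  proof -
    have "(\<Sum>i\<le>degree s. (\<lambda>R. poly.coeff s i * g i R)) \<in> fun_space.span (fn ` monomials m)"
      by (intro fun_space.span_sum fun_space.span_scale fun_space.span_base that) (use that in auto)
    moreover have "(\<Sum>i\<le>degree s. (\<lambda>R. poly.coeff s i * g i R)) = (\<lambda>R. \<Sum>i\<le>degree s. poly.coeff s i * g i R)"
      by (rule ext) (rule sum_apply)
    ultimately show ?thesis by simp
  qed
  have "f = (\<lambda>R. \<Sum>i\<le>degree p. poly.coeff p i * fn (monom 1 i, 0, 0) R) +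
     (\<lambda>R. \<Sum>i\<le>degree q. poly.coeff q i * fn (0, monom 1 i, 0) R) +
     (\<lambda>R. \<Sum>i\<le>degree r. poly.coeff r i * fn (0, 0, monom 1 i) R)"
    unfolding f fun_eq_iff plus_fun_apply fn_def
    by (auto simp: poly_altdef[of p] poly_altdef[of q] poly_altdef[of r] poly_monom sum_distrib_right mult.assoc)
  moreover have "\<dots> \<in> fun_space.span (fn ` monomials m)"
    by (intro fun_space.span_add span dp) (auto simp: monomials_def)
  ultimately show "f \<in> fun_space.span (fn ` monomials m)" by simp
qed

lemma wt_values: "3 dvd wt T \<or> 3 * k + 2 \<le> wt T"
  by (cases T) (auto simp: max_def)

lemma wt_surj:
  assumes "3 dvd n \<or> 3 * k + 2 \<le> n"
  shows "\<exists>T. T \<noteq> (0, 0, 0) \<and> wt T = n"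
proof -
  consider i where "n = 3 * i" | i where "n = 3 * i + 3 * k + 2" | i where "n = 3 * i + 3 * k + 4"
  proof (cases "3 dvd n")
    case True
    then show thesis using that(1) by (auto elim: dvdE)
  next
    case False
    then have "3 * k + 2 \<le> n" using assms by simp
    then obtain j where j: "n = 3 * k + 2 + j" using le_Suc_ex by blast
    then have "j mod 3 = 0 \<or> j mod 3 = 2" using False by presburger
    then show thesis
    proof
      assume "j mod 3 = 0"
      then have "n = 3 * (j div 3) + 3 * k + 2" using j by presburger
      then show thesis by (rule that(2))
    next
      assume "j mod 3 = 2"
      then have "n = 3 * (j div 3) + 3 * k + 4" using j by presburger
      then show thesis by (rule that(3))
    qed
  qed
  then show ?thesis
  proof cases
    case (1 i)
    then show ?thesis by (intro exI[of _ "(monom 1 i, 0, 0)"]) (simp add: degree_monom_eq monom_eq_0_iff)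
  next
    case (2 i)
    then show ?thesis by (intro exI[of _ "(0, monom 1 i, 0)"]) (simp add: degree_monom_eq monom_eq_0_iff)
  next
    case (3 i)
    then show ?thesis by (intro exI[of _ "(0, 0, monom 1 i)"]) (simp add: degree_monom_eq monom_eq_0_iff)
  qed
qed

text \<open>If no triple has weight \<open>n\<close>, the two spaces coincide; a triple of weight
  \<open>n\<close> belongs to the larger one only. For \<open>n = 0\<close> the smaller space is
  zero and the constants account for the jump.\<close>

lemma weierstrass_semigroup_Pinf:
  "weierstrass_semigroup_at (k + 5) X Pinf = {n. 3 dvd n \<or> 3 * k + 2 \<le> n}"
proof (intro set_eqI iffI)
  fix n assume n: "n \<in> weierstrass_semigroup_at (k + 5) X Pinf"
  show "n \<in> {n. 3 dvd n \<or> 3 * k + 2 \<le> n}"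
  proof (rule ccontr)
    assume "n \<notin> {n. 3 dvd n \<or> 3 * k + 2 \<le> n}"
    then have "wt T \<noteq> n" for T using wt_values[of T] by auto
    then have "int (wt T) \<le> int n - 1 \<longleftrightarrow> int (wt T) \<le> int n" for T
      by (metis int_eq_iff le_less zle_diff1_eq of_nat_eq_iff)
    then have "H0 (k + 5) X Pinf (int n - 1) = H0 (k + 5) X Pinf (int n)" unfolding H0_eq by simp
    then show False using n unfolding weierstrass_semigroup_at_def by simp
  qed
next
  fix n assume "n \<in> {n. 3 dvd n \<or> 3 * k + 2 \<le> n}"
  then obtain T where T: "T \<noteq> (0, 0, 0)" "wt T = n" using wt_surj by blast
  have "fun_space.dim (H0 (k + 5) X Pinf (int n - 1)) < fun_space.dim (H0 (k + 5) X Pinf (int n))"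
  proof (rule fun_space.dim_less_dim[OF subspace_H0])
    show "H0 (k + 5) X Pinf (int n - 1) \<subseteq> H0 (k + 5) X Pinf (int n)" unfolding H0_eq by auto
    show "fn T \<in> H0 (k + 5) X Pinf (int n)" unfolding H0_eq using T by auto
    show "fn T \<notin> H0 (k + 5) X Pinf (int n - 1)"
    proof
      assume "fn T \<in> H0 (k + 5) X Pinf (int n - 1)"
      then obtain S where "fn T = fn S" "S = (0, 0, 0) \<or> int (wt S) \<le> int n - 1" unfolding H0_eq by blast
      then show False using T fn_inj[of T S] by auto
    qed
    show "H0 (k + 5) X Pinf (int n) \<subseteq> fun_space.span (fn ` monomials n)" by (rule H0_subset_span)
    show "finite (fn ` monomials n)" by (simp add: monomials_def)
  qed
  then show "n \<in> weierstrass_semigroup_at (k + 5) X Pinf" unfolding weierstrass_semigroup_at_def by simp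
qed

end

section \<open>An explicit pair of polynomials\<close>

lemma simple_roots_prod:
  fixes I :: "nat set"
  assumes "finite I" and eq: "(\<Prod>i\<in>I. [:- of_nat i, 1:]) = [:- x, 1:] * c"
  shows "poly c (x :: 'k::field_char_0) \<noteq> 0"
proof -
  have "poly (\<Prod>i\<in>I. [:- of_nat i, 1:]) x = 0" unfolding eq by simp
  then obtain i where i: "i \<in> I" "x = of_nat i" using assms(1) by (auto simp: poly_prod)
  have "(\<Prod>i\<in>I. [:- of_nat i, 1:]) = [:- x, 1:] * (\<Prod>j\<in>I - {i}. [:- of_nat j, 1:])"
    using assms(1) i by (simp add: prod.remove)
  then have "c = (\<Prod>j\<in>I - {i}. [:- of_nat j, 1:])" using eq mult_left_cancel[of "[:- x, 1:]"] by simp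
  then show ?thesis using assms(1) i(2) by (auto simp: poly_prod)
qed

lemma weierstrass_semigroup_three:
  "weierstrass_semigroup TYPE('k::{alg_closed_field, field_char_0}) {n. 3 dvd n \<or> 3 * k + 2 \<le> n}"
proof -
  define p where "p = (\<lambda>I. \<Prod>i\<in>I. [:- of_nat i, 1:] :: 'k poly)"
  have deg: "degree (p I) = card I" for I
    unfolding p_def by (cases "finite I") (simp_all add: degree_prod_eq_sum_degree)
  have root: "poly (p I) x = 0 \<longleftrightarrow> (\<exists>i\<in>I. x = of_nat i)" if "finite I" for I x
    unfolding p_def using that by (auto simp: poly_prod)
  \<comment> \<open>The roots are \<open>0, ..., k + 1\<close> and
    \<open>k + 2, ..., 2 * k + 1\<close>, pairwise distinct in characteristic 0.\<close>
  interpret trigonal "p {..<k + 2}" "p {k + 2..<2 * k + 2}" k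
  proof
    fix x assume "poly (p {..<k + 2}) x = 0"
    then obtain i where "i < k + 2" "x = of_nat i" using root by auto
    then show "poly (p {k + 2..<2 * k + 2}) x \<noteq> 0" using root by auto
  next
    fix x c assume "p {..<k + 2} = [:- x, 1:] * c"
    then show "poly c x \<noteq> 0" unfolding p_def by (rule simple_roots_prod[rotated]) simp
  next
    fix x c assume "p {k + 2..<2 * k + 2} = [:- x, 1:] * c"
    then show "poly c x \<noteq> 0" unfolding p_def by (rule simple_roots_prod[rotated]) simp
  qed (simp_all add: deg)
  show ?thesis unfolding weierstrass_semigroup_def
    using smooth_curve Pinf_in_X weierstrass_semigroup_Pinf by blast
qed

theorem corollary4p1:
  fixes H :: "nat set" and g :: nat
  assumes "limit_sparse_semigroup g H"
    and "even (gap H g)"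
  shows "weierstrass_semigroup TYPE('k::{alg_closed_field, field_char_0}) H"
  using limit_sparse_even_structure[OF assms] weierstrass_semigroup_three by auto

end
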